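(* Let $\mathfrak g$ be a complex semisimple Lie algebra with Cartan subalgebra $\mathfrak h$ and root system $R\subset\mathfrak h^*$, and let $V$ be a finite-dimensional $\mathfrak g$-module. For every $h\in\mathbb C$, the one-form $$\nabla_\kappa=d-h\sum_{\alpha\in R}\frac{d\alpha}{\alpha}\cdot\kappa_\alpha$$ defines a flat (holomorphic) connection on the trivial vector bundle $\mathfrak h_{\mathrm{reg}}\times V$ over $\mathfrak h_{\mathrm{reg}}$ with fibre $V$, and this connection is reducible with respect to the weight space decomposition of $V$: for each weight $\mu$ of $V$, it preserves the subbundle $\mathfrak h_{\mathrm{reg}}\times V[\mu]$, where $V[\mu]$ is the weight space of weight $\mu$.
   Context: $\mathfrak h_{\mathrm{reg}}=\mathfrak h\setminus\bigcup_{\alpha\in R}\operatorname{Ker}(\alpha)$ is the set of regular elements of $\mathfrak h$. Let $\langle\cdot,\cdot\rangle$ be a fixed (non-zero) multiple of the Killing form of $\mathfrak g$ (and the induced form on $\mathfrak h^*$). For $\alpha\in R$ choose root vectors $e_\alpha\in\mathfrak g_\alpha$, $f_\alpha\in\mathfrak g_{-\alpha}$ with $[e_\alpha,f_\alpha]=h_\alpha=\alpha^\vee$; the truncated Casimir operator is $\kappa_\alpha=\frac{\langle\alpha,\alpha\rangle}{2}(e_\alpha f_\alpha+f_\alpha e_\alpha)\in U\mathfrak g$, which does not depend on the choice of $e_\alpha,f_\alpha$. It acts on $V$ through the $\mathfrak g$-action. *)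

theory Defs
  imports "HOL-Analysis.Analysis"
begin

section \<open>Finite-dimensional complex vector spaces\<close>

text \<open>
  The norm of the underlying type is auxiliary: on a finite-dimensional space all norms induce the
  same topology and the same notion of derivative. The dimension may be zero.
\<close>

locale fd_complex_space = vector_space sc
  for sc :: "complex \<Rightarrow> 'a::real_normed_vector \<Rightarrow> 'a" +
  assumes scale_of_real: "sc (complex_of_real r) x = r *\<^sub>R x"
    and finite_dimensional: "\<exists>B. finite B \<and> span B = UNIV"
begin

text \<open>The term \<open>extend_basis {}\<close> is a chosen basis of the whole space; the trace does not depend on it.\<close>

definition endo_trace :: "('a \<Rightarrow> 'a) \<Rightarrow> complex" where
  "endo_trace f = (\<Sum>b\<in>extend_basis {}. representation (extend_basis {}) (f b) b)"

text \<open>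
  The linear dual of a subspace \<open>H\<close>. Functionals are extended by zero outside \<open>H\<close>, so that a
  functional on \<open>H\<close> is represented by exactly one function.
\<close>

definition dual_space :: "'a set \<Rightarrow> ('a \<Rightarrow> complex) set" where
  "dual_space H = {\<alpha>. (\<forall>x\<in>H. \<forall>y\<in>H. \<alpha> (x + y) = \<alpha> x + \<alpha> y) \<and>
     (\<forall>c. \<forall>x\<in>H. \<alpha> (sc c x) = c * \<alpha> x) \<and> (\<forall>x. x \<notin> H \<longrightarrow> \<alpha> x = 0)}"

end

text \<open>Simultaneous eigenspace of the operators \<open>\<rho> x\<close>, \<open>x \<in> H\<close>, for the eigenvalue \<open>\<mu>\<close>.\<close>

definition weight_space ::
  "(complex \<Rightarrow> 'v \<Rightarrow> 'v) \<Rightarrow> ('g \<Rightarrow> 'v \<Rightarrow> 'v) \<Rightarrow> 'g set \<Rightarrow> ('g \<Rightarrow> complex) \<Rightarrow> 'v set" where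
  "weight_space sc \<rho> H \<mu> = {v. \<forall>x\<in>H. \<rho> x v = sc (\<mu> x) v}"

section \<open>Lie algebras\<close>

locale lie_algebra = fd_complex_space sc
  for sc :: "complex \<Rightarrow> 'g::real_normed_vector \<Rightarrow> 'g" +
  fixes br :: "'g \<Rightarrow> 'g \<Rightarrow> 'g"
  assumes linear_br_right: "Vector_Spaces.linear sc sc (\<lambda>y. br x y)"
    and linear_br_left: "Vector_Spaces.linear sc sc (\<lambda>x. br x y)"
    and br_self: "br x x = 0"
    and jacobi: "br x (br y z) + br y (br z x) + br z (br x y) = 0"
begin

definition bracket_span :: "'g set \<Rightarrow> 'g set \<Rightarrow> 'g set" where
  "bracket_span A B = span {br x y | x y. x \<in> A \<and> y \<in> B}"

definition lie_subalgebra :: "'g set \<Rightarrow> bool" where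
  "lie_subalgebra A \<longleftrightarrow> subspace A \<and> (\<forall>x\<in>A. \<forall>y\<in>A. br x y \<in> A)"

definition lie_ideal :: "'g set \<Rightarrow> bool" where
  "lie_ideal I \<longleftrightarrow> subspace I \<and> (\<forall>x. \<forall>y\<in>I. br x y \<in> I)"

definition solvable :: "'g set \<Rightarrow> bool" where
  "solvable A \<longleftrightarrow> (\<exists>n. ((\<lambda>D. bracket_span D D) ^^ n) A = {0})"

definition nilpotent :: "'g set \<Rightarrow> bool" where
  "nilpotent A \<longleftrightarrow> (\<exists>n. ((\<lambda>D. bracket_span A D) ^^ n) A = {0})"

text \<open>Vanishing solvable radical; the zero Lie algebra counts as semisimple.\<close>

definition semisimple :: bool where
  "semisimple \<longleftrightarrow> (\<forall>I. lie_ideal I \<and> solvable I \<longrightarrow> I = {0})"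

definition cartan_subalgebra :: "'g set \<Rightarrow> bool" where
  "cartan_subalgebra H \<longleftrightarrow>
     lie_subalgebra H \<and> nilpotent H \<and> {x. \<forall>y\<in>H. br x y \<in> H} = H"

definition killing :: "'g \<Rightarrow> 'g \<Rightarrow> complex" where
  "killing x y = endo_trace (\<lambda>z. br x (br y z))"

definition root_space :: "'g set \<Rightarrow> ('g \<Rightarrow> complex) \<Rightarrow> 'g set" where
  "root_space H \<alpha> = weight_space sc br H \<alpha>"

definition roots :: "'g set \<Rightarrow> ('g \<Rightarrow> complex) set" where
  "roots H = {\<alpha> \<in> dual_space H. (\<exists>x\<in>H. \<alpha> x \<noteq> 0) \<and> root_space H \<alpha> \<noteq> {0}}"

definition regular_elements :: "'g set \<Rightarrow> 'g set" where
  "regular_elements H = {x \<in> H. \<forall>\<alpha>\<in>roots H. \<alpha> x \<noteq> 0}"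

text \<open>
  The parameter \<open>c\<close> is the factor by which the chosen invariant form differs from the Killing form.
  The induced form on the dual of \<open>H\<close> is transported along the isomorphism
  \<open>t \<mapsto> inv_form c t\<close> from \<open>H\<close> to its dual.
\<close>

definition inv_form :: "complex \<Rightarrow> 'g \<Rightarrow> 'g \<Rightarrow> complex" where
  "inv_form c x y = c * killing x y"

definition dual_vector :: "complex \<Rightarrow> 'g set \<Rightarrow> ('g \<Rightarrow> complex) \<Rightarrow> 'g" where
  "dual_vector c H \<alpha> = (THE t. t \<in> H \<and> (\<forall>x\<in>H. inv_form c t x = \<alpha> x))"

definition dual_form :: "complex \<Rightarrow> 'g set \<Rightarrow> ('g \<Rightarrow> complex) \<Rightarrow> ('g \<Rightarrow> complex) \<Rightarrow> complex" where
  "dual_form c H \<alpha> \<beta> = inv_form c (dual_vector c H \<alpha>) (dual_vector c H \<beta>)"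

text \<open>The coroot is independent of \<open>c\<close>: both factors below scale inversely to each other.\<close>

definition coroot :: "complex \<Rightarrow> 'g set \<Rightarrow> ('g \<Rightarrow> complex) \<Rightarrow> 'g" where
  "coroot c H \<alpha> = sc (2 / dual_form c H \<alpha> \<alpha>) (dual_vector c H \<alpha>)"

definition root_vectors ::
  "complex \<Rightarrow> 'g set \<Rightarrow> (('g \<Rightarrow> complex) \<Rightarrow> 'g) \<Rightarrow> (('g \<Rightarrow> complex) \<Rightarrow> 'g) \<Rightarrow> bool" where
  "root_vectors c H e f \<longleftrightarrow> (\<forall>\<alpha>\<in>roots H.
     e \<alpha> \<in> root_space H \<alpha> \<and> f \<alpha> \<in> root_space H (- \<alpha>) \<and> br (e \<alpha>) (f \<alpha>) = coroot c H \<alpha>)"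

end

locale lie_module = lie_algebra sc br + V: fd_complex_space scV
  for sc :: "complex \<Rightarrow> 'g::real_normed_vector \<Rightarrow> 'g"
    and br :: "'g \<Rightarrow> 'g \<Rightarrow> 'g"
    and scV :: "complex \<Rightarrow> 'v::real_normed_vector \<Rightarrow> 'v" +
  fixes \<rho> :: "'g \<Rightarrow> 'v \<Rightarrow> 'v"
  assumes linear_rep: "Vector_Spaces.linear scV scV (\<rho> x)"
    and linear_rep_arg: "Vector_Spaces.linear sc scV (\<lambda>x. \<rho> x v)"
    and rep_br: "\<rho> (br x y) v = \<rho> x (\<rho> y v) - \<rho> y (\<rho> x v)"
begin

definition weights :: "'g set \<Rightarrow> ('g \<Rightarrow> complex) set" where
  "weights H = {\<mu> \<in> dual_space H. weight_space scV \<rho> H \<mu> \<noteq> {0}}"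

text \<open>
  The operator by which the element \<open>\<langle>\<alpha>,\<alpha>\<rangle>/2 (e\<^sub>\<alpha> f\<^sub>\<alpha> + f\<^sub>\<alpha> e\<^sub>\<alpha>)\<close> of the universal enveloping
  algebra acts on the module.
\<close>

definition truncated_casimir ::
  "complex \<Rightarrow> 'g set \<Rightarrow> (('g \<Rightarrow> complex) \<Rightarrow> 'g) \<Rightarrow> (('g \<Rightarrow> complex) \<Rightarrow> 'g) \<Rightarrow>
   ('g \<Rightarrow> complex) \<Rightarrow> 'v \<Rightarrow> 'v" where
  "truncated_casimir c H e f \<alpha> v =
     scV (dual_form c H \<alpha> \<alpha> / 2) (\<rho> (e \<alpha>) (\<rho> (f \<alpha>) v) + \<rho> (f \<alpha>) (\<rho> (e \<alpha>) v))"

text \<open>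
  The End(V)-valued one-form \<open>- h \<Sum>\<^sub>\<alpha> (d\<alpha>/\<alpha>) \<kappa>\<^sub>\<alpha>\<close> at the point \<open>x\<close>, contracted with the tangent
  vector \<open>u\<close>; by linearity of \<open>\<alpha>\<close> on \<open>H\<close>, \<open>d\<alpha>\<close> is constant and equal to \<open>\<alpha>\<close>.
\<close>

definition casimir_form ::
  "complex \<Rightarrow> 'g set \<Rightarrow> (('g \<Rightarrow> complex) \<Rightarrow> 'g) \<Rightarrow> (('g \<Rightarrow> complex) \<Rightarrow> 'g) \<Rightarrow> complex \<Rightarrow>
   'g \<Rightarrow> 'g \<Rightarrow> 'v \<Rightarrow> 'v" where
  "casimir_form c H e f h x u v =
     scV (- h) (\<Sum>\<alpha>\<in>roots H. scV (\<alpha> u / \<alpha> x) (truncated_casimir c H e f \<alpha> v))"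

end

section \<open>Holomorphic connections on trivial vector bundles\<close>

text \<open>
  The base \<open>X\<close> is an open subset of a complex subspace \<open>H\<close> of \<open>'g\<close>, and all tangent spaces are
  identified with \<open>H\<close>. The fibre is \<open>'v\<close>. A connection is given by its connection form \<open>\<omega>\<close>, i.e. it
  is \<open>d + \<omega>\<close>, where \<open>\<omega> x u\<close> is the endomorphism of the fibre assigned to the tangent vector \<open>u\<close>
  at \<open>x\<close>.
\<close>

text \<open>
  Complex Frechet differentiability. Only the values of the differential on \<open>H\<close> are determined,
  and only these are required to be complex linear.
\<close>

definition holomorphic_map ::
  "(complex \<Rightarrow> 'g::real_normed_vector \<Rightarrow> 'g) \<Rightarrow> (complex \<Rightarrow> 'v::real_normed_vector \<Rightarrow> 'v) \<Rightarrow>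
   'g set \<Rightarrow> 'g set \<Rightarrow> ('g \<Rightarrow> 'v) \<Rightarrow> bool" where
  "holomorphic_map sc scV H U s \<longleftrightarrow> (\<forall>x\<in>U. \<exists>D. (s has_derivative D) (at x within U) \<and>
     (\<forall>c. \<forall>u\<in>H. D (sc c u) = scV c (D u)))"

definition holomorphic_connection_form ::
  "(complex \<Rightarrow> 'g::real_normed_vector \<Rightarrow> 'g) \<Rightarrow> (complex \<Rightarrow> 'v::real_normed_vector \<Rightarrow> 'v) \<Rightarrow>
   'g set \<Rightarrow> 'g set \<Rightarrow> ('g \<Rightarrow> 'g \<Rightarrow> 'v \<Rightarrow> 'v) \<Rightarrow> bool" where
  "holomorphic_connection_form sc scV H X \<omega> \<longleftrightarrow>
     openin (top_of_set H) X \<and>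
     (\<forall>x\<in>X. \<forall>u\<in>H. Vector_Spaces.linear scV scV (\<omega> x u)) \<and>
     (\<forall>x\<in>X. \<forall>u\<in>H. \<forall>u'\<in>H. \<forall>v. \<omega> x (u + u') v = \<omega> x u v + \<omega> x u' v) \<and>
     (\<forall>x\<in>X. \<forall>c. \<forall>u\<in>H. \<forall>v. \<omega> x (sc c u) v = scV c (\<omega> x u v)) \<and>
     (\<forall>u\<in>H. \<forall>v. holomorphic_map sc scV H X (\<lambda>x. \<omega> x u v))"

definition covariant_derivative ::
  "('g::real_normed_vector \<Rightarrow> 'g \<Rightarrow> 'v \<Rightarrow> 'v::real_normed_vector) \<Rightarrow>
   'g set \<Rightarrow> ('g \<Rightarrow> 'v) \<Rightarrow> 'g \<Rightarrow> 'g \<Rightarrow> 'v" where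
  "covariant_derivative \<omega> U s x u = frechet_derivative s (at x within U) u + \<omega> x u (s x)"

text \<open>The curvature two-form \<open>d\<omega> + \<omega> \<and> \<omega>\<close>, evaluated at \<open>x\<close> on \<open>u\<close>, \<open>u'\<close> and applied to \<open>v\<close>.\<close>

definition curvature ::
  "('g::real_normed_vector \<Rightarrow> 'g \<Rightarrow> 'v \<Rightarrow> 'v::real_normed_vector) \<Rightarrow>
   'g set \<Rightarrow> 'g \<Rightarrow> 'g \<Rightarrow> 'g \<Rightarrow> 'v \<Rightarrow> 'v" where
  "curvature \<omega> X x u u' v =
     frechet_derivative (\<lambda>y. \<omega> y u' v) (at x within X) u
     - frechet_derivative (\<lambda>y. \<omega> y u v) (at x within X) u'
     + (\<omega> x u (\<omega> x u' v) - \<omega> x u' (\<omega> x u v))"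

definition flat_connection ::
  "'g set \<Rightarrow> 'g set \<Rightarrow> ('g::real_normed_vector \<Rightarrow> 'g \<Rightarrow> 'v \<Rightarrow> 'v::real_normed_vector) \<Rightarrow> bool" where
  "flat_connection H X \<omega> \<longleftrightarrow> (\<forall>x\<in>X. \<forall>u\<in>H. \<forall>u'\<in>H. \<forall>v. curvature \<omega> X x u u' v = 0)"

text \<open>
  The subbundle \<open>X \<times> W\<close> is preserved: covariant derivatives of its local holomorphic sections are
  again sections of it.
\<close>

definition preserves_subbundle ::
  "(complex \<Rightarrow> 'g::real_normed_vector \<Rightarrow> 'g) \<Rightarrow> (complex \<Rightarrow> 'v::real_normed_vector \<Rightarrow> 'v) \<Rightarrow>
   'g set \<Rightarrow> 'g set \<Rightarrow> ('g \<Rightarrow> 'g \<Rightarrow> 'v \<Rightarrow> 'v) \<Rightarrow> 'v set \<Rightarrow> bool" where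
  "preserves_subbundle sc scV H X \<omega> W \<longleftrightarrow>
     (\<forall>U s. openin (top_of_set H) U \<and> U \<subseteq> X \<and> holomorphic_map sc scV H U s \<and> s ` U \<subseteq> W \<longrightarrow>
       (\<forall>x\<in>U. \<forall>u\<in>H. covariant_derivative \<omega> U s x u \<in> W))"

end

theory Submission
  imports Defs "HOL-Computational_Algebra.Fundamental_Theorem_Algebra"
begin

text \<open>
  The curvature of \<open>d + \<omega>\<close> is \<open>d\<omega> + \<omega> \<and> \<omega>\<close>. The forms \<open>d\<alpha>/\<alpha>\<close> are closed and the operators \<open>\<kappa>\<^sub>\<alpha>\<close>
  are constant, so \<open>d\<omega> = 0\<close>, and flatness means that \<open>\<omega>(u)\<close> and \<open>\<omega>(u')\<close> commute at every regular
  point \<open>x\<close>. Attach to each root the point \<open>(p\<^sub>\<alpha>, q\<^sub>\<alpha>) = (\<alpha>(u)/\<alpha>(x), \<alpha>(u')/\<alpha>(x))\<close> of the plane over the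
  complex numbers. The commutator is \<open>h\<^sup>2\<close> times the sum of \<open>p\<^sub>\<alpha> q\<^sub>\<beta> [\<kappa>\<^sub>\<alpha>, \<kappa>\<^sub>\<beta>]\<close> over all pairs of roots. The roots whose
  points lie on a given line are exactly the roots that vanish at one element \<open>l\<close> of the Cartan
  subalgebra, that is, the roots of the centralizer of \<open>l\<close>. The sum of the operators \<open>\<kappa>\<^sub>\<beta>\<close> over such a
  line is twice the Casimir operator of this centralizer, up to a contribution of the Cartan
  subalgebra, so it commutes with each \<open>\<kappa>\<^sub>\<alpha>\<close> of the line (\<open>\<kappa>_commutes_subsystem_sum\<close>). On one line the
  antisymmetrized coefficient is a constant times the difference of two affine parameters, so each
  line contributes zero, and two distinct points lie on exactly one line (\<open>line_sums_cancel\<close>).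

  The Casimir operator of a centralizer is written with dual bases, which requires that the Killing
  form is nondegenerate, that the Cartan subalgebra \<open>H\<close> is abelian and acts diagonalizably, and that
  root spaces are one-dimensional. Here semisimple means that there are no nonzero solvable ideals and
  a Cartan subalgebra is a nilpotent self-normalizing one, so all this is derived below. Three trace
  arguments carry it.

  \<^item> Conjugating the eigenvalues of the semisimple part of \<open>ad x\<close> gives another derivation, because
    conjugation is additive, and the trace of its product with \<open>ad x\<close> is the sum of the \<open>\<bar>\<lambda>\<bar>\<^sup>2\<close>. If \<open>x\<close> is a sum of commutators
    in the radical of the Killing form, this trace vanishes, and \<open>ad x\<close> is nilpotent. By Engel's
    theorem the radical is solvable, hence zero (\<open>killing_nondegenerate\<close>).

  \<^item> A sum of commutators of \<open>H\<close> that is central in \<open>H\<close> has trace zero on each of its generalized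
    eigenspaces, so it is ad-nilpotent, and then orthogonal to \<open>H\<close>, on which the Killing form is
    nondegenerate. As \<open>H\<close> is nilpotent, it follows that \<open>H\<close> is abelian (\<open>H_abelian\<close>). The semisimple part
    of \<open>ad h\<close> is an inner derivation given by an element of \<open>H\<close>, whose difference from \<open>h\<close> vanishes for
    the same reason (\<open>H_ad_diagonalizable\<close>).

  \<^item> For a root \<open>\<alpha>\<close> with \<open>[e, f] = t\<^sub>\<alpha>\<close>, the span of \<open>f\<close>, \<open>t\<^sub>\<alpha>\<close> and the spaces of weight \<open>k\<alpha>\<close>, \<open>k \<ge> 1\<close>, is
    stable under \<open>e\<close> and \<open>f\<close>. The trace of \<open>t\<^sub>\<alpha>\<close> on it is zero, which leaves only dimension one for the
    weight \<open>\<alpha>\<close> (\<open>root_space_one_dimensional\<close>).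

  The weight spaces are preserved because each \<open>\<kappa>\<^sub>\<alpha>\<close> commutes with \<open>H\<close> and because the equations that
  define a weight space are linear and continuous, so that they pass to derivatives of sections.
  Derivatives are taken within the set of regular elements, which is open in \<open>H\<close> only; they are
  determined on vectors of \<open>H\<close> (\<open>derivative_unique_along_subspace\<close>).
\<close>

section \<open>Traces and generalized eigenspaces\<close>

sublocale fd_complex_space \<subseteq> finite_dimensional_vector_space sc "extend_basis {}"
proof
  show "finite (extend_basis {})"
    using finite_dimensional independent_extend_basis[OF independent_empty]
      independent_span_bound by blast
qed (simp_all add: independent_extend_basis independent_empty)

context fd_complex_space
begin

abbreviation endo :: "('a \<Rightarrow> 'a) \<Rightarrow> bool" where
  "endo \<equiv> Vector_Spaces.linear sc sc"

lemma endo_iff: "endo f \<longleftrightarrow> (\<forall>x y. f (x + y) = f x + f y) \<and> (\<forall>a x. f (sc a x) = sc a (f x))"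
  unfolding Vector_Spaces.linear_iff using vector_space_axioms by blast

lemma endo_add: "endo f \<Longrightarrow> f (x + y) = f x + f y"
  and endo_scale: "endo f \<Longrightarrow> f (sc a x) = sc a (f x)"
  by (simp_all add: endo_iff)

lemma endo_zero: "endo f \<Longrightarrow> f 0 = 0"
  using endo_scale[of f 0 0] by simp

lemma endo_diff: "endo f \<Longrightarrow> f (x - y) = f x - f y"
  using endo_add[of f "x - y" y] by simp

lemma endo_sum: "endo f \<Longrightarrow> f (sum g A) = (\<Sum>i\<in>A. f (g i))"
  by (induction A rule: infinite_finite_induct) (simp_all add: endo_zero endo_add)

lemma endo_ident: "endo (\<lambda>x. x)"
  by (simp add: endo_iff)

lemma endo_comp: "endo f \<Longrightarrow> endo g \<Longrightarrow> endo (\<lambda>x. f (g x))"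
  by (simp add: endo_iff)

lemma endo_plus: "endo f \<Longrightarrow> endo g \<Longrightarrow> endo (\<lambda>x. f x + g x)"
  by (simp add: endo_iff algebra_simps)

lemma endo_minus: "endo f \<Longrightarrow> endo g \<Longrightarrow> endo (\<lambda>x. f x - g x)"
  by (simp add: endo_iff algebra_simps)

lemma endo_scaled: "endo f \<Longrightarrow> endo (\<lambda>x. sc a (f x))"
  by (simp add: endo_iff algebra_simps)

lemma endo_funpow: "endo f \<Longrightarrow> endo (f ^^ n)"
  by (induction n) (simp_all add: endo_iff)

lemma endo_span:
  assumes "endo f" "\<And>b. b \<in> B \<Longrightarrow> f b \<in> U" "subspace U" "x \<in> span B"
  shows "f x \<in> U"
  using assms(4)
  by (induction rule: span_induct_alt)
    (use assms(1-3) in \<open>auto simp: endo_zero endo_add endo_scale subspace_0 intro: subspace_add subspace_scale\<close>)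

text \<open>The trace of the restriction of an operator to the invariant subspace spanned by an independent set.\<close>

definition tr_on :: "'a set \<Rightarrow> ('a \<Rightarrow> 'a) \<Rightarrow> complex" where
  "tr_on B f = (\<Sum>b\<in>B. representation B (f b) b)"

text \<open>
  Cyclicity of the trace. The two sides may use different bases of the same subspace, so that taking
  \<open>g\<close> to be the identity yields independence of the basis.
\<close>

lemma tr_on_swap:
  assumes B: "independent B" "independent B'" "span B = span B'"
    and f: "endo f" "\<And>x. x \<in> span B \<Longrightarrow> f x \<in> span B"
    and g: "endo g" "\<And>x. x \<in> span B \<Longrightarrow> g x \<in> span B"
  shows "tr_on B (\<lambda>x. f (g x)) = tr_on B' (\<lambda>x. g (f x))"
proof -
  have key: "representation C (p (q b)) b
      = (\<Sum>c\<in>D. representation D (q b) c * representation C (p c) b)"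
    if "independent C" "independent D" "span C = span D" "endo p" "b \<in> C"
      "\<And>x. x \<in> span C \<Longrightarrow> p x \<in> span C" "\<And>x. x \<in> span C \<Longrightarrow> q x \<in> span C" for C D p q b
  proof -
    have qb: "q b \<in> span D"
      using that span_base by blast
    have e: "q b = (\<Sum>c\<in>D. sc (representation D (q b) c) c)"
      using sum_representation_eq[OF that(2) qb finiteI_independent[OF that(2)] order_refl] by simp
    have "p (q b) = (\<Sum>c\<in>D. sc (representation D (q b) c) (p c))"
      using arg_cong[OF e, of p] by (simp add: endo_sum[OF that(4)] endo_scale[OF that(4)])
    moreover have "p c \<in> span C" if "c \<in> D" for c
      using that \<open>span C = span D\<close> \<open>\<And>x. x \<in> span C \<Longrightarrow> p x \<in> span C\<close> span_base by blast
    ultimately show ?thesis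
      using that(1) by (simp add: representation_sum representation_scale span_scale)
  qed
  have "tr_on B (\<lambda>x. f (g x))
      = (\<Sum>b\<in>B. \<Sum>c\<in>B'. representation B' (g b) c * representation B (f c) b)"
    unfolding tr_on_def by (intro sum.cong refl key) (use assms in auto)
  also have "\<dots> = (\<Sum>c\<in>B'. \<Sum>b\<in>B. representation B (f c) b * representation B' (g b) c)"
    by (subst sum.swap) (simp add: mult.commute)
  also have "\<dots> = tr_on B' (\<lambda>x. g (f x))"
    unfolding tr_on_def by (intro sum.cong refl key[symmetric]) (use assms in auto)
  finally show ?thesis .
qed

lemma tr_on_basis_change:
  assumes "independent B" "independent B'" "span B = span B'"
    and "endo f" "\<And>x. x \<in> span B \<Longrightarrow> f x \<in> span B"
  shows "tr_on B f = tr_on B' f"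
  using tr_on_swap[OF assms endo_ident] by simp

lemma tr_on_add:
  assumes "independent B" "\<And>x. x \<in> B \<Longrightarrow> f x \<in> span B" "\<And>x. x \<in> B \<Longrightarrow> g x \<in> span B"
  shows "tr_on B (\<lambda>x. f x + g x) = tr_on B f + tr_on B g"
  using assms by (simp add: tr_on_def representation_add sum.distrib)

lemma tr_on_scale:
  assumes "independent B" "\<And>x. x \<in> B \<Longrightarrow> f x \<in> span B"
  shows "tr_on B (\<lambda>x. sc a (f x)) = a * tr_on B f"
  using assms by (simp add: tr_on_def representation_scale sum_distrib_left)

lemma tr_on_diff:
  assumes "independent B" "\<And>x. x \<in> B \<Longrightarrow> f x \<in> span B" "\<And>x. x \<in> B \<Longrightarrow> g x \<in> span B"
  shows "tr_on B (\<lambda>x. f x - g x) = tr_on B f - tr_on B g"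
  using assms by (simp add: tr_on_def representation_diff sum_subtractf)

lemma tr_on_commutator:
  assumes "independent B"
    and "endo f" "\<And>x. x \<in> span B \<Longrightarrow> f x \<in> span B"
    and "endo g" "\<And>x. x \<in> span B \<Longrightarrow> g x \<in> span B"
  shows "tr_on B (\<lambda>x. f (g x) - g (f x)) = 0"
  using assms tr_on_swap[OF assms(1) assms(1) refl assms(2-5)]
  by (simp add: tr_on_diff span_base)

lemma tr_on_eigenbasis:
  assumes "independent B" "\<And>b. b \<in> B \<Longrightarrow> f b = sc (k b) b"
  shows "tr_on B f = (\<Sum>b\<in>B. k b)"
  using assms
  by (simp add: tr_on_def representation_scale representation_basis span_base)

lemma funpow_zero_mono:
  assumes "endo f" "(f ^^ m) x = 0" "m \<le> n"
  shows "(f ^^ n) x = 0"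
proof -
  have "(f ^^ n) x = (f ^^ (n - m)) ((f ^^ m) x)"
    using assms(3) by (metis comp_apply funpow_add le_add_diff_inverse2)
  then show ?thesis
    using assms by (simp add: endo_zero endo_funpow)
qed

text \<open>
  In a basis that extends a basis of the image of \<open>f\<close>, only the vectors of the image contribute to the
  trace, and on the image the nilpotency order is smaller.
\<close>

lemma tr_on_nilpotent_bounded:
  assumes "independent B" "endo f" "\<And>x. x \<in> span B \<Longrightarrow> f x \<in> span B"
    and "\<And>x. x \<in> span B \<Longrightarrow> (f ^^ m) x = 0"
  shows "tr_on B f = 0"
  using assms(1,3,4)
proof (induction m arbitrary: B)
  case 0
  then have "B \<subseteq> {0}"
    using span_base by auto
  then have "B = {}"
    using 0(1) dependent_zero by blast
  then show ?case
    by (simp add: tr_on_def)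
next
  case (Suc m)
  note f = \<open>endo f\<close>
  define R where "R = f ` span B"
  have R: "subspace R" "R \<subseteq> span B"
  proof -
    show "subspace R"
      unfolding R_def
      using f by (simp add: Vector_Spaces.linear.axioms(3) module_hom.subspace_image module_hom_iff_linear[symmetric])
  qed (use Suc.prems R_def in auto)
  obtain C0 where C0: "C0 \<subseteq> R" "independent C0" "R \<subseteq> span C0"
    using maximal_independent_subset by blast
  then have spC0: "span C0 = R"
    using R by (simp add: span_subspace)
  obtain C where C: "C0 \<subseteq> C" "C \<subseteq> span B" "independent C" "span B \<subseteq> span C"
    using maximal_independent_subset_extend[of C0 "span B"] C0 R by blast
  have spC: "span C = span B"
    using C by (simp add: span_subspace)
  have fR: "f b \<in> span C0" if "b \<in> C" for b
    using that C spC0 R_def by blast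
  have finC: "finite C"
    using C finiteI_independent by blast
  have "tr_on B f = tr_on C f"
    using tr_on_basis_change[of B C f] Suc.prems C spC f by auto
  also have "\<dots> = (\<Sum>b\<in>C. representation C0 (f b) b)"
    unfolding tr_on_def using C fR
    by (intro sum.cong refl) (metis representation_extend)
  also have "\<dots> = (\<Sum>b\<in>C0. representation C0 (f b) b)"
    using C finC representation_ne_zero by (intro sum.mono_neutral_right) blast+
  also have "\<dots> = 0"
  proof -
    have "tr_on C0 f = 0"
    proof (rule Suc.IH)
      show "f x \<in> span C0" if "x \<in> span C0" for x
        using that spC0 R R_def by blast
      show "(f ^^ m) x = 0" if "x \<in> span C0" for x
      proof -
        have "x \<in> f ` span B"
          using that by (simp only: spC0 R_def)
        then obtain y where "y \<in> span B" "x = f y"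
          by blast
        then show ?thesis
          using Suc.prems(3)[of y] by (simp add: funpow_swap1)
      qed
    qed (use C0 in auto)
    then show ?thesis
      by (simp add: tr_on_def)
  qed
  finally show ?case .
qed

lemma tr_on_nilpotent:
  assumes "independent B" "endo f" "\<And>x. x \<in> span B \<Longrightarrow> f x \<in> span B"
    and "\<And>b. b \<in> B \<Longrightarrow> \<exists>n. (f ^^ n) b = 0"
  shows "tr_on B f = 0"
proof -
  obtain n where n: "\<And>b. b \<in> B \<Longrightarrow> (f ^^ n b) b = 0"
    using assms(4) by metis
  define m where "m = sum n B"
  have "finite B"
    using assms(1) finiteI_independent by blast
  then have "(f ^^ m) b = 0" if "b \<in> B" for b
    using funpow_zero_mono[OF assms(2) n[OF that]] that by (simp add: m_def member_le_sum)
  then have "(f ^^ m) x = 0" if "x \<in> span B" for x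
    using endo_span[OF endo_funpow[OF assms(2)], of B m "{0}" x] that by simp
  then show ?thesis
    using tr_on_nilpotent_bounded assms by blast
qed

text \<open>The generalized eigenspace of \<open>f\<close> for \<open>l\<close>; it is zero if \<open>l\<close> is not an eigenvalue.\<close>

definition geig :: "('a \<Rightarrow> 'a) \<Rightarrow> complex \<Rightarrow> 'a set" where
  "geig f l = {v. \<exists>n. ((\<lambda>w. f w - sc l w) ^^ n) v = 0}"

lemma geigI: "((\<lambda>w. f w - sc l w) ^^ n) v = 0 \<Longrightarrow> v \<in> geig f l"
  unfolding geig_def by blast

lemma geigE:
  assumes "v \<in> geig f l"
  obtains n where "((\<lambda>w. f w - sc l w) ^^ n) v = 0"
  using assms unfolding geig_def by blast

lemma endo_shift: "endo f \<Longrightarrow> endo (\<lambda>w. f w - sc l w)"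
  by (simp add: endo_iff algebra_simps)

lemma subspace_geig:
  assumes "endo f"
  shows "subspace (geig f l)"
proof (rule subspaceI)
  note e = endo_shift[OF assms, of l]
  show "0 \<in> geig f l"
    unfolding geig_def by (auto intro!: exI[of _ 0])
  show "x + y \<in> geig f l" if xy: "x \<in> geig f l" "y \<in> geig f l" for x y
  proof -
    obtain m n where "((\<lambda>w. f w - sc l w) ^^ m) x = 0" "((\<lambda>w. f w - sc l w) ^^ n) y = 0"
      using xy by (auto elim!: geigE)
    then have "((\<lambda>w. f w - sc l w) ^^ (m + n)) (x + y) = 0"
      using e by (simp add: endo_add[OF endo_funpow[OF e]] funpow_zero_mono[OF e])
    then show ?thesis
      by (rule geigI)
  qed
  show "sc c x \<in> geig f l" if "x \<in> geig f l" for c x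
  proof -
    obtain m where "((\<lambda>w. f w - sc l w) ^^ m) x = 0"
      using \<open>x \<in> geig f l\<close> by (auto elim!: geigE)
    then have "((\<lambda>w. f w - sc l w) ^^ m) (sc c x) = 0"
      by (simp add: endo_scale[OF endo_funpow[OF e]])
    then show ?thesis
      by (rule geigI)
  qed
qed

lemma eigenvector_in_geig: "f v = sc l v \<Longrightarrow> v \<in> geig f l"
  unfolding geig_def by (auto intro: exI[of _ 1])

lemma geig_step:
  assumes "f v - sc l v \<in> geig f l"
  shows "v \<in> geig f l"
proof -
  obtain n where "((\<lambda>w. f w - sc l w) ^^ n) (f v - sc l v) = 0"
    using assms by (auto elim!: geigE)
  then have "((\<lambda>w. f w - sc l w) ^^ Suc n) v = 0"
    by (simp del: funpow.simps add: funpow_Suc_right)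
  then show ?thesis
    by (rule geigI)
qed

lemma geig_commuting:
  assumes "endo f" "endo g" "\<And>x. g (f x) = f (g x)" "v \<in> geig f l"
  shows "g v \<in> geig f l"
proof -
  have *: "g (((\<lambda>w. f w - sc l w) ^^ n) v) = ((\<lambda>w. f w - sc l w) ^^ n) (g v)" for n
    by (induction n) (simp_all add: endo_diff[OF assms(2)] endo_scale[OF assms(2)] assms(3))
  obtain n where "((\<lambda>w. f w - sc l w) ^^ n) v = 0"
    using assms(4) by (auto elim!: geigE)
  then have "((\<lambda>w. f w - sc l w) ^^ n) (g v) = 0"
    using *[of n] assms(2) by (simp add: endo_zero)
  then show ?thesis
    by (rule geigI)
qed

lemma geig_invariant: "endo f \<Longrightarrow> v \<in> geig f l \<Longrightarrow> f v \<in> geig f l"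
  by (rule geig_commuting) auto

text \<open>
  On a generalized eigenspace for \<open>l \<noteq> a\<close> the operator \<open>f - a\<close> is a nonzero scalar plus a
  nilpotent operator; the preimage is found by induction on the nilpotency order.
\<close>

lemma geig_shift_preimage:
  assumes f: "endo f" and U: "subspace U" "\<And>x. x \<in> U \<Longrightarrow> f x \<in> U"
    and "l \<noteq> a" "s \<in> geig f l" "s \<in> U"
  shows "\<exists>z\<in>geig f l \<inter> U. f z - sc a z = s"
proof -
  obtain n where "((\<lambda>w. f w - sc l w) ^^ n) s = 0"
    using assms by (auto elim!: geigE)
  then show ?thesis
    using \<open>s \<in> U\<close>
  proof (induction n arbitrary: s)
    case 0
    then show ?case
      using U f by (intro bexI[of _ 0]) (auto simp: endo_zero subspace_0 subspace_geig)
  next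
    case (Suc n)
    define m where "m = l - a"
    have m: "m \<noteq> 0"
      using \<open>l \<noteq> a\<close> by (simp add: m_def)
    define s' where "s' = sc (1 / m) (f s - sc l s)"
    have "((\<lambda>w. f w - sc l w) ^^ n) (f s - sc l s) = 0"
      using Suc.prems by (simp del: funpow.simps add: funpow_Suc_right)
    then have "((\<lambda>w. f w - sc l w) ^^ n) s' = 0"
      unfolding s'_def by (simp add: endo_scale[OF endo_funpow[OF endo_shift[OF f]]])
    moreover have "s' \<in> U"
      unfolding s'_def using U Suc.prems by (simp add: subspace_scale subspace_diff)
    ultimately obtain z where z: "z \<in> geig f l \<inter> U" "f z - sc a z = s'"
      using Suc.IH by blast
    have sg: "s \<in> geig f l"
      using Suc.prems unfolding geig_def by blast
    have "f (sc (1 / m) s - z) - sc a (sc (1 / m) s - z)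
        = sc (1 / m) (f s - sc a s) - s'"
      using f z(2) by (simp add: endo_diff endo_scale algebra_simps)
    also have "\<dots> = sc (1 / m) (sc m s)"
      unfolding s'_def m_def by (simp add: algebra_simps)
    also have "\<dots> = s"
      using m by simp
    finally show ?case
      using z sg U Suc.prems subspace_geig[OF f]
      by (intro bexI[of _ "sc (1 / m) s - z"]) (auto intro!: subspace_diff subspace_scale)
  qed
qed

text \<open>
  On the sum of the generalized eigenspaces, \<open>f - a\<close> is onto up to the summand for \<open>a\<close>. This is what
  removes one linear factor of an annihilating polynomial.
\<close>

lemma shift_preimage_span:
  assumes f: "endo f" and U: "subspace U" "\<And>x. x \<in> U \<Longrightarrow> f x \<in> U"
    and "x \<in> span (\<Union>l. geig f l \<inter> U)"
  shows "\<exists>z\<in>span (\<Union>l. geig f l \<inter> U). \<exists>w\<in>geig f a \<inter> U. x = f z - sc a z + w"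
  using assms(4)
proof (induction rule: span_induct_alt)
  case base
  show ?case
    using f U subspace_geig[OF f] by (intro bexI[of _ 0]) (auto simp: endo_zero span_zero subspace_0)
next
  case (step c s y)
  obtain z w where zw: "z \<in> span (\<Union>l. geig f l \<inter> U)" "w \<in> geig f a \<inter> U" "y = f z - sc a z + w"
    using step by blast
  obtain l where l: "s \<in> geig f l" "s \<in> U"
    using step by blast
  have gU: "subspace (geig f a \<inter> U)"
    using U subspace_geig[OF f] by (simp add: subspace_inter)
  show ?case
  proof (cases "l = a")
    case True
    have 1: "sc c s + w \<in> geig f a \<inter> U"
      using zw(2) l True gU by (intro subspace_add[OF gU] subspace_scale[OF gU]) auto
    have 2: "sc c s + y = f z - sc a z + (sc c s + w)"
      by (simp add: zw(3))
    show ?thesis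
      by (rule bexI[OF _ zw(1)], rule bexI[OF _ 1], rule 2)
  next
    case False
    then obtain z' where z': "z' \<in> geig f l \<inter> U" "f z' - sc a z' = s"
      using geig_shift_preimage[OF f U False l] by blast
    have "f (sc c z' + z) - sc a (sc c z' + z) + w = sc c (f z' - sc a z') + (f z - sc a z + w)"
      using f by (simp add: endo_add endo_scale algebra_simps)
    also have "\<dots> = sc c s + y"
      using z' zw by simp
    finally have 1: "sc c s + y = f (sc c z' + z) - sc a (sc c z' + z) + w"
      by simp
    have 2: "sc c z' + z \<in> span (\<Union>l. geig f l \<inter> U)"
      using z' zw(1) by (intro span_add span_scale) (auto intro: span_base)
    show ?thesis
      by (rule bexI[OF _ 2], rule bexI[OF _ zw(2)], rule 1)
  qed
qed

lemma poly_annihilator: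
  assumes f: "endo f"
  shows "\<exists>p::complex poly. p \<noteq> 0 \<and> (\<exists>N\<ge>degree p. (\<Sum>i\<le>N. sc (coeff p i) ((f ^^ i) v)) = 0)"
proof -
  define N where "N = dimension"
  obtain c where c: "\<exists>i\<le>N. c i \<noteq> 0" "(\<Sum>i\<le>N. sc (c i) ((f ^^ i) v)) = 0"
  proof (cases "inj_on (\<lambda>i. (f ^^ i) v) {..N}")
    case True
    define S where "S = (\<lambda>i. (f ^^ i) v) ` {..N}"
    have "card S = Suc N"
      using card_image[OF True] by (simp add: S_def)
    then have "dependent S"
      using independent_bound_general[of S] N_def dim_subset_UNIV[of S] by auto
    then obtain u where u: "\<exists>w\<in>S. u w \<noteq> 0" "(\<Sum>w\<in>S. sc (u w) w) = 0"
      using dependent_finite[of S] by (auto simp: S_def)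
    show ?thesis
      using u True by (intro that[of "\<lambda>i. u ((f ^^ i) v)"]) (auto simp: S_def sum.reindex)
  next
    case False
    then obtain i j where ij: "i \<le> N" "j \<le> N" "i \<noteq> j" "(f ^^ i) v = (f ^^ j) v"
      by (auto simp: inj_on_def)
    define c where "c k = (if k = i then 1 else if k = j then -1 else (0::complex))" for k
    have "(\<Sum>k\<le>N. sc (c k) ((f ^^ k) v)) = (\<Sum>k\<in>{i, j}. sc (c k) ((f ^^ k) v))"
      using ij by (intro sum.mono_neutral_right) (auto simp: c_def)
    also have "\<dots> = 0"
      using ij by (simp add: c_def)
    finally show ?thesis
      using ij by (intro that[of c]) (auto simp: c_def intro: exI[of _ i])
  qed
  define p where "p = (\<Sum>i\<le>N. monom (c i) i)"
  have cf: "coeff p k = (if k \<le> N then c k else 0)" for k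
    by (simp add: p_def coeff_sum)
  have "degree p \<le> N"
    by (rule degree_le) (simp add: cf)
  moreover have "p \<noteq> 0"
    using c(1) cf by (metis coeff_0)
  moreover have "(\<Sum>i\<le>N. sc (coeff p i) ((f ^^ i) v)) = 0"
    using c(2) by (simp add: cf)
  ultimately show ?thesis
    by blast
qed

text \<open>
  Induction on the degree: for a root \<open>a\<close> of \<open>p\<close>, the quotient of \<open>p\<close> by the factor of \<open>a\<close>
  annihilates \<open>(f - a) v\<close>, which is therefore in the span of the generalized eigenvectors. Hence it
  is \<open>(f - a) z\<close> plus a generalized eigenvector for \<open>a\<close>, and \<open>v - z\<close> is one as well.
\<close>

lemma geig_span_of_annihilator:
  assumes f: "endo f" and U: "subspace U" "\<And>x. x \<in> U \<Longrightarrow> f x \<in> U"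
    and "p \<noteq> 0" "degree p \<le> N" "(\<Sum>i\<le>N. sc (coeff p i) ((f ^^ i) v)) = 0" "v \<in> U"
  shows "v \<in> span (\<Union>l. geig f l \<inter> U)"
  using assms(4-7)
proof (induction "degree p" arbitrary: p N v)
  case 0
  have "(\<Sum>i\<le>N. sc (coeff p i) ((f ^^ i) v)) = (\<Sum>i\<in>{0}. sc (coeff p i) ((f ^^ i) v))"
    using "0.hyps" by (intro sum.mono_neutral_right) (auto simp: coeff_eq_0)
  then have "sc (coeff p 0) v = 0"
    using 0 by simp
  moreover have "coeff p 0 \<noteq> 0"
    using 0 by (metis leading_coeff_0_iff)
  ultimately show ?case
    by (simp add: span_zero)
next
  case (Suc n)
  have "\<not> constant (poly p)"
    using Suc.hyps(2) constant_degree[of p] by simp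
  then obtain a where "poly p a = 0"
    using fundamental_theorem_of_algebra by blast
  then obtain q where q: "p = [:- a, 1:] * q"
    by (auto simp: poly_eq_0_iff_dvd)
  have q0: "q \<noteq> 0"
    using q Suc.prems by auto
  have dq: "degree p = Suc (degree q)"
    using q0 by (simp add: q degree_mult_eq del: mult_pCons_left)
  obtain M where M: "N = Suc M"
    using Suc dq by (cases N) auto
  define w where "w = f v - sc a v"
  have cfp: "coeff p i = (case i of 0 \<Rightarrow> 0 | Suc j \<Rightarrow> coeff q j) - a * coeff q i" for i
    by (cases i) (simp_all add: q)
  have cq: "coeff q (Suc M) = 0"
    using Suc.prems dq M by (simp add: coeff_eq_0)
  have fw: "(f ^^ i) w = (f ^^ Suc i) v - sc a ((f ^^ i) v)" for i
    unfolding w_def using endo_funpow[OF f, of i]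
    by (simp add: endo_diff endo_scale funpow_swap1)
  have "(\<Sum>i\<le>N. sc (coeff p i) ((f ^^ i) v))
      = (\<Sum>i\<le>Suc M. sc (case i of 0 \<Rightarrow> 0 | Suc j \<Rightarrow> coeff q j) ((f ^^ i) v))
        - (\<Sum>i\<le>Suc M. sc (a * coeff q i) ((f ^^ i) v))"
    by (simp only: M cfp scale_left_diff_distrib sum_subtractf)
  also have "(\<Sum>i\<le>Suc M. sc (case i of 0 \<Rightarrow> 0 | Suc j \<Rightarrow> coeff q j) ((f ^^ i) v))
      = (\<Sum>i\<le>M. sc (coeff q i) ((f ^^ Suc i) v))"
    by (subst sum.atMost_Suc_shift) simp
  also have "(\<Sum>i\<le>Suc M. sc (a * coeff q i) ((f ^^ i) v))
      = (\<Sum>i\<le>M. sc (coeff q i) (sc a ((f ^^ i) v)))"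
    by (simp add: cq mult.commute)
  also have "(\<Sum>i\<le>M. sc (coeff q i) ((f ^^ Suc i) v)) - (\<Sum>i\<le>M. sc (coeff q i) (sc a ((f ^^ i) v)))
      = (\<Sum>i\<le>M. sc (coeff q i) ((f ^^ i) w))"
    by (simp only: fw scale_right_diff_distrib sum_subtractf)
  finally have "(\<Sum>i\<le>M. sc (coeff q i) ((f ^^ i) w)) = 0"
    using Suc.prems by simp
  moreover have "w \<in> U"
    using U Suc.prems by (simp add: w_def subspace_diff subspace_scale)
  ultimately have "w \<in> span (\<Union>l. geig f l \<inter> U)"
    using Suc.hyps(1)[of q M w] Suc.hyps(2) Suc.prems dq q0 M by auto
  then obtain z u where zu: "z \<in> span (\<Union>l. geig f l \<inter> U)" "u \<in> geig f a \<inter> U" "w = f z - sc a z + u"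
    using shift_preimage_span[OF f U] by blast
  have "span (\<Union>l. geig f l \<inter> U) \<subseteq> U"
    using U by (intro span_minimal) auto
  then have "v - z \<in> U"
    using U zu Suc.prems by (auto intro: subspace_diff)
  moreover have "f (v - z) - sc a (v - z) = u"
    using zu(3) f unfolding w_def by (simp add: endo_diff algebra_simps)
  then have "f (v - z) - sc a (v - z) \<in> geig f a"
    using zu(2) by simp
  then have "v - z \<in> geig f a"
    by (rule geig_step)
  ultimately have "v - z \<in> span (\<Union>l. geig f l \<inter> U)"
    by (intro span_base) auto
  then show ?case
    using zu(1) span_add[of "v - z" _ z] by fastforce
qed

text \<open>Relative to an invariant subspace, so that restrictions of operators never have to be formed.\<close>

lemma geig_decomposition:
  assumes "endo f" "subspace U" "\<And>x. x \<in> U \<Longrightarrow> f x \<in> U"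
  shows "U \<subseteq> span (\<Union>l. geig f l \<inter> U)"
  using geig_span_of_annihilator[OF assms] poly_annihilator[OF assms(1)] by blast

lemma geig_shift_inj:
  assumes f: "endo f" and "v \<in> geig f l" "f v = sc m v" "m \<noteq> l"
  shows "v = 0"
proof -
  have *: "((\<lambda>w. f w - sc l w) ^^ n) v = sc ((m - l) ^ n) v" for n
    by (induction n) (simp_all add: endo_scale[OF f] assms(3) algebra_simps)
  obtain n where "((\<lambda>w. f w - sc l w) ^^ n) v = 0"
    using assms by (auto elim!: geigE)
  then show ?thesis
    using assms(4) by (simp add: *)
qed

text \<open>
  A vector in the span of the other generalized eigenspaces is killed by a product of factors
  \<open>f - m\<close> with \<open>m \<noteq> l\<close>, and each such factor is injective on the generalized eigenspace for \<open>l\<close>.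
\<close>

lemma geig_independent:
  assumes f: "endo f" and "v \<in> geig f l" "v \<in> span (\<Union>m\<in>-{l}. geig f m)"
  shows "v = 0"
proof -
  define P where "P ms x = foldr (\<lambda>m w. f w - sc m w) ms x" for ms x
  have P0: "P (ms @ [m]) x = P ms (f x - sc m x)" for ms m x
    by (simp add: P_def)
  have Papp: "P (ms @ ms') x = P ms (P ms' x)" for ms ms' x
    by (simp add: P_def)
  have Pe: "endo (P ms)" for ms
    unfolding P_def
    by (induction ms) (auto simp: endo_ident id_def endo_minus endo_comp endo_scaled f)
  have Pf: "P ms (f x) = f (P ms x)" for ms x
    unfolding P_def by (induction ms arbitrary: x) (simp_all add: endo_diff[OF f] endo_scale[OF f])
  have Pc: "P ms (P ms' x) = P ms' (P ms x)" for ms ms' x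
  proof (induction ms')
    case Nil
    then show ?case by (simp add: P_def)
  next
    case (Cons m ms')
    have "P (m # ms') y = f (P ms' y) - sc m (P ms' y)" for y
      by (simp add: P_def)
    then show ?case
      using Cons by (simp add: endo_diff[OF Pe] endo_scale[OF Pe] Pf)
  qed
  have "\<exists>ms. l \<notin> set ms \<and> P ms v = 0"
    using assms(3)
  proof (induction rule: span_induct_alt)
    case base
    show ?case
      by (rule exI[of _ "[]"]) (simp add: P_def)
  next
    case (step c x y)
    obtain ms where ms: "l \<notin> set ms" "P ms y = 0"
      using step by blast
    obtain m n where m: "m \<noteq> l" "((\<lambda>w. f w - sc m w) ^^ n) x = 0"
      using step by (auto elim!: geigE)
    have "P (replicate k m) x = ((\<lambda>w. f w - sc m w) ^^ k) x" for k
      by (induction k) (simp_all add: P_def)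
    then have "P (replicate n m) x = 0"
      using m(2) by simp
    then have "P ms (P (replicate n m) (sc c x + y)) = 0"
      using ms Pc[of ms "replicate n m" y] by (simp add: endo_add[OF Pe] endo_scale[OF Pe] endo_zero[OF Pe])
    then show ?case
      using ms m by (intro exI[of _ "ms @ replicate n m"]) (auto simp: Papp)
  qed
  then obtain ms where "l \<notin> set ms" "P ms v = 0"
    by blast
  then show ?thesis
    using assms(2)
  proof (induction ms arbitrary: v)
    case Nil
    then show ?case by (simp add: P_def)
  next
    case (Cons m ms)
    have "P ms v \<in> geig f l"
      using geig_commuting[of f "P ms" v l] f Pe Pf Cons.prems(3) by blast
    moreover have "f (P ms v) = sc m (P ms v)"
      using Cons.prems by (simp add: P_def)
    ultimately have "P ms v = 0"
      using Cons.prems geig_shift_inj[OF f] by auto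
    then show ?case
      using Cons by auto
  qed
qed

lemma tr_on_geig:
  assumes f: "endo f" and B: "independent B" "span B = geig f l"
  shows "tr_on B f = l * of_nat (card B)"
proof -
  have inv: "f x \<in> span B" if "x \<in> span B" for x
    using that geig_invariant[OF f] B(2) by simp
  have "tr_on B f = tr_on B (\<lambda>x. (f x - sc l x) + sc l x)"
    by simp
  also have "\<dots> = tr_on B (\<lambda>x. f x - sc l x) + tr_on B (\<lambda>x. sc l x)"
    by (rule tr_on_add[OF B(1)]) (auto intro: span_base span_diff span_scale inv)
  also have "tr_on B (\<lambda>x. f x - sc l x) = 0"
  proof (rule tr_on_nilpotent[OF B(1) endo_shift[OF f]])
    show "f x - sc l x \<in> span B" if "x \<in> span B" for x
      using that inv by (simp add: span_diff span_scale)
    show "\<exists>n. ((\<lambda>w. f w - sc l w) ^^ n) b = 0" if "b \<in> B" for b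
      using span_base[OF that] B(2) by (auto simp: geig_def)
  qed
  also have "tr_on B (\<lambda>x. sc l x) = l * of_nat (card B)"
    using tr_on_eigenbasis[OF B(1), of "sc l" "\<lambda>_. l"] by simp
  finally show ?thesis by simp
qed

text \<open>
  The operator \<open>s\<close> is \<open>\<phi>\<close> applied to the semisimple part of \<open>f\<close>. Two choices of \<open>\<phi>\<close> matter below:
  the identity, and complex conjugation, which makes the trace of \<open>f s\<close> a sum of squared moduli.
\<close>

lemma semisimple_functional_calculus:
  assumes f: "endo f"
  obtains s B lab where "endo s" "\<forall>l. \<forall>v\<in>geig f l. s v = sc (\<phi> l) v"
    "independent B" "span B = UNIV" "\<forall>b\<in>B. b \<in> geig f (lab b)"
    "tr_on B (\<lambda>x. f (s x)) = (\<Sum>b\<in>B. lab b * \<phi> (lab b))"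
proof -
  obtain B where B: "B \<subseteq> (\<Union>l. geig f l)" "independent B" "(\<Union>l. geig f l) \<subseteq> span B"
    using maximal_independent_subset by blast
  have "UNIV \<subseteq> span (\<Union>l. geig f l)"
    using geig_decomposition[OF f, of UNIV] by simp
  then have spB: "span B = UNIV"
    using B(3) by (metis span_mono span_span top.extremum_uniqueI subset_trans)
  obtain lab where lab: "\<And>b. b \<in> B \<Longrightarrow> b \<in> geig f (lab b)"
    using B(1) by (metis UN_iff subsetD)
  define Bl where "Bl l = {b \<in> B. lab b = l}" for l
  have spBl: "span (Bl l) = geig f l" for l
  proof
    show "span (Bl l) \<subseteq> geig f l"
      using lab subspace_geig[OF f] by (intro span_minimal) (auto simp: Bl_def)
    show "geig f l \<subseteq> span (Bl l)"
    proof
      fix v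
      assume v: "v \<in> geig f l"
      have "v \<in> span (Bl l \<union> (B - Bl l))"
        using spB by (simp add: Un_absorb1 Bl_def)
      then obtain x y where xy: "v = x + y" "x \<in> span (Bl l)" "y \<in> span (B - Bl l)"
        unfolding span_Un by blast
      have "B - Bl l \<subseteq> (\<Union>m\<in>-{l}. geig f m)"
        using lab by (auto simp: Bl_def)
      then have "y \<in> span (\<Union>m\<in>-{l}. geig f m)"
        using xy(3) span_mono by blast
      moreover have "y \<in> geig f l"
        using xy v \<open>span (Bl l) \<subseteq> geig f l\<close> subspace_diff[OF subspace_geig[OF f], of v l x] by auto
      ultimately have "y = 0"
        using geig_independent[OF f] by blast
      then show "v \<in> span (Bl l)"
        using xy by simp
    qed
  qed
  interpret p: vector_space_pair sc sc ..
  define s where "s = p.construct B (\<lambda>b. sc (\<phi> (lab b)) b)"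
  have se: "endo s"
    unfolding s_def by (rule p.linear_construct[OF B(2)])
  have sb: "s b = sc (\<phi> (lab b)) b" if "b \<in> B" for b
    unfolding s_def by (rule p.construct_basis[OF B(2) that])
  have sg: "s v = sc (\<phi> l) v" if "v \<in> geig f l" for l v
  proof -
    have "v \<in> span (Bl l)"
      using that spBl by simp
    then have "s v - sc (\<phi> l) v = 0"
      using endo_span[OF endo_shift[OF se], of "Bl l" "\<phi> l" "{0}" v] sb by (simp add: Bl_def)
    then show ?thesis by simp
  qed
  have finB: "finite B"
    using B finiteI_independent by blast
  have indB: "independent (Bl l)" for l
    by (rule independent_mono[OF B(2)]) (auto simp: Bl_def)
  have block: "(\<Sum>b\<in>Bl l. representation B (f b) b) = l * of_nat (card (Bl l))" for l
  proof -
    have "(\<Sum>b\<in>Bl l. representation B (f b) b) = tr_on (Bl l) f"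
      unfolding tr_on_def
    proof (intro sum.cong refl)
      fix b assume b: "b \<in> Bl l"
      then have "f b \<in> span (Bl l)"
        using geig_invariant[OF f, of b l] lab[of b] spBl by (auto simp: Bl_def)
      then show "representation B (f b) b = representation (Bl l) (f b) b"
        using representation_extend[OF B(2), of "f b" "Bl l"] by (simp add: Bl_def)
    qed
    then show ?thesis
      using tr_on_geig[OF f indB spBl] by simp
  qed
  have "tr_on B (\<lambda>x. f (s x)) = (\<Sum>b\<in>B. \<phi> (lab b) * representation B (f b) b)"
    unfolding tr_on_def
    by (intro sum.cong refl) (simp add: sb endo_scale[OF f] representation_scale B(2) spB)
  also have "\<dots> = (\<Sum>l\<in>lab ` B. \<Sum>b\<in>Bl l. \<phi> (lab b) * representation B (f b) b)"
    unfolding Bl_def by (rule sum.image_gen[OF finB])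
  also have "\<dots> = (\<Sum>l\<in>lab ` B. \<Sum>b\<in>Bl l. lab b * \<phi> (lab b))"
  proof (rule sum.cong[OF refl])
    fix l
    have "(\<Sum>b\<in>Bl l. \<phi> (lab b) * representation B (f b) b) = \<phi> l * (\<Sum>b\<in>Bl l. representation B (f b) b)"
      by (simp add: sum_distrib_left Bl_def)
    also have "\<dots> = (\<Sum>b\<in>Bl l. lab b * \<phi> (lab b))"
      by (simp add: block) (simp add: Bl_def)
    finally show "(\<Sum>b\<in>Bl l. \<phi> (lab b) * representation B (f b) b) = (\<Sum>b\<in>Bl l. lab b * \<phi> (lab b))" .
  qed
  also have "\<dots> = (\<Sum>b\<in>B. lab b * \<phi> (lab b))"
    unfolding Bl_def by (rule sum.image_gen[OF finB, symmetric])
  finally have "tr_on B (\<lambda>x. f (s x)) = (\<Sum>b\<in>B. lab b * \<phi> (lab b))" .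
  then show ?thesis
    using that[of s B lab] se sg B(2) spB lab by blast
qed

text \<open>
  The map that sends \<open>x\<close> to the values of \<open>F x\<close> on a basis, read as coordinates in that basis, is an
  injective endomorphism of \<open>U\<close>, hence surjective.
\<close>

lemma nondegenerate_form_represents:
  fixes F :: "'a \<Rightarrow> 'a \<Rightarrow> complex" and \<phi> :: "'a \<Rightarrow> complex"
  assumes U: "subspace U"
    and F: "\<And>x y z. F (x + y) z = F x z + F y z" "\<And>a x z. F (sc a x) z = a * F x z"
      "\<And>x y z. F x (y + z) = F x y + F x z" "\<And>a x z. F x (sc a z) = a * F x z"
    and nd: "\<And>x. x \<in> U \<Longrightarrow> (\<And>y. y \<in> U \<Longrightarrow> F x y = 0) \<Longrightarrow> x = 0"
    and \<phi>: "\<And>x y. x \<in> U \<Longrightarrow> y \<in> U \<Longrightarrow> \<phi> (x + y) = \<phi> x + \<phi> y" "\<And>a x. x \<in> U \<Longrightarrow> \<phi> (sc a x) = a * \<phi> x"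
  shows "\<exists>t\<in>U. \<forall>y\<in>U. F t y = \<phi> y"
proof -
  obtain B where B: "B \<subseteq> U" "independent B" "U \<subseteq> span B"
    using maximal_independent_subset by blast
  have spB: "span B = U"
    using B U by (simp add: span_subspace)
  have finB: "finite B"
    using B finiteI_independent by blast
  define g where "g x = (\<Sum>b\<in>B. sc (F x b) b)" for x
  have ge: "endo g"
    unfolding g_def endo_iff using F by (simp add: algebra_simps sum.distrib scale_sum_right)
  have gU: "g x \<in> U" for x
    unfolding g_def spB[symmetric] by (intro span_sum span_scale span_base)
  have coords: "p b = q b" if "(\<Sum>b\<in>B. sc (p b) b) = (\<Sum>b\<in>B. sc (q b) b)" "b \<in> B" for p q b
  proof -
    have "(\<Sum>b\<in>B. sc (p b - q b) b) = 0"
      using that by (simp only: scale_left_diff_distrib sum_subtractf) simp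
    then show ?thesis
      using independentD[OF B(2) finB order_refl, of "\<lambda>b. p b - q b"] that(2) by force
  qed
  have ext: "P y = Q y" if "y \<in> U" "\<And>b. b \<in> B \<Longrightarrow> P b = Q b"
    and "\<And>x y. x \<in> U \<Longrightarrow> y \<in> U \<Longrightarrow> P (x + y) = P x + P y" "\<And>a x. x \<in> U \<Longrightarrow> P (sc a x) = a * P x"
    and "\<And>x y. x \<in> U \<Longrightarrow> y \<in> U \<Longrightarrow> Q (x + y) = Q x + Q y" "\<And>a x. x \<in> U \<Longrightarrow> Q (sc a x) = a * Q x"
    for P Q :: "'a \<Rightarrow> complex" and y
  proof -
    have "y \<in> span B" using that spB by simp
    then have "y \<in> U \<and> P y = Q y"
    proof (induction rule: span_induct_alt)
      case base
      show ?case
        using that(4)[of 0 0] that(6)[of 0 0] U by (simp add: subspace_0)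
    next
      case (step c x y)
      have "x \<in> U" "sc c x \<in> U"
        using step B U by (auto simp: subspace_scale)
      then show ?case
        using step that U by (simp add: subspace_add)
    qed
    then show ?thesis by simp
  qed
  have inj: "inj_on g U"
  proof (rule inj_onI)
    fix x y assume xy: "x \<in> U" "y \<in> U" "g x = g y"
    then have "F x b = F y b" if "b \<in> B" for b
      using coords[of "F x" "F y"] that by (simp add: g_def)
    then have "F x z = F y z" if "z \<in> U" for z
      using ext[of z "F x" "F y"] that F by auto
    moreover have "F (x - y) z = F x z - F y z" for z
      using F(1)[of "x - y" y z] by simp
    ultimately have "x - y = 0"
      using nd[of "x - y"] xy U by (simp add: subspace_diff)
    then show "x = y" by simp
  qed
  interpret q: finite_dimensional_vector_space_pair_1 sc "extend_basis {}" sc ..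
  have "dim (g ` U) = dim U"
    using q.dim_image_eq[OF ge, of U] inj U by (simp add: span_eq_iff[THEN iffD2])
  moreover have "subspace (g ` U)"
    using ge U by (simp add: module_hom.subspace_image module_hom_iff_linear)
  ultimately have "g ` U = U"
    using subspace_dim_equal[of "g ` U" U] gU U by auto
  moreover have "(\<Sum>b\<in>B. sc (\<phi> b) b) \<in> U"
    unfolding spB[symmetric] by (intro span_sum span_scale span_base)
  ultimately obtain t where t: "t \<in> U" "g t = (\<Sum>b\<in>B. sc (\<phi> b) b)"
    by (metis imageE)
  then have "F t b = \<phi> b" if "b \<in> B" for b
    using coords[of "F t" \<phi>] that by (simp add: g_def)
  then have "F t y = \<phi> y" if "y \<in> U" for y
    using ext[of y "F t" \<phi>] that F \<phi> by auto
  then show ?thesis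
    using t by blast
qed

end

section \<open>Derivations, Engel's theorem and Cartan's criterion\<close>

context fd_complex_space
begin

lemma endo_trace_eq: "endo_trace f = tr_on (extend_basis {}) f"
  by (simp add: endo_trace_def tr_on_def)

lemma endo_trace_basis:
  assumes "independent B" "span B = UNIV" "endo f"
  shows "endo_trace f = tr_on B f"
  unfolding endo_trace_eq
  by (rule tr_on_basis_change) (use assms independent_Basis span_Basis in auto)

lemma endo_trace_swap: "endo f \<Longrightarrow> endo g \<Longrightarrow> endo_trace (\<lambda>x. f (g x)) = endo_trace (\<lambda>x. g (f x))"
  unfolding endo_trace_eq
  by (rule tr_on_swap) (use independent_Basis span_Basis in auto)

lemma endo_trace_add: "endo_trace (\<lambda>x. f x + g x) = endo_trace f + endo_trace g"
  unfolding endo_trace_eq by (rule tr_on_add) (use independent_Basis span_Basis in auto)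

lemma endo_trace_diff: "endo_trace (\<lambda>x. f x - g x) = endo_trace f - endo_trace g"
  unfolding endo_trace_eq by (rule tr_on_diff) (use independent_Basis span_Basis in auto)

lemma endo_trace_scale: "endo_trace (\<lambda>x. sc a (f x)) = a * endo_trace f"
  unfolding endo_trace_eq by (rule tr_on_scale) (use independent_Basis span_Basis in auto)

lemma endo_trace_nilpotent: "endo f \<Longrightarrow> (\<And>x. \<exists>n. (f ^^ n) x = 0) \<Longrightarrow> endo_trace f = 0"
  unfolding endo_trace_eq by (rule tr_on_nilpotent) (use independent_Basis span_Basis in auto)

lemma span_geig: "endo f \<Longrightarrow> span (\<Union>l. geig f l) = UNIV"
  using geig_decomposition[of f UNIV] by auto

lemma geig_zero_iff: "v \<in> geig f 0 \<longleftrightarrow> (\<exists>n. (f ^^ n) v = 0)"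
  by (simp add: geig_def)

lemma dim_strict: "subspace S \<Longrightarrow> subspace T \<Longrightarrow> S \<subset> T \<Longrightarrow> dim S < dim T"
  by (rule dim_psubset) (simp add: span_eq_iff[THEN iffD2])

lemma maximal_dim_subspace:
  assumes "P A"
  obtains B where "P B" "\<And>C. P C \<Longrightarrow> dim C \<le> dim B"
proof -
  have "\<forall>C. P C \<longrightarrow> dim C < Suc dimension"
    using dim_subset_UNIV by (simp add: less_Suc_eq_le)
  then obtain B where "P B" "\<forall>C. P C \<longrightarrow> dim C \<le> dim B"
    using ex_has_greatest_nat[where P = P and f = dim, OF assms] by blast
  then show ?thesis
    using that by blast
qed

end

context lie_algebra
begin

lemma endo_br: "endo (br x)"
  using linear_br_right by simp

lemma br_add_right: "br x (y + z) = br x y + br x z"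
  and br_scale_right: "br x (sc a y) = sc a (br x y)"
  and br_zero_right [simp]: "br x 0 = 0"
  and br_diff_right: "br x (y - z) = br x y - br x z"
  using endo_br[of x] by (simp_all add: endo_add endo_scale endo_zero endo_diff)

lemma br_add_left: "br (y + z) x = br y x + br z x"
  and br_scale_left: "br (sc a y) x = sc a (br y x)"
  and br_zero_left [simp]: "br 0 x = 0"
  and br_diff_left: "br (y - z) x = br y x - br z x"
  using linear_br_left[of x]
  by (simp_all add: endo_add[of "\<lambda>y. br y x"] endo_scale[of "\<lambda>y. br y x"] endo_zero[of "\<lambda>y. br y x"]
      endo_diff[of "\<lambda>y. br y x"])

lemma br_antisym: "br x y = - br y x"
proof -
  have "br (x + y) (x + y) = br x y + br y x"
    using br_self[of x] br_self[of y] by (simp add: br_add_left br_add_right)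
  then show ?thesis
    using br_self[of "x + y"] by (simp add: eq_neg_iff_add_eq_0)
qed

lemma br_minus_right: "br x (- y) = - br x y"
  using br_diff_right[of x 0 y] by simp

lemma br_derivation: "br x (br y z) = br (br x y) z + br y (br x z)"
proof -
  have "br x (br y z) - br y (br x z) - br (br x y) z = 0"
    using jacobi[of x y z] br_antisym[of z x] br_antisym[of z "br x y"] by (simp add: br_minus_right)
  then show ?thesis
    by (simp add: algebra_simps)
qed

lemma br_br_left: "br (br x y) z = br x (br y z) - br y (br x z)"
  using br_derivation[of x y z] by simp

lemma killing_add_left: "killing (x + y) z = killing x z + killing y z"
  unfolding killing_def by (simp add: br_add_left endo_trace_add)

lemma killing_scale_left: "killing (sc a x) z = a * killing x z"
  unfolding killing_def by (simp add: br_scale_left endo_trace_scale)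

lemma killing_sym: "killing x y = killing y x"
  unfolding killing_def by (rule endo_trace_swap) (rule endo_br)+

lemma killing_add_right: "killing z (x + y) = killing z x + killing z y"
  using killing_add_left killing_sym by metis

lemma killing_scale_right: "killing z (sc a x) = a * killing z x"
  using killing_scale_left killing_sym by metis

lemma killing_zero [simp]: "killing 0 z = 0" "killing z 0 = 0"
  using killing_scale_left[of 0 0 z] killing_scale_right[of z 0 0] by simp_all

lemma killing_minus_left: "killing (- x) z = - killing x z"
  using killing_add_left[of x "- x" z] by (simp add: eq_neg_iff_add_eq_0 add.commute)

lemma killing_diff_left: "killing (x - y) z = killing x z - killing y z"
  using killing_add_left[of x "- y" z] by (simp add: killing_minus_left)

lemma killing_invariant: "killing (br x y) z = killing x (br y z)"
proof -
  have "killing (br x y) z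
      = endo_trace (\<lambda>w. br x (br y (br z w))) - endo_trace (\<lambda>w. br y (br x (br z w)))"
    unfolding killing_def br_br_left endo_trace_diff ..
  also have "endo_trace (\<lambda>w. br y (br x (br z w))) = endo_trace (\<lambda>w. br x (br z (br y w)))"
    by (rule endo_trace_swap[OF endo_br endo_comp[OF endo_br endo_br]])
  also have "endo_trace (\<lambda>w. br x (br y (br z w))) - endo_trace (\<lambda>w. br x (br z (br y w)))
      = killing x (br y z)"
    unfolding killing_def br_br_left br_diff_right endo_trace_diff ..
  finally show ?thesis .
qed

lemma killing_skew: "killing (br h x) y = - killing x (br h y)"
  using killing_invariant[of x h y] br_antisym[of h x] by (simp add: killing_minus_left)

definition derivation :: "('g \<Rightarrow> 'g) \<Rightarrow> bool" where
  "derivation D \<longleftrightarrow> endo D \<and> (\<forall>x y. D (br x y) = br (D x) y + br x (D y))"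

lemma derivation_br: "derivation (br x)"
  unfolding derivation_def using endo_br br_derivation by blast

text \<open>
  The induction on the sum of the two nilpotency orders replaces the binomial formula for the powers
  of \<open>D - (a + b)\<close> on a bracket.
\<close>

lemma geig_derivation_br:
  assumes D: "derivation D" and "y \<in> geig D a" "z \<in> geig D b"
  shows "br y z \<in> geig D (a + b)"
proof -
  have eD: "endo D"
    using D by (simp add: derivation_def)
  obtain m n where "((\<lambda>w. D w - sc a w) ^^ m) y = 0" "((\<lambda>w. D w - sc b w) ^^ n) z = 0"
    using assms by (auto elim!: geigE)
  then show ?thesis
  proof (induction "m + n" arbitrary: m n y z)
    case 0
    then show ?case
      by (simp add: subspace_0 subspace_geig eD)
  next
    case (Suc k)
    show ?case
    proof (cases "m = 0 \<or> n = 0")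
      case True
      then have "br y z = 0"
        using Suc.prems by auto
      then show ?thesis
        by (simp add: subspace_0 subspace_geig eD)
    next
      case False
      then obtain m' n' where mn: "m = Suc m'" "n = Suc n'"
        by (metis not0_implies_Suc)
      have "br (D y - sc a y) z \<in> geig D (a + b)"
        using Suc.prems Suc.hyps(2) mn
        by (intro Suc.hyps(1)[of m' n]) (simp_all del: funpow.simps add: funpow_Suc_right)
      moreover have "br y (D z - sc b z) \<in> geig D (a + b)"
        using Suc.prems Suc.hyps(2) mn
        by (intro Suc.hyps(1)[of m n']) (simp_all del: funpow.simps add: funpow_Suc_right)
      ultimately have "br (D y - sc a y) z + br y (D z - sc b z) \<in> geig D (a + b)"
        using subspace_add subspace_geig[OF eD] by blast
      moreover have "br (D y - sc a y) z + br y (D z - sc b z) = D (br y z) - sc (a + b) (br y z)"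
        using D unfolding derivation_def
        by (simp add: br_diff_left br_diff_right br_scale_left br_scale_right algebra_simps)
      ultimately have "D (br y z) - sc (a + b) (br y z) \<in> geig D (a + b)"
        by simp
      then show ?thesis
        by (rule geig_step)
    qed
  qed
qed

lemma killing_geig_orthogonal:
  assumes "y \<in> geig (br h) a" "z \<in> geig (br h) b" "a + b \<noteq> 0"
  shows "killing y z = 0"
proof -
  obtain m n where "((\<lambda>w. br h w - sc a w) ^^ m) y = 0" "((\<lambda>w. br h w - sc b w) ^^ n) z = 0"
    using assms by (auto elim!: geigE)
  then show ?thesis
  proof (induction "m + n" arbitrary: m n y z)
    case 0
    then show ?case by simp
  next
    case (Suc k)
    show ?case
    proof (cases "m = 0 \<or> n = 0")
      case True
      then show ?thesis
        using Suc.prems by auto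
    next
      case False
      then obtain m' n' where mn: "m = Suc m'" "n = Suc n'"
        by (metis not0_implies_Suc)
      have 1: "killing (br h y - sc a y) z = 0"
        using Suc.prems Suc.hyps(2) mn
        by (intro Suc.hyps(1)[of m' n]) (simp_all del: funpow.simps add: funpow_Suc_right)
      have 2: "killing y (br h z - sc b z) = 0"
        using Suc.prems Suc.hyps(2) mn
        by (intro Suc.hyps(1)[of m n']) (simp_all del: funpow.simps add: funpow_Suc_right)
      have "killing y (br h z - sc b z) = killing y (br h z) - b * killing y z"
        using killing_diff_left[of "br h z" "sc b z" y] killing_sym[of y] by (simp add: killing_scale_left)
      moreover have "killing (br h y - sc a y) z = - killing y (br h z) - a * killing y z"
        by (simp add: killing_diff_left killing_scale_left killing_skew)
      ultimately have "a * killing y z = - (b * killing y z)"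
        using 1 2 by simp
      then have "(a + b) * killing y z = 0"
        by (simp add: distrib_right)
      then show ?thesis
        using assms(3) by simp
    qed
  qed
qed

text \<open>
  Brackets add eigenvalues, so an additive function of the eigenvalues of a derivation is again a
  derivation. This applies to the semisimple part and to its complex conjugate.
\<close>

lemma additive_calculus_derivation:
  assumes D: "derivation D" and s: "endo s" "\<And>l v. v \<in> geig D l \<Longrightarrow> s v = sc (\<phi> l) v"
    and add: "\<And>a b. \<phi> (a + b) = \<phi> a + \<phi> b"
  shows "derivation s"
proof -
  have eD: "endo D"
    using D by (simp add: derivation_def)
  have *: "s (br y z) = br (s y) z + br y (s z)" if y: "y \<in> geig D a" for y z a
  proof -
    have "z \<in> span (\<Union>l. geig D l)"
      using span_geig[OF eD] by simp
    then show ?thesis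
    proof (induction rule: span_induct_alt)
      case base
      then show ?case
        using s(1) by (simp add: endo_zero)
    next
      case (step c x z)
      then obtain b where b: "x \<in> geig D b"
        by blast
      have "s (br y x) = sc (\<phi> (a + b)) (br y x)"
        using s(2) geig_derivation_br[OF D y b] by blast
      then have "s (br y x) = br (s y) x + br y (s x)"
        using s(2)[OF y] s(2)[OF b] by (simp add: add br_scale_left br_scale_right algebra_simps)
      then show ?case
        using step s(1) by (simp add: endo_add endo_scale br_add_right br_scale_right algebra_simps)
    qed
  qed
  have "s (br y z) = br (s y) z + br y (s z)" for y z
  proof -
    have "y \<in> span (\<Union>l. geig D l)"
      using span_geig[OF eD] by simp
    then show ?thesis
    proof (induction rule: span_induct_alt)
      case base
      then show ?case
        using s(1) by (simp add: endo_zero)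
    next
      case (step c x y)
      then obtain a where "x \<in> geig D a"
        by blast
      then have "s (br x z) = br (s x) z + br x (s z)"
        by (rule *)
      then show ?case
        using step s(1) by (simp add: endo_add endo_scale br_add_left br_scale_left algebra_simps)
    qed
  qed
  then show ?thesis
    using s(1) by (simp add: derivation_def)
qed

text \<open>
  Engel's theorem without quotients: nilpotency and the conclusion are relative to a pair of subspaces
  \<open>W \<subset> U\<close>. The induction is on \<open>dim A\<close>. A maximal proper subalgebra \<open>B\<close> of \<open>A\<close> is normalized by
  some \<open>y\<close> outside it, by induction applied to the pair \<open>B \<subset> A\<close>, so \<open>A\<close> is spanned by \<open>B\<close> and \<open>y\<close>.
  The vectors of \<open>U\<close> sent into \<open>W\<close> by \<open>B\<close> are stable under \<open>y\<close>, and the last iterate under \<open>y\<close> outside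
  \<open>W\<close> is the required vector.
\<close>

lemma engel:
  assumes "lie_subalgebra A" "subspace U" "subspace W" "W \<subset> U"
    and "\<And>x v. x \<in> A \<Longrightarrow> v \<in> U \<Longrightarrow> br x v \<in> U" "\<And>x v. x \<in> A \<Longrightarrow> v \<in> W \<Longrightarrow> br x v \<in> W"
    and "\<And>x v. x \<in> A \<Longrightarrow> v \<in> U \<Longrightarrow> \<exists>n. (br x ^^ n) v \<in> W"
    and "\<And>x y. x \<in> A \<Longrightarrow> y \<in> A \<Longrightarrow> \<exists>n. (br x ^^ n) y = 0"
  shows "\<exists>v\<in>U - W. \<forall>x\<in>A. br x v \<in> W"
  using assms
proof (induction "dim A" arbitrary: A U W rule: less_induct)
  case less
  note A = less.prems(1) and U = less.prems(2) and W = less.prems(3) and WU = less.prems(4)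
  have sA: "subspace A"
    using A by (simp add: lie_subalgebra_def)
  show ?case
  proof (cases "A = {0}")
    case True
    then show ?thesis
      using WU W by (auto simp: subspace_0)
  next
    case False
    define Q where "Q B \<longleftrightarrow> lie_subalgebra B \<and> B \<subset> A" for B
    have "Q {0}"
      using False sA by (auto simp: Q_def lie_subalgebra_def subspace_0)
    then obtain B where B: "Q B" and Bmax: "\<And>C. Q C \<Longrightarrow> dim C \<le> dim B"
      using maximal_dim_subspace[of Q "{0}"] by blast
    have Bsub: "lie_subalgebra B" "B \<subseteq> A" "subspace B" "B \<subset> A"
      using B by (auto simp: Q_def lie_subalgebra_def)
    have dB: "dim B < dim A"
      using dim_strict[OF Bsub(3) sA Bsub(4)] .
    have "\<exists>y\<in>A - B. \<forall>x\<in>B. br x y \<in> B"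
    proof (rule less.hyps[OF dB Bsub(1) sA Bsub(3,4)])
      show "br x v \<in> A" if "x \<in> B" "v \<in> A" for x v
        using that A Bsub by (auto simp: lie_subalgebra_def)
      show "br x v \<in> B" if "x \<in> B" "v \<in> B" for x v
        using that Bsub by (auto simp: lie_subalgebra_def)
      show "\<exists>n. (br x ^^ n) v \<in> B" if "x \<in> B" "v \<in> A" for x v
        using less.prems(8)[of x v] that Bsub(2) subspace_0[OF Bsub(3)] by (metis subsetD)
      show "\<exists>n. (br x ^^ n) y = 0" if "x \<in> B" "y \<in> B" for x y
        using less.prems(8)[of x y] that Bsub(2) by blast
    qed
    then obtain y where y: "y \<in> A" "y \<notin> B" "\<And>x. x \<in> B \<Longrightarrow> br x y \<in> B"
      by blast
    have decomp: "x \<in> span (insert y B) \<longleftrightarrow> (\<exists>k. x - sc k y \<in> B)" for x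
      using span_breakdown_eq[of x y B] Bsub(3) by (simp add: span_eq_iff[THEN iffD2])
    have "span (insert y B) = A"
    proof (rule ccontr)
      assume ne: "span (insert y B) \<noteq> A"
      have "span (insert y B) \<subseteq> A"
        using y(1) Bsub(2) sA by (intro span_minimal) auto
      moreover have "br u v \<in> span (insert y B)"
        if uv: "u \<in> span (insert y B)" "v \<in> span (insert y B)" for u v
      proof -
        obtain k l where kl: "u - sc k y \<in> B" "v - sc l y \<in> B"
          using uv decomp by blast
        define b d where "b = u - sc k y" and "d = v - sc l y"
        have bd: "b \<in> B" "d \<in> B" "u = b + sc k y" "v = d + sc l y"
          using kl by (auto simp: b_def d_def)
        have "br u v = br b d + sc l (br b y) - sc k (br d y)"
          using br_antisym[of y d]
          by (simp add: bd br_add_left br_add_right br_scale_left br_scale_right br_self)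
        moreover have "br b d \<in> B"
          using bd Bsub(1) by (simp add: lie_subalgebra_def)
        ultimately have "br u v \<in> B"
          using y(3)[OF bd(1)] y(3)[OF bd(2)] Bsub(3)
          by (simp add: subspace_add subspace_diff subspace_scale)
        then show ?thesis
          using span_superset by blast
      qed
      ultimately have "Q (span (insert y B))"
        using ne by (auto simp: Q_def lie_subalgebra_def)
      then have "dim (span (insert y B)) \<le> dim B"
        by (rule Bmax)
      moreover have "B \<subset> span (insert y B)"
        using y(2) span_base[of y "insert y B"] span_superset[of "insert y B"] by blast
      then have "dim B < dim (span (insert y B))"
        using dim_strict Bsub(3) by blast
      ultimately show False
        by simp
    qed
    with decomp have A_decomp: "\<exists>k. x - sc k y \<in> B" if "x \<in> A" for x
      using that by blast
    have "\<exists>v\<in>U - W. \<forall>x\<in>B. br x v \<in> W"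
    proof (rule less.hyps[OF dB Bsub(1) U W WU])
      show "\<exists>n. (br x ^^ n) v = 0" if "x \<in> B" "v \<in> B" for x v
        using less.prems(8)[of x v] that Bsub(2) by blast
    qed (use less.prems(5-7) Bsub(2) in blast)+
    then obtain v where v: "v \<in> U" "v \<notin> W" "\<And>b. b \<in> B \<Longrightarrow> br b v \<in> W"
      by blast
    have inv: "(br y ^^ n) v \<in> U \<and> (\<forall>b\<in>B. br b ((br y ^^ n) v) \<in> W)" for n
    proof (induction n)
      case 0
      show ?case using v by simp
    next
      case (Suc n)
      define w where "w = (br y ^^ n) v"
      have "br b (br y w) \<in> W" if b: "b \<in> B" for b
      proof -
        have "br (br b y) w \<in> W" "br y (br b w) \<in> W"
          using Suc y b less.prems(6) by (auto simp: w_def)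
        then show ?thesis
          using br_derivation[of b y w] W by (simp add: subspace_add)
      qed
      then show ?case
        using Suc less.prems(5) y(1) by (simp add: w_def)
    qed
    define n where "n = (LEAST n. (br y ^^ n) v \<in> W)"
    have n: "(br y ^^ n) v \<in> W"
      unfolding n_def using less.prems(7)[OF y(1) v(1)] by (rule LeastI_ex)
    have "n \<noteq> 0"
      using n v(2) by (metis funpow_0)
    then obtain m where m: "n = Suc m"
      by (metis not0_implies_Suc)
    define w where "w = (br y ^^ m) v"
    have "w \<notin> W"
      unfolding w_def using not_less_Least[of m "\<lambda>n. (br y ^^ n) v \<in> W"] m n_def by simp
    moreover have "br x w \<in> W" if x: "x \<in> A" for x
    proof -
      obtain k where k: "x - sc k y \<in> B"
        using A_decomp[OF x] by blast
      have "br x w = br (x - sc k y) w + sc k (br y w)"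
        by (simp add: br_diff_left br_scale_left)
      moreover have "br y w \<in> W"
        using n m by (simp add: w_def)
      ultimately show ?thesis
        using inv[of m] k W by (simp add: w_def subspace_add subspace_scale)
    qed
    ultimately show ?thesis
      using inv[of m] by (auto simp: w_def)
  qed
qed

text \<open>
  By Engel's theorem a maximal proper ideal of \<open>D\<close> has codimension one and contains all brackets,
  which is impossible if \<open>D\<close> is spanned by brackets.
\<close>

lemma perfect_nilpotent_trivial:
  assumes D: "lie_subalgebra D" "bracket_span D D = D"
    and nil: "\<And>x y. x \<in> D \<Longrightarrow> y \<in> D \<Longrightarrow> \<exists>n. (br x ^^ n) y = 0"
  shows "D = {0}"
proof (rule ccontr)
  assume ne: "D \<noteq> {0}"
  have sD: "subspace D" "\<And>x y. x \<in> D \<Longrightarrow> y \<in> D \<Longrightarrow> br x y \<in> D"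
    using D by (auto simp: lie_subalgebra_def)
  define Q where "Q W \<longleftrightarrow> subspace W \<and> W \<subset> D \<and> (\<forall>x\<in>D. \<forall>w\<in>W. br x w \<in> W)" for W
  have "Q {0}"
    using ne sD by (auto simp: Q_def subspace_0)
  then obtain W where W: "Q W" and max: "\<And>C. Q C \<Longrightarrow> dim C \<le> dim W"
    using maximal_dim_subspace[of Q "{0}"] by blast
  have "\<exists>v\<in>D - W. \<forall>x\<in>D. br x v \<in> W"
  proof (rule engel[OF D(1) sD(1)])
    show "\<exists>n. (br x ^^ n) v \<in> W" if "x \<in> D" "v \<in> D" for x v
      using nil[OF that] W by (metis Q_def subspace_0)
  qed (use W sD nil in \<open>auto simp: Q_def\<close>)
  then obtain v where v: "v \<in> D" "v \<notin> W" "\<And>x. x \<in> D \<Longrightarrow> br x v \<in> W"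
    by blast
  have to_W: "br x u \<in> W" if x: "x \<in> D" and u: "u \<in> span (insert v W)" for x u
    by (rule endo_span[OF endo_br _ _ u]) (use v(3) W x in \<open>auto simp: Q_def\<close>)
  have "span (insert v W) = D"
  proof (rule ccontr)
    assume "span (insert v W) \<noteq> D"
    moreover have "span (insert v W) \<subseteq> D"
      using v W sD by (intro span_minimal) (auto simp: Q_def)
    moreover have "W \<subseteq> span (insert v W)"
      using span_superset by blast
    ultimately have "Q (span (insert v W))"
      using to_W by (auto simp: Q_def)
    then have "dim (span (insert v W)) \<le> dim W"
      by (rule max)
    moreover have "W \<subset> span (insert v W)"
      using v(2) span_base[of v "insert v W"] span_superset[of "insert v W"] by blast
    then have "dim W < dim (span (insert v W))"
      using dim_strict[of W "span (insert v W)"] W by (simp add: Q_def)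
    ultimately show False
      by simp
  qed
  then have "bracket_span D D \<subseteq> W"
    unfolding bracket_span_def using to_W W by (intro span_minimal) (auto simp: Q_def)
  then show False
    using D(2) W by (auto simp: Q_def)
qed

lemma bracket_span_br: "x \<in> A \<Longrightarrow> y \<in> B \<Longrightarrow> br x y \<in> bracket_span A B"
  unfolding bracket_span_def by (rule span_base) blast

lemma lie_ideal_bracket_span:
  assumes "lie_ideal I"
  shows "lie_ideal (bracket_span I I)" "bracket_span I I \<subseteq> I"
proof -
  show "bracket_span I I \<subseteq> I"
    unfolding bracket_span_def using assms by (intro span_minimal) (auto simp: lie_ideal_def)
  have "br x y \<in> bracket_span I I" if y: "y \<in> bracket_span I I" for x y
  proof (rule endo_span[OF endo_br _ _ y[unfolded bracket_span_def]])
    fix b assume "b \<in> {br x y |x y. x \<in> I \<and> y \<in> I}"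
    then obtain u v where uv: "b = br u v" "u \<in> I" "v \<in> I"
      by blast
    then have "br x u \<in> I" "br x v \<in> I"
      using assms by (auto simp: lie_ideal_def)
    then have "br (br x u) v \<in> bracket_span I I" "br u (br x v) \<in> bracket_span I I"
      using uv by (simp_all add: bracket_span_br)
    then show "br x b \<in> bracket_span I I"
      unfolding uv(1) br_derivation[of x u v] by (simp add: bracket_span_def span_add)
  qed (simp add: bracket_span_def)
  then show "lie_ideal (bracket_span I I)"
    by (auto simp: lie_ideal_def bracket_span_def)
qed

definition killing_radical :: "'g set" where
  "killing_radical = {x. \<forall>y. killing x y = 0}"

lemma lie_ideal_killing_radical: "lie_ideal killing_radical"
  unfolding lie_ideal_def killing_radical_def
  by (auto intro!: subspaceI simp: killing_add_left killing_scale_left killing_skew)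

text \<open>
  Let \<open>s\<close> act by \<open>cnj l\<close> on the generalized eigenspace of \<open>ad x\<close> for \<open>l\<close>. It is a derivation, so for
  \<open>x = [y, z]\<close> the trace of \<open>ad x s\<close> equals minus the Killing form of \<open>y\<close> and \<open>s z\<close>, which is zero for
  \<open>y\<close> in the radical. It also equals the sum of the squared moduli of the eigenvalues.
\<close>

lemma derived_radical_ad_nilpotent:
  assumes x: "x \<in> bracket_span killing_radical killing_radical"
  shows "\<exists>n. (br x ^^ n) y = 0"
proof -
  obtain s B lab where s: "endo s" "\<forall>l. \<forall>v\<in>geig (br x) l. s v = sc (cnj l) v"
    and B: "independent B" "span B = UNIV" "\<forall>b\<in>B. b \<in> geig (br x) (lab b)"
      "tr_on B (\<lambda>v. br x (s v)) = (\<Sum>b\<in>B. lab b * cnj (lab b))"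
    by (rule semisimple_functional_calculus[OF endo_br[of x], where \<phi> = cnj])
  have ds: "derivation s"
    by (rule additive_calculus_derivation[OF derivation_br[of x] s(1), where \<phi> = cnj]) (use s(2) in auto)
  have zero: "endo_trace (\<lambda>v. br u (s v)) = 0" if "u \<in> bracket_span killing_radical killing_radical" for u
    using that unfolding bracket_span_def
  proof (induction rule: span_induct_alt)
    case base
    show ?case
      using endo_trace_scale[of 0 "\<lambda>_. 0"] by simp
  next
    case (step c w u)
    then obtain y z where yz: "w = br y z" "y \<in> killing_radical"
      by blast
    have "endo_trace (\<lambda>v. br w (s v))
        = endo_trace (\<lambda>v. br y (br z (s v))) - endo_trace (\<lambda>v. br z (br y (s v)))"
      unfolding yz(1) br_br_left endo_trace_diff ..
    also have "endo_trace (\<lambda>v. br z (br y (s v))) = endo_trace (\<lambda>v. br y (s (br z v)))"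
      by (rule endo_trace_swap[OF endo_br endo_comp[OF endo_br s(1)]])
    also have "\<dots> = endo_trace (\<lambda>v. br y (br (s z) v)) + endo_trace (\<lambda>v. br y (br z (s v)))"
      using ds by (simp add: derivation_def br_add_right endo_trace_add)
    also have "endo_trace (\<lambda>v. br y (br (s z) v)) = 0"
      using yz(2) by (simp add: killing_radical_def killing_def)
    finally have "endo_trace (\<lambda>v. br w (s v)) = 0"
      by simp
    then show ?case
      using step by (simp add: br_add_left br_scale_left endo_trace_add endo_trace_scale)
  qed
  have "(\<Sum>b\<in>B. complex_of_real ((cmod (lab b))\<^sup>2)) = 0"
    unfolding complex_norm_square
    using zero[OF x] endo_trace_basis[OF B(1,2) endo_comp[OF endo_br s(1)]] B(4) by simp
  then have "(\<Sum>b\<in>B. (cmod (lab b))\<^sup>2) = 0"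
    unfolding of_real_sum[symmetric] of_real_eq_0_iff .
  then have "lab b = 0" if "b \<in> B" for b
    using that finiteI_independent[OF B(1)] by (simp add: sum_nonneg_eq_0_iff)
  then have "B \<subseteq> geig (br x) 0"
    using B(3) by fastforce
  then have "span B \<subseteq> geig (br x) 0"
    using subspace_geig[OF endo_br] by (simp add: span_minimal)
  then show ?thesis
    using B(2) geig_zero_iff by blast
qed

text \<open>
  The derived series of the radical of the Killing form becomes stationary; its last term is perfect
  and consists of ad-nilpotent elements, so it is zero and the radical is a solvable ideal.
\<close>

theorem killing_nondegenerate:
  assumes "semisimple" "\<And>y. killing x y = 0"
  shows "x = 0"
proof -
  define T where "T n = ((\<lambda>D. bracket_span D D) ^^ n) killing_radical" for n
  have T_Suc: "T (Suc n) = bracket_span (T n) (T n)" for n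
    by (simp add: T_def)
  have Ti: "lie_ideal (T n)" for n
    by (induction n) (simp_all add: T_def lie_ideal_killing_radical lie_ideal_bracket_span)
  have Tsub: "T (Suc n) \<subseteq> T n" for n
    unfolding T_Suc by (rule lie_ideal_bracket_span(2)[OF Ti])
  have "\<exists>n. T (Suc (Suc n)) = T (Suc n)"
  proof (rule ccontr)
    assume "\<nexists>n. T (Suc (Suc n)) = T (Suc n)"
    then have "T (Suc (Suc n)) \<subset> T (Suc n)" for n
      using Tsub by blast
    then have lt: "dim (T (Suc (Suc n))) < dim (T (Suc n))" for n
      using dim_strict Ti by (auto simp: lie_ideal_def)
    have "dim (T (Suc n)) + n \<le> dim (T (Suc 0))" for n
      using lt by (induction n) (simp, metis (no_types, opaque_lifting) Suc_leI add_Suc_right add_le_mono1 add_Suc le_trans)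
    then have "Suc (dim (T (Suc 0))) \<le> dim (T (Suc 0))"
      using le_trans add_leD2 by blast
    then show False by simp
  qed
  then obtain n where n: "T (Suc (Suc n)) = T (Suc n)"
    by blast
  have T1: "T (Suc n) \<subseteq> T (Suc 0)" for n
    using Tsub by (induction n) auto
  have "T (Suc n) = {0}"
  proof (rule perfect_nilpotent_trivial)
    show "lie_subalgebra (T (Suc n))"
      using Ti[of "Suc n"] by (auto simp: lie_ideal_def lie_subalgebra_def)
    show "bracket_span (T (Suc n)) (T (Suc n)) = T (Suc n)"
      using n by (simp add: T_Suc)
    fix x y assume "x \<in> T (Suc n)"
    then have "x \<in> bracket_span killing_radical killing_radical"
      using T1[of n] by (auto simp: T_def)
    then show "\<exists>n. (br x ^^ n) y = 0"
      by (rule derived_radical_ad_nilpotent)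
  qed
  then have "solvable killing_radical"
    unfolding solvable_def T_def by blast
  then have "killing_radical = {0}"
    using assms(1) lie_ideal_killing_radical unfolding semisimple_def by blast
  then show ?thesis
    using assms(2) by (auto simp: killing_radical_def)
qed

text \<open>
  Choose \<open>t\<close> such that the Killing form with \<open>t\<close> is the functional that takes \<open>y\<close> to the trace of
  \<open>D ad y\<close>. The derivation \<open>E = D - ad t\<close> is orthogonal to all \<open>ad y\<close>, and invariance of the trace
  makes every \<open>E y\<close> orthogonal to the whole algebra.
\<close>

lemma derivation_inner:
  assumes ss: "semisimple" and D: "derivation D"
  obtains t where "\<And>y. D y = br t y"
proof -
  have eD: "endo D"
    using D by (simp add: derivation_def)
  define \<phi> where "\<phi> y = endo_trace (\<lambda>v. D (br y v))" for y
  have \<phi>: "\<phi> (x + y) = \<phi> x + \<phi> y" "\<phi> (sc a x) = a * \<phi> x" for a x y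
    unfolding \<phi>_def br_add_left br_scale_left endo_add[OF eD] endo_scale[OF eD]
    by (rule endo_trace_add endo_trace_scale)+
  have "\<exists>t\<in>UNIV. \<forall>y\<in>UNIV. killing t y = \<phi> y"
    by (rule nondegenerate_form_represents)
      (use killing_nondegenerate[OF ss] in \<open>auto simp: killing_add_left killing_add_right
        killing_scale_left killing_scale_right \<phi>\<close>)
  then obtain t where t: "\<And>y. killing t y = endo_trace (\<lambda>v. D (br y v))"
    unfolding \<phi>_def by blast
  define E where "E = (\<lambda>y. D y - br t y)"
  have eE: "endo E"
    unfolding E_def by (rule endo_minus[OF eD endo_br])
  have trE: "endo_trace (\<lambda>v. E (br y v)) = 0" for y
    using t[of y] by (simp add: E_def endo_trace_diff killing_def)
  have dE: "E (br y z) = br (E y) z + br y (E z)" for y z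
    using D br_derivation[of t y z] by (simp add: E_def derivation_def br_diff_left br_diff_right)
  have "killing (E y) z = 0" for y z
  proof -
    have "br (E y) w = E (br y w) - br y (E w)" for w
      using dE[of y w] by simp
    then have "killing (E y) z
        = endo_trace (\<lambda>v. E (br y (br z v))) - endo_trace (\<lambda>v. br y (E (br z v)))"
      unfolding killing_def by (simp add: endo_trace_diff)
    also have "endo_trace (\<lambda>v. br y (E (br z v))) = endo_trace (\<lambda>v. E (br z (br y v)))"
      by (rule endo_trace_swap[OF endo_br endo_comp[OF eE endo_br]])
    also have "endo_trace (\<lambda>v. E (br y (br z v))) - endo_trace (\<lambda>v. E (br z (br y v)))
        = endo_trace (\<lambda>v. E (br (br y z) v))"
      unfolding br_br_left by (simp add: endo_diff[OF eE] endo_trace_diff)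
    finally show ?thesis
      by (simp add: trE)
  qed
  then have "E y = 0" for y
    using killing_nondegenerate[OF ss] by blast
  then show ?thesis
    using that by (simp add: E_def)
qed

end

section \<open>Cartan subalgebras of semisimple Lie algebras\<close>

lemma funpow_comp_commuting:
  assumes "\<And>x. f (g x) = g (f x)"
  shows "((\<lambda>x. f (g x)) ^^ n) x = (g ^^ n) ((f ^^ n) x)"
proof -
  have *: "f ((g ^^ k) y) = (g ^^ k) (f y)" for k y
    by (induction k) (simp_all add: assms)
  show ?thesis
    by (induction n) (simp_all add: assms *)
qed

locale cartan_semisimple = lie_algebra sc br
  for sc :: "complex \<Rightarrow> 'g::real_normed_vector \<Rightarrow> 'g" and br +
  fixes H :: "'g set"
  assumes semisimple: "semisimple"
    and cartan: "cartan_subalgebra H"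
begin

lemma subspace_H: "subspace H"
  and br_H: "x \<in> H \<Longrightarrow> y \<in> H \<Longrightarrow> br x y \<in> H"
  and nilpotent_H: "nilpotent H"
  using cartan by (auto simp: cartan_subalgebra_def lie_subalgebra_def)

lemma self_normalizing: "(\<And>y. y \<in> H \<Longrightarrow> br x y \<in> H) \<Longrightarrow> x \<in> H"
  using cartan by (auto simp: cartan_subalgebra_def)

definition lower_central :: "nat \<Rightarrow> 'g set" where
  "lower_central k = ((\<lambda>D. bracket_span H D) ^^ k) H"

lemma lower_central_Suc: "lower_central (Suc k) = bracket_span H (lower_central k)"
  and lower_central_0: "lower_central 0 = H"
  by (simp_all add: lower_central_def)

lemma lower_central_vanishes: "\<exists>n. lower_central n = {0}"
  using nilpotent_H by (simp add: nilpotent_def lower_central_def)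

lemma lower_central_subset: "lower_central k \<subseteq> H"
proof (induction k)
  case (Suc k)
  then show ?case
    unfolding lower_central_Suc bracket_span_def
    using br_H subspace_H by (intro span_minimal) auto
qed (simp add: lower_central_0)

lemma ad_nilpotent_on_H:
  assumes "x \<in> H" "y \<in> H"
  shows "\<exists>n. (br x ^^ n) y = 0"
proof -
  have "(br x ^^ k) y \<in> lower_central k" for k
    by (induction k) (simp_all add: assms lower_central_0 lower_central_Suc bracket_span_br)
  then show ?thesis
    using lower_central_vanishes by (metis singletonD)
qed

lemma H_subset_geig_0: "h \<in> H \<Longrightarrow> x \<in> H \<Longrightarrow> x \<in> geig (br h) 0"
  using ad_nilpotent_on_H by (simp add: geig_zero_iff)

lemma geig_H_invariant: "h \<in> H \<Longrightarrow> x \<in> H \<Longrightarrow> v \<in> geig (br h) l \<Longrightarrow> br x v \<in> geig (br h) l"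
  using geig_derivation_br[OF derivation_br H_subset_geig_0] by fastforce

text \<open>The complement of \<open>H\<close> in the Fitting decomposition of the adjoint action of \<open>H\<close>.\<close>

definition nonzero_part :: "'g set" where
  "nonzero_part = span (\<Union>h\<in>H. \<Union>l\<in>-{0}. geig (br h) l)"

text \<open>
  Among the \<open>H\<close>-stable subspaces that together with \<open>nonzero_part\<close> span the algebra, one of least
  dimension lies in the generalized zero eigenspace of every \<open>ad h\<close>, since it could otherwise be
  intersected with one of these. The common generalized zero eigenspace is \<open>H\<close>: otherwise Engel's
  theorem yields an element outside \<open>H\<close> that normalizes \<open>H\<close>.
\<close>

lemma H_nonzero_part_decomposition: "\<exists>x\<in>H. v - x \<in> nonzero_part"
proof -
  define P where "P C \<longleftrightarrow> subspace C \<and> (\<forall>x\<in>H. \<forall>v\<in>C. br x v \<in> C) \<and> (\<forall>v. \<exists>x\<in>C. v - x \<in> nonzero_part)" for C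
  have "P UNIV"
    unfolding P_def by (auto intro: exI[of _ v for v] simp: nonzero_part_def span_zero) (metis diff_self span_zero)
  then obtain C where C: "P C" and min: "\<And>C'. P C' \<Longrightarrow> dim C \<le> dim C'"
    using ex_has_least_nat[of P UNIV dim] by blast
  have C_geig: "C \<subseteq> geig (br h) 0" if h: "h \<in> H" for h
  proof -
    define C' where "C' = C \<inter> geig (br h) 0"
    have sC': "subspace C'"
      using C subspace_geig[OF endo_br] by (simp add: C'_def P_def subspace_inter)
    have proj: "\<exists>x\<in>C'. c - x \<in> nonzero_part" if "c \<in> C" for c
    proof -
      have "c \<in> span (\<Union>l. geig (br h) l \<inter> C)"
        using geig_decomposition[OF endo_br, of C h] C h that by (auto simp: P_def)
      then show ?thesis
      proof (induction rule: span_induct_alt)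
        case base
        then show ?case
          using sC' by (intro bexI[of _ 0]) (auto simp: subspace_0 nonzero_part_def span_zero)
      next
        case (step a s y)
        then obtain x l where x: "x \<in> C'" "y - x \<in> nonzero_part" and l: "s \<in> geig (br h) l" "s \<in> C"
          by blast
        show ?case
        proof (cases "l = 0")
          case True
          then have "s \<in> C'"
            using l by (simp add: C'_def)
          then have "sc a s + x \<in> C'"
            using x(1) by (intro subspace_add[OF sC'] subspace_scale[OF sC'])
          moreover have "sc a s + y - (sc a s + x) \<in> nonzero_part"
            using x by simp
          ultimately show ?thesis by blast
        next
          case False
          then have "sc a s \<in> nonzero_part"
            using l h unfolding nonzero_part_def by (intro span_scale span_base) auto
          then have "sc a s + (y - x) \<in> nonzero_part"
            using x unfolding nonzero_part_def by (intro span_add)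
          then have "sc a s + y - x \<in> nonzero_part"
            by (simp add: algebra_simps)
          then show ?thesis
            using x by blast
        qed
      qed
    qed
    have "P C'"
      unfolding P_def
    proof (intro conjI ballI allI)
      show "\<exists>x\<in>C'. v - x \<in> nonzero_part" for v
      proof -
        obtain c where c: "c \<in> C" "v - c \<in> nonzero_part"
          using C unfolding P_def by blast
        obtain x where x: "x \<in> C'" "c - x \<in> nonzero_part"
          using proj[OF c(1)] by blast
        have "(v - c) + (c - x) \<in> nonzero_part"
          using c x unfolding nonzero_part_def by (intro span_add)
        then show ?thesis
          using x by (intro bexI[of _ x]) simp_all
      qed
    qed (use C h geig_H_invariant sC' in \<open>auto simp: P_def C'_def\<close>)
    then have "dim C \<le> dim C'"
      by (rule min)
    then have "C' = C"
      using sC' C dim_strict[of C' C] by (auto simp: P_def C'_def)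
    then show ?thesis
      by (auto simp: C'_def)
  qed
  define C0 where "C0 = {v. \<forall>h\<in>H. v \<in> geig (br h) 0}"
  have "C0 = (\<Inter>h\<in>H. geig (br h) 0)"
    by (auto simp: C0_def)
  then have sC0: "subspace C0"
    by (simp add: subspace_Int subspace_geig[OF endo_br])
  have "C0 = H"
  proof (rule ccontr)
    assume "C0 \<noteq> H"
    have "\<exists>v\<in>C0 - H. \<forall>x\<in>H. br x v \<in> H"
    proof (rule engel[OF _ sC0 subspace_H])
      show "lie_subalgebra H"
        using subspace_H br_H by (simp add: lie_subalgebra_def)
      show "H \<subset> C0"
        using \<open>C0 \<noteq> H\<close> H_subset_geig_0 by (auto simp: C0_def)
      show "\<exists>n. (br x ^^ n) v \<in> H" if xv: "x \<in> H" "v \<in> C0" for x v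
      proof -
        obtain n where "(br x ^^ n) v = 0"
          using xv by (auto simp: C0_def geig_zero_iff)
        then show ?thesis
          using subspace_0[OF subspace_H] by (intro exI[of _ n]) simp
      qed
    qed (use geig_H_invariant br_H ad_nilpotent_on_H in \<open>auto simp: C0_def\<close>)
    then obtain v where v: "v \<notin> H" "\<And>x. x \<in> H \<Longrightarrow> br x v \<in> H"
      by blast
    then have "br v y \<in> H" if "y \<in> H" for y
      using br_antisym[of v y] that subspace_H by (simp add: subspace_neg)
    then show False
      using self_normalizing v by blast
  qed
  then have "C \<subseteq> H"
    using C_geig by (auto simp: C0_def)
  then show ?thesis
    using C unfolding P_def by blast
qed

lemma killing_nonzero_part:
  assumes "x \<in> H" "v \<in> nonzero_part"
  shows "killing x v = 0"
  using assms(2) unfolding nonzero_part_def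
proof (induction rule: span_induct_alt)
  case base
  then show ?case by simp
next
  case (step c s y)
  then obtain h l where hl: "h \<in> H" "l \<noteq> 0" "s \<in> geig (br h) l"
    by blast
  then have "killing x s = 0"
    using killing_geig_orthogonal[OF H_subset_geig_0[OF hl(1) assms(1)] hl(3)] by simp
  then show ?case
    using step by (simp add: killing_add_right killing_scale_right)
qed

lemma killing_nondegenerate_H:
  assumes "x \<in> H" "\<And>y. y \<in> H \<Longrightarrow> killing x y = 0"
  shows "x = 0"
proof (rule killing_nondegenerate[OF semisimple])
  fix v
  obtain y where y: "y \<in> H" "v - y \<in> nonzero_part"
    using H_nonzero_part_decomposition by blast
  have "killing x v = killing x y + killing x (v - y)"
    using killing_add_right[of x y "v - y"] by simp
  then show "killing x v = 0"
    using assms y killing_nonzero_part by simp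
qed

text \<open>
  \<open>ad z\<close> is nilpotent and commutes with every \<open>ad h\<close>, so the products \<open>ad z ad h\<close> are nilpotent and
  \<open>z\<close> is orthogonal to \<open>H\<close>.
\<close>

lemma central_ad_nilpotent_zero:
  assumes z: "z \<in> H" and comm: "\<And>h. h \<in> H \<Longrightarrow> br z h = 0" and nil: "\<And>v. \<exists>n. (br z ^^ n) v = 0"
  shows "z = 0"
proof (rule killing_nondegenerate_H[OF z])
  fix h assume h: "h \<in> H"
  have c: "br z (br h v) = br h (br z v)" for v
    using br_derivation[of z h v] comm[OF h] by simp
  have "\<exists>n. ((\<lambda>v. br z (br h v)) ^^ n) v = 0" for v
  proof -
    obtain n where "(br z ^^ n) v = 0"
      using nil by blast
    then have "((\<lambda>v. br z (br h v)) ^^ n) v = 0"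
      by (simp add: funpow_comp_commuting[of "br z" "br h", OF c] endo_zero[OF endo_funpow[OF endo_br]])
    then show ?thesis ..
  qed
  then show "killing z h = 0"
    unfolding killing_def by (rule endo_trace_nilpotent[OF endo_comp[OF endo_br endo_br]])
qed

text \<open>
  Every \<open>ad h\<close> preserves the generalized eigenspaces of \<open>ad z\<close>. On the one for \<open>l\<close> the trace of \<open>ad z\<close>
  is \<open>l\<close> times the dimension, and it is zero because \<open>z\<close> is a sum of commutators.
\<close>

lemma central_commutator_zero:
  assumes z: "z \<in> bracket_span H H" and comm: "\<And>h. h \<in> H \<Longrightarrow> br z h = 0"
  shows "z = 0"
proof (rule central_ad_nilpotent_zero[OF _ comm])
  show "z \<in> H"
    using z lower_central_subset[of 1] by (auto simp: lower_central_def)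
  have only0: "geig (br z) l = {0}" if "l \<noteq> 0" for l
  proof -
    obtain B where B: "B \<subseteq> geig (br z) l" "independent B" "geig (br z) l \<subseteq> span B"
      using maximal_independent_subset by blast
    have spB: "span B = geig (br z) l"
      using B subspace_geig[OF endo_br] by (simp add: span_subspace)
    have inv: "br h x \<in> span B" if "h \<in> H" "x \<in> span B" for h x
    proof -
      have "br h (br z v) = br z (br h v)" for v
        using br_derivation[of z h v] comm[OF that(1)] by simp
      then show ?thesis
        using geig_commuting[OF endo_br endo_br] that(2) spB by blast
    qed
    have "u \<in> H \<and> tr_on B (br u) = 0" if "u \<in> bracket_span H H" for u
      using that unfolding bracket_span_def
    proof (induction rule: span_induct_alt)
      case base
      then show ?case
        using subspace_0[OF subspace_H] by (simp add: tr_on_def representation_zero)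
    next
      case (step c x y)
      then obtain a b where ab: "x = br a b" "a \<in> H" "b \<in> H"
        by blast
      have "br x = (\<lambda>v. br a (br b v) - br b (br a v))"
        using ab(1) br_br_left by blast
      then have x: "x \<in> H" "tr_on B (br x) = 0"
        using ab br_H tr_on_commutator[OF B(2) endo_br inv[OF ab(2)] endo_br inv[OF ab(3)]]
        by simp_all
      have "tr_on B (\<lambda>v. br (sc c x + y) v) = tr_on B (\<lambda>v. sc c (br x v)) + tr_on B (br y)"
        unfolding br_add_left br_scale_left
        using tr_on_add[OF B(2), of "\<lambda>v. sc c (br x v)" "br y"] inv x(1) step by (simp add: span_base span_scale)
      also have "tr_on B (\<lambda>v. sc c (br x v)) = c * tr_on B (br x)"
        using inv x(1) by (intro tr_on_scale[OF B(2)]) (simp add: span_base)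
      finally show ?case
        using x step subspace_H by (simp add: subspace_add subspace_scale)
    qed
    then have "l * of_nat (card B) = 0"
      using tr_on_geig[OF endo_br B(2) spB] z by simp
    then have "card B = 0"
      using \<open>l \<noteq> 0\<close> by simp
    then have "B = {}"
      using finiteI_independent[OF B(2)] by simp
    then show ?thesis
      using spB by simp
  qed
  have "(\<Union>l. geig (br z) l) \<subseteq> geig (br z) 0"
  proof
    fix v assume "v \<in> (\<Union>l. geig (br z) l)"
    then obtain l where "v \<in> geig (br z) l"
      by blast
    then show "v \<in> geig (br z) 0"
      using only0[of l] subspace_0[OF subspace_geig[OF endo_br]] by (cases "l = 0") auto
  qed
  then have "span (\<Union>l. geig (br z) l) \<subseteq> geig (br z) 0"
    by (rule span_minimal) (rule subspace_geig[OF endo_br])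
  then show "\<exists>n. (br z ^^ n) v = 0" for v
    using span_geig[OF endo_br] geig_zero_iff by blast
qed

text \<open>
  If the commutators do not vanish, the last nonzero term of the lower central series consists of
  central sums of commutators.
\<close>

lemma H_abelian:
  assumes "x \<in> H" "y \<in> H"
  shows "br x y = 0"
proof -
  define n where "n = (LEAST n. lower_central n = {0})"
  have n: "lower_central n = {0}"
    unfolding n_def using lower_central_vanishes by (rule LeastI_ex)
  have "lower_central 1 = {0}"
  proof (cases "n \<le> 1")
    case True
    then consider "n = 0" | "n = 1"
      by linarith
    then show ?thesis
    proof cases
      case 1
      then have "H = {0}"
        using n by (simp add: lower_central_0)
      then show ?thesis
        unfolding One_nat_def lower_central_Suc lower_central_0 bracket_span_def by simp
    next
      case 2
      then show ?thesis
        using n by simp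
    qed
  next
    case False
    then obtain k where k: "n = Suc (Suc k)"
      by (metis One_nat_def Suc_le_mono le0 not0_implies_Suc nat_le_linear)
    have "lower_central (Suc k) \<noteq> {0}"
      using not_less_Least[of "Suc k" "\<lambda>n. lower_central n = {0}"] k by (simp add: n_def)
    moreover have "0 \<in> lower_central (Suc k)"
      by (simp add: lower_central_Suc bracket_span_def span_zero)
    ultimately obtain z where z: "z \<in> lower_central (Suc k)" "z \<noteq> 0"
      by blast
    have "br h z \<in> lower_central n" if "h \<in> H" for h
      using bracket_span_br[OF that z(1)] by (simp add: k lower_central_Suc)
    then have "br z h = 0" if "h \<in> H" for h
      using that n br_antisym[of z h] by auto
    moreover have "bracket_span H (lower_central k) \<subseteq> bracket_span H H"
      unfolding bracket_span_def using lower_central_subset[of k] by (intro span_mono) blast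
    then have "z \<in> bracket_span H H"
      using z(1) by (auto simp: lower_central_Suc)
    ultimately show ?thesis
      using central_commutator_zero z(2) by blast
  qed
  then have "bracket_span H H = {0}"
    by (simp add: lower_central_def)
  then show ?thesis
    using bracket_span_br[OF assms] by simp
qed

text \<open>
  The semisimple part of \<open>ad h\<close> is a derivation, hence \<open>ad t\<close> for some \<open>t\<close>; it kills \<open>H\<close>, so \<open>t\<close>
  normalizes \<open>H\<close> and lies in it. Then \<open>h - t\<close> is ad-nilpotent and central in \<open>H\<close>, so it vanishes.
\<close>

lemma H_ad_diagonalizable:
  assumes h: "h \<in> H" and "v \<in> geig (br h) l"
  shows "br h v = sc l v"
proof -
  obtain s B lab where s: "endo s" "\<forall>l. \<forall>v\<in>geig (br h) l. s v = sc l v"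
    and "independent B" "span B = UNIV" "\<forall>b\<in>B. b \<in> geig (br h) (lab b)"
      "tr_on B (\<lambda>v. br h (s v)) = (\<Sum>b\<in>B. lab b * lab b)"
    by (rule semisimple_functional_calculus[OF endo_br[of h], where \<phi> = "\<lambda>l. l"])
  have "derivation s"
    by (rule additive_calculus_derivation[OF derivation_br[of h] s(1), where \<phi> = "\<lambda>l. l"]) (use s(2) in auto)
  then obtain t where t: "\<And>y. s y = br t y"
    using derivation_inner[OF semisimple] by blast
  have tH: "br t y = 0" if "y \<in> H" for y
    using s(2) H_subset_geig_0[OF h that] t[of y] by fastforce
  have "t \<in> H"
    by (rule self_normalizing) (simp add: tH subspace_0[OF subspace_H])
  define n where "n = h - t"
  have nv: "br n v = br h v - sc l v" if "v \<in> geig (br h) l" for v l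
    using s(2) t that by (simp add: n_def br_diff_left)
  have pow: "(br n ^^ j) v = ((\<lambda>w. br h w - sc l w) ^^ j) v" if "v \<in> geig (br h) l" for v l j
    using that
  proof (induction j arbitrary: v)
    case (Suc j)
    have "br h v - sc l v \<in> geig (br h) l"
      using Suc.prems geig_invariant[OF endo_br] subspace_geig[OF endo_br]
      by (simp add: subspace_diff subspace_scale)
    then show ?case
      using Suc.IH[of "br h v - sc l v"] nv[OF Suc.prems]
      by (simp del: funpow.simps add: funpow_Suc_right)
  qed simp
  have "geig (br h) l \<subseteq> geig (br n) 0" for l
    using pow by (fastforce simp: geig_def)
  then have "span (\<Union>l. geig (br h) l) \<subseteq> geig (br n) 0"
    by (intro span_minimal subspace_geig endo_br) blast
  then have "\<exists>j. (br n ^^ j) v = 0" for v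
    using span_geig[OF endo_br] geig_zero_iff by blast
  moreover have "n \<in> H"
    using h \<open>t \<in> H\<close> subspace_H by (simp add: n_def subspace_diff)
  ultimately have "n = 0"
    using central_ad_nilpotent_zero H_abelian by blast
  then show ?thesis
    using nv[OF assms(2)] by simp
qed

text \<open>
  Induction on the dimension: if some \<open>ad h\<close> is not scalar on \<open>U\<close>, its eigenspaces in \<open>U\<close> are proper
  subspaces, and they are stable under \<open>H\<close>.
\<close>

lemma simultaneous_eigenvectors_span:
  assumes "subspace U" "\<And>h v. h \<in> H \<Longrightarrow> v \<in> U \<Longrightarrow> br h v \<in> U"
  shows "U \<subseteq> span {v. \<forall>h\<in>H. \<exists>l. br h v = sc l v}"
  using assms
proof (induction "dim U" arbitrary: U rule: less_induct)
  case less
  show ?case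
  proof (cases "\<forall>h\<in>H. \<exists>l. \<forall>v\<in>U. br h v = sc l v")
    case True
    then have "U \<subseteq> {v. \<forall>h\<in>H. \<exists>l. br h v = sc l v}"
      by blast
    then show ?thesis
      using span_superset by (rule subset_trans)
  next
    case False
    then obtain h where h: "h \<in> H" "\<And>l. \<exists>v\<in>U. br h v \<noteq> sc l v"
      by blast
    have "geig (br h) l \<inter> U \<subseteq> span {v. \<forall>h\<in>H. \<exists>l. br h v = sc l v}" for l
    proof (rule less.hyps)
      show sub: "subspace (geig (br h) l \<inter> U)"
        using less.prems subspace_geig[OF endo_br] by (simp add: subspace_inter)
      have "geig (br h) l \<inter> U \<noteq> U"
        using h H_ad_diagonalizable[OF h(1)] by blast
      then show "dim (geig (br h) l \<inter> U) < dim U"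
        using dim_strict[OF sub less.prems(1)] by blast
    qed (use less.prems geig_H_invariant[OF h(1)] in auto)
    then have "span (\<Union>l. geig (br h) l \<inter> U) \<subseteq> span {v. \<forall>h\<in>H. \<exists>l. br h v = sc l v}"
      by (intro span_minimal) auto
    then show ?thesis
      using geig_decomposition[OF endo_br less.prems(1)] less.prems(2) h(1) by blast
  qed
qed

lemma root_space_iff: "x \<in> root_space H \<alpha> \<longleftrightarrow> (\<forall>h\<in>H. br h x = sc (\<alpha> h) x)"
  by (simp add: root_space_def weight_space_def)

lemma subspace_root_space: "subspace (root_space H \<alpha>)"
  by (rule subspaceI) (auto simp: root_space_iff br_add_right br_scale_right algebra_simps)

lemma simultaneous_eigenvector_cases:
  assumes v: "v \<noteq> 0" "\<forall>h\<in>H. \<exists>l. br h v = sc l v"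
  shows "v \<in> H \<or> (\<exists>\<alpha>\<in>roots H. v \<in> root_space H \<alpha>)"
proof -
  define \<alpha> where "\<alpha> h = (if h \<in> H then (SOME l. br h v = sc l v) else 0)" for h
  have \<alpha>: "br h v = sc (\<alpha> h) v" if "h \<in> H" for h
    using someI_ex[of "\<lambda>l. br h v = sc l v"] v(2) that by (simp add: \<alpha>_def)
  \<comment> \<open>Eigenvalues of a nonzero vector are unique, which makes \<open>\<alpha>\<close> linear.\<close>
  have eq: "a = b" if "sc a v = sc b v" for a b
    using that v(1) by (simp add: scale_cancel_right)
  have dual: "\<alpha> \<in> dual_space H"
    unfolding dual_space_def
  proof (intro CollectI conjI ballI allI impI)
    fix x y assume xy: "x \<in> H" "y \<in> H"
    then show "\<alpha> (x + y) = \<alpha> x + \<alpha> y"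
      using \<alpha>[of x] \<alpha>[of y] \<alpha>[of "x + y"] subspace_H
      by (intro eq) (simp add: subspace_add br_add_left algebra_simps)
  next
    fix c x assume x: "x \<in> H"
    then show "\<alpha> (sc c x) = c * \<alpha> x"
      using \<alpha>[of x] \<alpha>[of "sc c x"] subspace_H
      by (intro eq) (auto simp: subspace_scale br_scale_left)
  qed (simp add: \<alpha>_def)
  have mem: "v \<in> root_space H \<alpha>"
    using \<alpha> by (simp add: root_space_iff)
  show ?thesis
  proof (cases "\<exists>x\<in>H. \<alpha> x \<noteq> 0")
    case True
    then show ?thesis
      using dual mem v(1) by (auto simp: roots_def)
  next
    case False
    then have comm: "br v h = 0" if "h \<in> H" for h
      using \<alpha>[OF that] br_antisym[of v h] that by simp
    have "v \<in> H"
      by (rule self_normalizing) (simp add: comm subspace_0[OF subspace_H])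
    then show ?thesis ..
  qed
qed

theorem root_decomposition: "span (H \<union> (\<Union>\<alpha>\<in>roots H. root_space H \<alpha>)) = UNIV"
proof -
  have "{v. \<forall>h\<in>H. \<exists>l. br h v = sc l v} \<subseteq> H \<union> (\<Union>\<alpha>\<in>roots H. root_space H \<alpha>)"
  proof
    fix v assume "v \<in> {v. \<forall>h\<in>H. \<exists>l. br h v = sc l v}"
    then show "v \<in> H \<union> (\<Union>\<alpha>\<in>roots H. root_space H \<alpha>)"
      using simultaneous_eigenvector_cases[of v] subspace_0[OF subspace_H] by (cases "v = 0") auto
  qed
  then have "span {v. \<forall>h\<in>H. \<exists>l. br h v = sc l v} \<subseteq> span (H \<union> (\<Union>\<alpha>\<in>roots H. root_space H \<alpha>))"
    by (rule span_mono)
  then show ?thesis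
    using simultaneous_eigenvectors_span[of UNIV] by auto
qed

end

section \<open>Roots\<close>

locale cartan_form = cartan_semisimple sc br H
  for sc :: "complex \<Rightarrow> 'g::real_normed_vector \<Rightarrow> 'g" and br H +
  fixes c :: complex
  assumes c_nonzero: "c \<noteq> 0"
begin

abbreviation form :: "'g \<Rightarrow> 'g \<Rightarrow> complex" where
  "form \<equiv> inv_form c"

lemma form_add_left: "form (x + y) z = form x z + form y z"
  and form_add_right: "form z (x + y) = form z x + form z y"
  and form_scale_left: "form (sc a x) z = a * form x z"
  and form_scale_right: "form z (sc a x) = a * form z x"
  and form_zero [simp]: "form 0 z = 0" "form z 0 = 0"
  and form_minus_left: "form (- x) z = - form x z"
  by (simp_all add: inv_form_def killing_add_left killing_add_right killing_scale_left
      killing_scale_right killing_minus_left algebra_simps)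

lemma form_sym: "form x y = form y x"
  by (simp add: inv_form_def killing_sym)

lemma form_invariant: "form (br x y) z = form x (br y z)"
  by (simp add: inv_form_def killing_invariant)

lemma form_skew: "form (br h x) y = - form x (br h y)"
  by (simp add: inv_form_def killing_skew)

lemma form_nondegenerate: "(\<And>y. form x y = 0) \<Longrightarrow> x = 0"
  using killing_nondegenerate[OF semisimple] c_nonzero by (simp add: inv_form_def)

lemma form_nondegenerate_H: "x \<in> H \<Longrightarrow> (\<And>y. y \<in> H \<Longrightarrow> form x y = 0) \<Longrightarrow> x = 0"
  using killing_nondegenerate_H c_nonzero by (simp add: inv_form_def)

lemma form_zero_on_span:
  assumes "\<And>s. s \<in> S \<Longrightarrow> form s y = 0" "x \<in> span S"
  shows "form x y = 0"
  using assms(2) by (induction rule: span_induct_alt) (simp_all add: assms(1) form_add_left form_scale_left)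

lemma form_sum_left: "form (sum g A) y = (\<Sum>i\<in>A. form (g i) y)"
  by (induction A rule: infinite_finite_induct) (simp_all add: form_add_left)

lemma root_space_zero: "root_space H (\<lambda>_. 0) = H"
proof
  show "root_space H (\<lambda>_. 0) \<subseteq> H"
  proof
    fix x assume "x \<in> root_space H (\<lambda>_. 0)"
    then have "br x h = 0" if "h \<in> H" for h
      using that br_antisym[of x h] by (simp add: root_space_iff)
    then show "x \<in> H"
      using subspace_0[OF subspace_H] by (metis self_normalizing)
  qed
  show "H \<subseteq> root_space H (\<lambda>_. 0)"
    using H_abelian by (auto simp: root_space_iff)
qed

text \<open>
  Stated for arbitrary functions \<open>\<alpha>\<close> and \<open>\<beta>\<close>, so that it covers \<open>H\<close>, whose weight is zero, and
  multiples of roots as well as roots.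
\<close>

lemma form_root_orthogonal:
  assumes "x \<in> root_space H \<alpha>" "y \<in> root_space H \<beta>" "h \<in> H" "\<alpha> h + \<beta> h \<noteq> 0"
  shows "form x y = 0"
proof -
  have "form (br h x) y = - form x (br h y)"
    by (rule form_skew)
  then have "\<alpha> h * form x y = - (\<beta> h * form x y)"
    using assms by (simp add: root_space_iff form_scale_left form_scale_right)
  then have "(\<alpha> h + \<beta> h) * form x y = 0"
    by (simp add: distrib_right)
  then show ?thesis
    using assms(4) by simp
qed

lemma form_H_root: "x \<in> H \<Longrightarrow> y \<in> root_space H \<beta> \<Longrightarrow> h \<in> H \<Longrightarrow> \<beta> h \<noteq> 0 \<Longrightarrow> form x y = 0"
  using form_root_orthogonal[of x "\<lambda>_. 0" y \<beta> h] by (simp add: root_space_zero)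

lemma br_root_space:
  assumes "x \<in> root_space H \<alpha>" "y \<in> root_space H \<beta>"
  shows "br x y \<in> root_space H (\<lambda>h. \<alpha> h + \<beta> h)"
  using assms br_derivation[of _ x y]
  by (simp add: root_space_iff br_scale_left br_scale_right algebra_simps)

lemma root_linear:
  assumes "\<alpha> \<in> roots H"
  shows "x \<in> H \<Longrightarrow> y \<in> H \<Longrightarrow> \<alpha> (x + y) = \<alpha> x + \<alpha> y" "x \<in> H \<Longrightarrow> \<alpha> (sc a x) = a * \<alpha> x"
    "x \<notin> H \<Longrightarrow> \<alpha> x = 0"
  using assms by (auto simp: roots_def dual_space_def)

lemma root_nonzero:
  assumes "\<alpha> \<in> roots H"
  obtains h where "h \<in> H" "\<alpha> h \<noteq> 0"
  using assms by (auto simp: roots_def)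

lemma roots_separated:
  assumes "\<alpha> \<in> roots H" "\<beta> \<in> roots H" "\<alpha> \<noteq> \<beta>"
  obtains h where "h \<in> H" "\<alpha> h \<noteq> \<beta> h"
  using assms root_linear(3) by (metis ext)

lemma dual_vector:
  assumes "\<alpha> \<in> roots H"
  shows dual_vector_in_H: "dual_vector c H \<alpha> \<in> H"
    and form_dual_vector: "x \<in> H \<Longrightarrow> form (dual_vector c H \<alpha>) x = \<alpha> x"
proof -
  have "\<exists>t\<in>H. \<forall>y\<in>H. form t y = \<alpha> y"
    by (rule nondegenerate_form_represents[OF subspace_H])
      (use form_nondegenerate_H root_linear[OF assms] in \<open>auto simp: form_add_left form_add_right
        form_scale_left form_scale_right\<close>)
  then have "\<exists>!t. t \<in> H \<and> (\<forall>x\<in>H. form t x = \<alpha> x)"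
  proof (rule bexE, intro ex1I)
    fix t s assume t: "t \<in> H" "\<forall>y\<in>H. form t y = \<alpha> y" and s: "s \<in> H \<and> (\<forall>x\<in>H. form s x = \<alpha> x)"
    have "form (s - t) y = 0" if "y \<in> H" for y
      using form_add_left[of s "- t" y] s t that by (simp add: form_minus_left)
    then show "s = t"
      using form_nondegenerate_H[of "s - t"] s t subspace_diff[OF subspace_H] by simp
  qed auto
  then have "dual_vector c H \<alpha> \<in> H \<and> (\<forall>x\<in>H. form (dual_vector c H \<alpha>) x = \<alpha> x)"
    unfolding dual_vector_def by (rule theI')
  then show "dual_vector c H \<alpha> \<in> H" "x \<in> H \<Longrightarrow> form (dual_vector c H \<alpha>) x = \<alpha> x"
    by auto
qed

text \<open>An element of a root space is orthogonal to \<open>H\<close> and to every root space except the opposite one.\<close>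

lemma root_pairing:
  assumes \<alpha>: "\<alpha> \<in> roots H" and x: "x \<in> root_space H \<alpha>" "x \<noteq> 0"
  obtains y where "y \<in> root_space H (- \<alpha>)" "form x y = 1"
proof -
  have "\<exists>y\<in>root_space H (- \<alpha>). form x y \<noteq> 0"
  proof (rule ccontr)
    assume neg: "\<not> ?thesis"
    have "form s x = 0" if "s \<in> H \<union> (\<Union>\<beta>\<in>roots H. root_space H \<beta>)" for s
      using that
    proof
      assume "s \<in> H"
      then show ?thesis
        using root_nonzero[OF \<alpha>] form_H_root[OF _ x(1)] by metis
    next
      assume "s \<in> (\<Union>\<beta>\<in>roots H. root_space H \<beta>)"
      then obtain \<beta> where \<beta>: "\<beta> \<in> roots H" "s \<in> root_space H \<beta>"
        by blast
      show ?thesis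
      proof (cases "\<exists>h\<in>H. \<beta> h + \<alpha> h \<noteq> 0")
        case True
        then show ?thesis
          using form_root_orthogonal[OF \<beta>(2) x(1)] by blast
      next
        case False
        then have "s \<in> root_space H (- \<alpha>)"
          using \<beta>(2) by (auto simp: root_space_iff add_eq_0_iff)
        then show ?thesis
          using neg form_sym by auto
      qed
    qed
    then have "form s x = 0" for s
      using form_zero_on_span[of "H \<union> (\<Union>\<beta>\<in>roots H. root_space H \<beta>)" x s] root_decomposition by simp
    then have "form x s = 0" for s
      by (simp add: form_sym[of x])
    then show False
      using form_nondegenerate x(2) by blast
  qed
  then obtain y where y: "y \<in> root_space H (- \<alpha>)" "form x y \<noteq> 0"
    by blast
  then show ?thesis
    using that[of "sc (1 / form x y) y"] subspace_scale[OF subspace_root_space] by (simp add: form_scale_right)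
qed

lemma neg_root:
  assumes "\<alpha> \<in> roots H"
  shows "- \<alpha> \<in> roots H"
proof -
  obtain x where x: "x \<in> root_space H \<alpha>" "x \<noteq> 0"
    using assms subspace_0[OF subspace_root_space] by (auto simp: roots_def)
  obtain y where y: "y \<in> root_space H (- \<alpha>)" "form x y = 1"
    by (rule root_pairing[OF assms x])
  then have "y \<noteq> 0"
    by auto
  then show ?thesis
    using assms y(1) by (auto simp: roots_def dual_space_def)
qed

text \<open>
  Nonzero vectors of distinct root spaces are independent, as vectors of the opposite root spaces
  separate them.
\<close>

lemma finite_roots: "finite (roots H)"
proof -
  have "\<exists>x. x \<in> root_space H \<alpha> \<and> x \<noteq> 0" if "\<alpha> \<in> roots H" for \<alpha>
    using that subspace_0[OF subspace_root_space] by (auto simp: roots_def)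
  then obtain x where x: "\<And>\<alpha>. \<alpha> \<in> roots H \<Longrightarrow> x \<alpha> \<in> root_space H \<alpha>" "\<And>\<alpha>. \<alpha> \<in> roots H \<Longrightarrow> x \<alpha> \<noteq> 0"
    by metis
  have orth: "form (x \<beta>) y = 0"
    if ab: "\<alpha> \<in> roots H" "\<beta> \<in> roots H" "\<alpha> \<noteq> \<beta>" "y \<in> root_space H (- \<alpha>)" for \<alpha> \<beta> y
  proof -
    obtain h where "h \<in> H" "\<alpha> h \<noteq> \<beta> h"
      by (rule roots_separated[OF ab(1-3)])
    then show ?thesis
      using form_root_orthogonal[OF x(1)[OF ab(2)] ab(4), of h] by simp
  qed
  have inj: "inj_on x (roots H)"
  proof (rule inj_onI, rule ccontr)
    fix \<alpha> \<beta> assume ab: "\<alpha> \<in> roots H" "\<beta> \<in> roots H" "x \<alpha> = x \<beta>" "\<alpha> \<noteq> \<beta>"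
    obtain y where y: "y \<in> root_space H (- \<alpha>)" "form (x \<alpha>) y = 1"
      by (rule root_pairing[OF ab(1) x(1)[OF ab(1)] x(2)[OF ab(1)]])
    then show False
      using orth[OF ab(1,2,4) y(1)] ab(3) by simp
  qed
  have "independent (x ` roots H)"
    unfolding independent_explicit_module
  proof (intro allI impI)
    fix T u v
    assume T: "finite T" "T \<subseteq> x ` roots H" "(\<Sum>v\<in>T. sc (u v) v) = 0" "v \<in> T"
    obtain \<alpha> where \<alpha>: "\<alpha> \<in> roots H" "v = x \<alpha>"
      using T by blast
    obtain y where y: "y \<in> root_space H (- \<alpha>)" "form (x \<alpha>) y = 1"
      by (rule root_pairing[OF \<alpha>(1) x(1)[OF \<alpha>(1)] x(2)[OF \<alpha>(1)]])
    have "(\<Sum>w\<in>T. u w * form w y) = form (\<Sum>v\<in>T. sc (u v) v) y"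
      by (simp add: form_sum_left form_scale_left)
    also have "\<dots> = 0"
      using T by simp
    also have "(\<Sum>w\<in>T. u w * form w y) = (\<Sum>w\<in>{v}. u w * form w y)"
      using T \<alpha> orth[OF \<alpha>(1) _ _ y(1)] by (intro sum.mono_neutral_right) auto
    finally show "u v = 0"
      using \<alpha>(2) y(2) by simp
  qed
  then show ?thesis
    using finiteI_independent inj finite_imageD by blast
qed

lemma br_opposite_roots:
  assumes \<alpha>: "\<alpha> \<in> roots H" and x: "x \<in> root_space H \<alpha>" and y: "y \<in> root_space H (- \<alpha>)"
  shows "br x y = sc (form x y) (dual_vector c H \<alpha>)"
proof -
  have xy: "br x y \<in> H"
    using br_root_space[OF x y] root_space_zero by simp
  have "br x y - sc (form x y) (dual_vector c H \<alpha>) = 0"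
  proof (rule form_nondegenerate_H)
    show "br x y - sc (form x y) (dual_vector c H \<alpha>) \<in> H"
      using xy dual_vector_in_H[OF \<alpha>] subspace_H by (simp add: subspace_diff subspace_scale)
    fix h assume h: "h \<in> H"
    have "form (br x y) h = form h (br x y)"
      by (rule form_sym)
    also have "\<dots> = form (br h x) y"
      by (simp add: form_invariant)
    also have "\<dots> = \<alpha> h * form x y"
      using x h by (simp add: root_space_iff form_scale_left)
    finally show "form (br x y - sc (form x y) (dual_vector c H \<alpha>)) h = 0"
      using form_add_left[of "br x y" "- sc (form x y) (dual_vector c H \<alpha>)" h] form_dual_vector[OF \<alpha> h]
      by (simp add: form_minus_left form_scale_left)
  qed
  then show ?thesis by simp
qed

text \<open>
  If \<open>\<alpha>\<close> vanishes at \<open>t\<close>, then \<open>ad t\<close> acts on the string of weights \<open>\<beta> + k\<alpha>\<close> by the scalar \<open>\<beta>(t)\<close>. Its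
  trace there is zero, as \<open>t\<close> is a commutator of elements that preserve the string. So all roots
  vanish at \<open>t\<close> and \<open>t\<close> is central, hence zero, although it represents \<open>\<alpha>\<close>.
\<close>

lemma root_norm_nonzero:
  assumes \<alpha>: "\<alpha> \<in> roots H"
  shows "\<alpha> (dual_vector c H \<alpha>) \<noteq> 0"
proof
  define t where "t = dual_vector c H \<alpha>"
  assume "\<alpha> (dual_vector c H \<alpha>) = 0"
  then have at: "\<alpha> t = 0"
    by (simp add: t_def)
  have tH: "t \<in> H"
    using dual_vector_in_H[OF \<alpha>] by (simp add: t_def)
  obtain x where x: "x \<in> root_space H \<alpha>" "x \<noteq> 0"
    using \<alpha> subspace_0[OF subspace_root_space] by (auto simp: roots_def)
  obtain y where y: "y \<in> root_space H (- \<alpha>)" "form x y = 1"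
    by (rule root_pairing[OF \<alpha> x])
  have xy: "br x y = t"
    using br_opposite_roots[OF \<alpha> x(1) y(1)] y(2) by (simp add: t_def)
  have bt: "\<beta> t = 0" if \<beta>: "\<beta> \<in> roots H" for \<beta>
  proof -
    define W where "W k = root_space H (\<lambda>h. \<beta> h + of_int k * \<alpha> h)" for k
    have up: "br x v \<in> W (k + 1)" if "v \<in> W k" for v k
      using br_root_space[OF x(1) that[unfolded W_def]] by (simp add: W_def algebra_simps)
    have down: "br y v \<in> W (k - 1)" if "v \<in> W k" for v k
      using br_root_space[OF y(1) that[unfolded W_def]] by (simp add: W_def algebra_simps)
    obtain B where B: "B \<subseteq> (\<Union>k. W k)" "independent B" "(\<Union>k. W k) \<subseteq> span B"
      using maximal_independent_subset by blast
    have inv: "br x v \<in> span B" "br y v \<in> span B" if "v \<in> span B" for v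
    proof -
      show "br x v \<in> span B"
        by (rule endo_span[OF endo_br _ subspace_span that]) (use B up in blast)
      show "br y v \<in> span B"
        by (rule endo_span[OF endo_br _ subspace_span that]) (use B down in blast)
    qed
    have "tr_on B (\<lambda>v. br x (br y v) - br y (br x v)) = 0"
      by (rule tr_on_commutator[OF B(2) endo_br inv(1) endo_br inv(2)])
    moreover have "br t = (\<lambda>v. br x (br y v) - br y (br x v))"
      unfolding xy[symmetric] using br_br_left by blast
    ultimately have "tr_on B (br t) = 0"
      by simp
    moreover have "br t b = sc (\<beta> t) b" if "b \<in> B" for b
      using that B(1) tH at by (auto simp: W_def root_space_iff)
    then have "tr_on B (br t) = (\<Sum>b\<in>B. \<beta> t)"
      by (rule tr_on_eigenbasis[OF B(2)])
    ultimately have "of_nat (card B) * \<beta> t = 0"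
      by simp
    moreover have "card B \<noteq> 0"
    proof
      assume "card B = 0"
      then have "B = {}"
        using finiteI_independent[OF B(2)] by simp
      then have "W 0 \<subseteq> {0}"
        using B(3) by auto
      then show False
        using \<beta> subspace_0[OF subspace_root_space] by (auto simp: W_def roots_def)
    qed
    ultimately show ?thesis
      by simp
  qed
  have "br t s = 0" if "s \<in> H \<union> (\<Union>\<beta>\<in>roots H. root_space H \<beta>)" for s
    using that H_abelian tH bt by (auto simp: root_space_iff)
  then have "br t v = 0" for v
    using endo_span[OF endo_br, of "H \<union> (\<Union>\<beta>\<in>roots H. root_space H \<beta>)" t "{0}" v] root_decomposition by auto
  then have "form t v = 0" for v
    using endo_trace_scale[of 0 "\<lambda>_. 0"] by (simp add: inv_form_def killing_def)
  moreover obtain h where "h \<in> H" "\<alpha> h \<noteq> 0"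
    by (rule root_nonzero[OF \<alpha>])
  ultimately show False
    using form_dual_vector[OF \<alpha>] by (simp add: t_def)
qed

text \<open>
  On the span of \<open>f\<close>, \<open>t\<close> and the spaces of weight \<open>k\<alpha>\<close> with \<open>k \<ge> 1\<close> the trace of \<open>ad t\<close> is
  \<open>-\<alpha>(t) + 0 + \<Sum> k \<alpha>(t)\<close>, where the sum is over a basis of weight vectors. It is zero since
  \<open>t = [e, f]\<close>. Hence the sum of the multiplicities \<open>k\<close> is one, and the basis is a single vector of
  weight \<open>\<alpha>\<close>.
\<close>

lemma root_space_one_dimensional:
  assumes \<alpha>: "\<alpha> \<in> roots H" and e: "e \<in> root_space H \<alpha>" "e \<noteq> 0"
  shows "root_space H \<alpha> \<subseteq> span {e}"
proof -
  define t where "t = dual_vector c H \<alpha>"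
  have tH: "t \<in> H" and ft: "\<And>x. x \<in> H \<Longrightarrow> form t x = \<alpha> x"
    using dual_vector[OF \<alpha>] by (auto simp: t_def)
  have at: "\<alpha> t \<noteq> 0"
    using root_norm_nonzero[OF \<alpha>] by (simp add: t_def)
  obtain f where f: "f \<in> root_space H (- \<alpha>)" "form e f = 1"
    by (rule root_pairing[OF \<alpha> e])
  have ef: "br e f = t"
    using br_opposite_roots[OF \<alpha> e(1) f(1)] f(2) by (simp add: t_def)
  define W where "W k = root_space H (\<lambda>h. of_nat k * \<alpha> h)" for k :: nat
  define S where "S = (\<Union>k\<in>{1..}. W k)"
  have W1: "W 1 = root_space H \<alpha>"
    by (simp add: W_def)
  have up: "br e v \<in> S" if "v \<in> W k" for v k
  proof -
    have "br e v \<in> W (Suc k)"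
      using br_root_space[OF e(1) that[unfolded W_def]] by (simp add: W_def algebra_simps)
    then show ?thesis
      by (auto simp: S_def)
  qed
  have down: "br f v \<in> span (insert t S)" if v: "v \<in> W k" and k: "1 \<le> k" for v k
  proof (cases "k = 1")
    case True
    then have "br v f = sc (form v f) t"
      using br_opposite_roots[OF \<alpha> _ f(1)] v W1 by (simp add: t_def)
    then have "br f v = - sc (form v f) t"
      using br_antisym[of f v] by simp
    then show ?thesis
      by (metis insertI1 span_base span_neg span_scale)
  next
    case False
    have "br f v \<in> W (k - 1)"
      using br_root_space[OF f(1) v[unfolded W_def]] k by (simp add: W_def of_nat_diff algebra_simps)
    then have "br f v \<in> S"
      using False k by (auto simp: S_def intro!: bexI[of _ "k - 1"])
    then show ?thesis
      by (simp add: span_base)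
  qed
  obtain B where B: "B \<subseteq> S" "independent B" "S \<subseteq> span B"
    using maximal_independent_subset by blast
  obtain k where k: "\<And>b. b \<in> B \<Longrightarrow> 1 \<le> k b \<and> b \<in> W (k b)"
  proof -
    have "\<forall>b\<in>B. \<exists>k. 1 \<le> k \<and> b \<in> W k"
      using B(1) by (auto simp: S_def)
    then show ?thesis
      using that by metis
  qed
  have finB: "finite B"
    using B finiteI_independent by blast
  have t_notin: "t \<notin> span B"
  proof
    assume "t \<in> span B"
    moreover have "form b t = 0" if "b \<in> B" for b
    proof -
      have "form t b = 0"
        using form_H_root[OF tH, of b "\<lambda>h. of_nat (k b) * \<alpha> h" t] k[OF that] tH at by (simp add: W_def)
      then show ?thesis
        by (simp add: form_sym)
    qed
    ultimately have "form t t = 0"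
      using form_zero_on_span by blast
    then show False
      using ft tH at by simp
  qed
  have f_notin: "f \<notin> span (insert t B)"
  proof
    assume "f \<in> span (insert t B)"
    moreover have "form b e = 0" if "b \<in> insert t B" for b
    proof (cases "b = t")
      case True
      then show ?thesis
        using form_H_root[OF tH e(1) tH at] by simp
    next
      case False
      then have b: "b \<in> W (k b)"
        using that k by blast
      have "of_nat (k b) * \<alpha> t + \<alpha> t = of_nat (Suc (k b)) * \<alpha> t"
        by (simp add: algebra_simps)
      then have "of_nat (k b) * \<alpha> t + \<alpha> t \<noteq> 0"
        using at by (simp del: of_nat_Suc)
      then show ?thesis
        using form_root_orthogonal[OF b[unfolded W_def] e(1) tH] by simp
    qed
    ultimately have "form f e = 0"
      using form_zero_on_span by blast
    then show False
      using f(2) form_sym[of e f] by simp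
  qed
  have notin: "t \<notin> B" "f \<notin> insert t B"
    using t_notin f_notin span_base by blast+
  define M where "M = insert f (insert t B)"
  have indM: "independent M"
    unfolding M_def using B(2) t_notin f_notin by (intro independent_insertI)
  have SM: "span (insert t S) \<subseteq> span M"
  proof (rule span_minimal)
    have "span B \<subseteq> span M"
      by (rule span_mono) (auto simp: M_def)
    then show "insert t S \<subseteq> span M"
      using B(3) by (auto simp: M_def intro: span_base)
  qed simp
  have sM: "v \<in> span M" if "v \<in> S" for v
    using that SM span_base[of v "insert t S"] by auto
  have te: "br e t = sc (- \<alpha> t) e" and tf: "br f t = sc (\<alpha> t) f"
    using e(1) f(1) tH br_antisym[of e t] br_antisym[of f t] by (simp_all add: root_space_iff)
  have eS: "e \<in> S"
    using e W1 by (auto simp: S_def)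
  have e_inv: "br e v \<in> span M" if "v \<in> span M" for v
  proof (rule endo_span[OF endo_br _ subspace_span that])
    fix b assume "b \<in> M"
    then consider "b = f" | "b = t" | "b \<in> B"
      by (auto simp: M_def)
    then show "br e b \<in> span M"
    proof cases
      case 1
      then show ?thesis using ef by (simp add: M_def span_base)
    next
      case 2
      then show ?thesis using te sM[OF eS] by (simp add: span_scale span_neg)
    next
      case 3
      then show ?thesis using sM up k by blast
    qed
  qed
  have f_inv: "br f v \<in> span M" if "v \<in> span M" for v
  proof (rule endo_span[OF endo_br _ subspace_span that])
    fix b assume "b \<in> M"
    then consider "b = f" | "b = t" | "b \<in> B"
      by (auto simp: M_def)
    then show "br f b \<in> span M"
    proof cases
      case 1
      then show ?thesis by (simp add: br_self span_zero)
    next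
      case 2
      then show ?thesis using tf by (simp add: M_def span_base span_scale)
    next
      case 3
      then show ?thesis using SM down k by blast
    qed
  qed
  have "tr_on M (\<lambda>v. br e (br f v) - br f (br e v)) = 0"
    by (rule tr_on_commutator[OF indM endo_br e_inv endo_br f_inv])
  moreover have "br t = (\<lambda>v. br e (br f v) - br f (br e v))"
    unfolding ef[symmetric] using br_br_left by blast
  ultimately have tr0: "tr_on M (br t) = 0"
    by simp
  define \<kappa> where "\<kappa> b = (if b = f then - \<alpha> t else if b = t then 0 else of_nat (k b) * \<alpha> t)" for b
  have "br t b = sc (\<kappa> b) b" if "b \<in> M" for b
    using that f(1) tH k[of b] by (auto simp: M_def \<kappa>_def root_space_iff W_def br_self)
  then have "tr_on M (br t) = (\<Sum>b\<in>M. \<kappa> b)"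
    by (rule tr_on_eigenbasis[OF indM])
  also have "\<dots> = \<kappa> f + (\<kappa> t + (\<Sum>b\<in>B. \<kappa> b))"
    unfolding M_def using notin finB by simp
  also have "\<kappa> f + (\<kappa> t + (\<Sum>b\<in>B. \<kappa> b)) = - \<alpha> t + (\<Sum>b\<in>B. \<kappa> b)"
    using notin by (auto simp: \<kappa>_def)
  also have "(\<Sum>b\<in>B. \<kappa> b) = (\<Sum>b\<in>B. of_nat (k b) * \<alpha> t)"
    using notin by (intro sum.cong refl) (auto simp: \<kappa>_def)
  also have "\<dots> = of_nat (\<Sum>b\<in>B. k b) * \<alpha> t"
    by (simp add: sum_distrib_right)
  finally have "(of_nat (\<Sum>b\<in>B. k b) - 1) * \<alpha> t = 0"
    using tr0 by (simp add: algebra_simps)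
  then have "of_nat (\<Sum>b\<in>B. k b) = (1 :: complex)"
    using at by simp
  then have "(\<Sum>b\<in>B. k b) = 1"
    using of_nat_eq_1_iff by blast
  moreover have "card B \<le> (\<Sum>b\<in>B. k b)"
    using sum_mono[of B "\<lambda>_. 1" k] k by simp
  ultimately have "card B \<le> 1"
    by simp
  have "e \<in> span B"
    using B(3) eS by blast
  then have "B \<noteq> {}"
    using e(2) by auto
  then have "card B = 1"
    using \<open>card B \<le> 1\<close> finB by (simp add: le_Suc_eq)
  then obtain b where b: "B = {b}"
    by (auto simp: card_1_singleton_iff)
  obtain a where a: "e = sc a b"
    using \<open>e \<in> span B\<close> b by (auto simp: span_singleton)
  then have "a \<noteq> 0"
    using e(2) by auto
  then have "b = sc (1 / a) e"
    using a by simp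
  then have "b \<in> span {e}"
    by (simp add: span_base span_scale)
  then have "span B \<subseteq> span {e}"
    using b by (intro span_minimal) auto
  moreover have "root_space H \<alpha> \<subseteq> S"
    using W1 by (auto simp: S_def)
  ultimately show ?thesis
    using B(3) by blast
qed

lemma dual_bases_H:
  obtains B d where "finite B" "B \<subseteq> H" "d ` B \<subseteq> H"
    "\<forall>y\<in>H. y = (\<Sum>b\<in>B. sc (form y (d b)) b)" "\<forall>y\<in>H. y = (\<Sum>b\<in>B. sc (form b y) (d b))"
proof -
  obtain B where B: "B \<subseteq> H" "independent B" "H \<subseteq> span B"
    using maximal_independent_subset by blast
  have spB: "span B = H"
    using B subspace_H by (simp add: span_subspace)
  have finB: "finite B"
    using B finiteI_independent by blast
  have "\<exists>t\<in>H. \<forall>y\<in>H. form t y = representation B y b" for b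
    by (rule nondegenerate_form_represents[OF subspace_H])
      (use form_nondegenerate_H in \<open>auto simp: form_add_left form_add_right form_scale_left
        form_scale_right representation_add representation_scale B(2) spB\<close>)
  then obtain d where d: "\<And>b. d b \<in> H" "\<And>b y. y \<in> H \<Longrightarrow> form (d b) y = representation B y b"
    by metis
  have 1: "y = (\<Sum>b\<in>B. sc (form y (d b)) b)" if "y \<in> H" for y
    using sum_representation_eq[OF B(2) _ finB order_refl, of y] that spB by (simp add: d(2) form_sym[of y])
  have 2: "y = (\<Sum>b\<in>B. sc (form b y) (d b))" if y: "y \<in> H" for y
  proof -
    have "y - (\<Sum>b\<in>B. sc (form b y) (d b)) = 0"
    proof (rule form_nondegenerate_H)
      show "y - (\<Sum>b\<in>B. sc (form b y) (d b)) \<in> H"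
        using y d(1) subspace_H by (intro subspace_diff subspace_sum subspace_scale) auto
      fix z assume z: "z \<in> H"
      have "form y z = form (\<Sum>b\<in>B. sc (form z (d b)) b) y"
        using 1[OF z] form_sym[of y z] by simp
      also have "\<dots> = (\<Sum>b\<in>B. form z (d b) * form b y)"
        by (simp add: form_sum_left form_scale_left)
      also have "\<dots> = form (\<Sum>b\<in>B. sc (form b y) (d b)) z"
        by (simp add: form_sum_left form_scale_left form_sym[of z] mult.commute)
      finally show "form (y - (\<Sum>b\<in>B. sc (form b y) (d b))) z = 0"
        using form_add_left[of y "- (\<Sum>b\<in>B. sc (form b y) (d b))" z] by (simp add: form_minus_left)
    qed
    then show ?thesis by simp
  qed
  show ?thesis
    using that[of B d] finB B(1) d(1) 1 2 by blast
qed

end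

section \<open>Commutation of the truncated Casimir operators\<close>

text \<open>
  By skewness \<open>p \<alpha> * q \<beta>\<close> may be replaced by half of the determinant \<open>D\<close>, which vanishes if \<open>\<alpha>\<close> and
  \<open>\<beta>\<close> have the same point in the plane. The remaining pairs are grouped by the line through their
  points. With an affine parameter \<open>s\<close> on the line, \<open>D\<close> is a constant times \<open>s \<beta> - s \<alpha>\<close>, and each of
  the two terms sums to zero by the hypothesis on lines.
\<close>

lemma (in fd_complex_space) line_sums_cancel:
  fixes p q :: "'r \<Rightarrow> complex" and k :: "'r \<Rightarrow> 'r \<Rightarrow> 'a"
  assumes R: "finite R"
    and skew: "\<And>\<alpha> \<beta>. k \<alpha> \<beta> = - k \<beta> \<alpha>"
    and line: "\<And>a b m \<alpha>. \<alpha> \<in> R \<Longrightarrow> a * p \<alpha> + b * q \<alpha> + m = 0 \<Longrightarrow>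
      (\<Sum>\<beta>\<in>{\<beta>\<in>R. a * p \<beta> + b * q \<beta> + m = 0}. k \<alpha> \<beta>) = 0"
  shows "(\<Sum>\<alpha>\<in>R. \<Sum>\<beta>\<in>R. sc (p \<alpha> * q \<beta>) (k \<alpha> \<beta>)) = 0"
proof -
  define D where "D = (\<lambda>(\<alpha>, \<beta>). p \<alpha> * q \<beta> - q \<alpha> * p \<beta>)"
  define G where "G z = sc (D z) (case_prod k z)" for z
  define P where "P = {(\<alpha>, \<beta>). \<alpha> \<in> R \<and> \<beta> \<in> R \<and> (p \<alpha>, q \<alpha>) \<noteq> (p \<beta>, q \<beta>)}"
  define L where "L = (\<lambda>(\<alpha>, \<beta>). {\<gamma>\<in>R. (p \<beta> - p \<alpha>) * (q \<gamma> - q \<alpha>) - (q \<beta> - q \<alpha>) * (p \<gamma> - p \<alpha>) = 0})"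
  have "P \<subseteq> R \<times> R"
    by (auto simp: P_def)
  then have finP: "finite P"
    using R finite_subset by blast
  have fibre: "(\<Sum>z\<in>{z\<in>P. L z = \<Psi>}. G z) = 0" if Psi: "\<Psi> \<in> L ` P" for \<Psi>
  proof -
    obtain \<alpha>0 \<beta>0 where 0: "\<alpha>0 \<in> R" "\<beta>0 \<in> R" "(p \<alpha>0, q \<alpha>0) \<noteq> (p \<beta>0, q \<beta>0)" "\<Psi> = L (\<alpha>0, \<beta>0)"
      using Psi by (auto simp: P_def)
    define u w where "u = p \<beta>0 - p \<alpha>0" and "w = q \<beta>0 - q \<alpha>0"
    have uw: "u \<noteq> 0 \<or> w \<noteq> 0"
      using 0 by (auto simp: u_def w_def)
    \<comment> \<open>The affine parameter on the line, read off from a coordinate in which the direction \<open>(u, w)\<close> is nonzero.\<close>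
    define s where "s \<gamma> = (if u \<noteq> 0 then (p \<gamma> - p \<alpha>0) / u else (q \<gamma> - q \<alpha>0) / w)" for \<gamma>
    have mem: "\<gamma> \<in> \<Psi> \<longleftrightarrow> \<gamma> \<in> R \<and> u * (q \<gamma> - q \<alpha>0) = w * (p \<gamma> - p \<alpha>0)" for \<gamma>
      by (simp add: 0(4) L_def u_def w_def)
    have finPsi: "finite \<Psi>"
      using R mem by (meson finite_subset subsetI)
    have param: "p \<gamma> = p \<alpha>0 + s \<gamma> * u" "q \<gamma> = q \<alpha>0 + s \<gamma> * w" if "\<gamma> \<in> \<Psi>" for \<gamma>
    proof -
      have "p \<gamma> - p \<alpha>0 = s \<gamma> * u \<and> q \<gamma> - q \<alpha>0 = s \<gamma> * w"
      proof (cases "u = 0")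
        case True
        then show ?thesis
          using that uw mem[of \<gamma>] by (simp add: s_def)
      next
        case False
        have "q \<gamma> - q \<alpha>0 = u * (q \<gamma> - q \<alpha>0) / u"
          using False by simp
        also have "\<dots> = s \<gamma> * w"
          using that mem[of \<gamma>] False by (simp add: s_def)
        finally show ?thesis
          using False by (simp add: s_def)
      qed
      then show "p \<gamma> = p \<alpha>0 + s \<gamma> * u" "q \<gamma> = q \<alpha>0 + s \<gamma> * w"
        by (simp_all add: diff_eq_eq add.commute)
    qed
    have same: "L (\<alpha>, \<beta>) = \<Psi>" if ab: "\<alpha> \<in> \<Psi>" "\<beta> \<in> \<Psi>" "(p \<alpha>, q \<alpha>) \<noteq> (p \<beta>, q \<beta>)" for \<alpha> \<beta>
    proof -
      have ne: "s \<beta> - s \<alpha> \<noteq> 0"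
        using ab param by auto
      have "(p \<beta> - p \<alpha>) * (q \<gamma> - q \<alpha>) - (q \<beta> - q \<alpha>) * (p \<gamma> - p \<alpha>)
          = (s \<beta> - s \<alpha>) * (u * (q \<gamma> - q \<alpha>0) - w * (p \<gamma> - p \<alpha>0))" for \<gamma>
        unfolding param[OF ab(1)] param[OF ab(2)] by (simp add: algebra_simps)
      then have "(p \<beta> - p \<alpha>) * (q \<gamma> - q \<alpha>) - (q \<beta> - q \<alpha>) * (p \<gamma> - p \<alpha>) = 0
          \<longleftrightarrow> u * (q \<gamma> - q \<alpha>0) = w * (p \<gamma> - p \<alpha>0)" for \<gamma>
        using ne by (simp only: mult_eq_0_iff) simp
      then show ?thesis
        unfolding L_def using mem by (simp only: prod.case) blast
    qed
    have fib: "{z\<in>P. L z = \<Psi>} = {(\<alpha>, \<beta>). \<alpha> \<in> \<Psi> \<and> \<beta> \<in> \<Psi> \<and> (p \<alpha>, q \<alpha>) \<noteq> (p \<beta>, q \<beta>)}"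
    proof (intro equalityI subsetI)
      fix z assume "z \<in> {z\<in>P. L z = \<Psi>}"
      then obtain \<alpha> \<beta> where z: "z = (\<alpha>, \<beta>)" "(\<alpha>, \<beta>) \<in> P" "L (\<alpha>, \<beta>) = \<Psi>"
        by (cases z) auto
      then have "\<alpha> \<in> L (\<alpha>, \<beta>)" "\<beta> \<in> L (\<alpha>, \<beta>)"
        by (auto simp: L_def P_def)
      then show "z \<in> {(\<alpha>, \<beta>). \<alpha> \<in> \<Psi> \<and> \<beta> \<in> \<Psi> \<and> (p \<alpha>, q \<alpha>) \<noteq> (p \<beta>, q \<beta>)}"
        using z by (auto simp: P_def)
    next
      fix z assume "z \<in> {(\<alpha>, \<beta>). \<alpha> \<in> \<Psi> \<and> \<beta> \<in> \<Psi> \<and> (p \<alpha>, q \<alpha>) \<noteq> (p \<beta>, q \<beta>)}"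
      then show "z \<in> {z\<in>P. L z = \<Psi>}"
        using same mem by (auto simp: P_def)
    qed
    define r where "r = p \<alpha>0 * w - q \<alpha>0 * u"
    have row: "(\<Sum>\<beta>\<in>\<Psi>. k \<alpha> \<beta>) = 0" if "\<alpha> \<in> \<Psi>" for \<alpha>
    proof -
      have eq: "\<gamma> \<in> \<Psi> \<longleftrightarrow> \<gamma> \<in> R \<and> - w * p \<gamma> + u * q \<gamma> + r = 0" for \<gamma>
        unfolding mem r_def by (auto simp: algebra_simps)
      then have "\<Psi> = {\<gamma>\<in>R. - w * p \<gamma> + u * q \<gamma> + r = 0}"
        by blast
      then show ?thesis
        using line[of \<alpha> "- w" u r] that eq by simp
    qed
    have D: "D (\<alpha>, \<beta>) = r * s \<beta> - r * s \<alpha>" if "\<alpha> \<in> \<Psi>" "\<beta> \<in> \<Psi>" for \<alpha> \<beta>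
      unfolding D_def r_def using param[OF that(1)] param[OF that(2)] by (simp add: algebra_simps)
    have "(\<Sum>z\<in>{z\<in>P. L z = \<Psi>}. G z) = (\<Sum>z\<in>\<Psi> \<times> \<Psi>. G z)"
      unfolding fib using finPsi by (intro sum.mono_neutral_left) (auto simp: G_def D_def)
    also have "\<dots> = (\<Sum>\<alpha>\<in>\<Psi>. \<Sum>\<beta>\<in>\<Psi>. sc (r * s \<beta>) (k \<alpha> \<beta>) - sc (r * s \<alpha>) (k \<alpha> \<beta>))"
      unfolding sum.cartesian_product'
      by (intro sum.cong refl) (auto simp: G_def D scale_left_diff_distrib)
    also have "\<dots> = (\<Sum>\<alpha>\<in>\<Psi>. \<Sum>\<beta>\<in>\<Psi>. sc (r * s \<beta>) (k \<alpha> \<beta>)) - (\<Sum>\<alpha>\<in>\<Psi>. \<Sum>\<beta>\<in>\<Psi>. sc (r * s \<alpha>) (k \<alpha> \<beta>))"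
      by (simp add: sum_subtractf)
    also have "(\<Sum>\<alpha>\<in>\<Psi>. \<Sum>\<beta>\<in>\<Psi>. sc (r * s \<alpha>) (k \<alpha> \<beta>)) = 0"
      using row by (simp flip: scale_sum_right)
    also have "(\<Sum>\<alpha>\<in>\<Psi>. \<Sum>\<beta>\<in>\<Psi>. sc (r * s \<beta>) (k \<alpha> \<beta>)) = (\<Sum>\<beta>\<in>\<Psi>. \<Sum>\<alpha>\<in>\<Psi>. sc (r * s \<beta>) (- k \<beta> \<alpha>))"
      using skew by (subst sum.swap) (intro sum.cong refl, metis)
    also have "\<dots> = 0"
      using row by (simp add: sum_negf flip: scale_sum_right)
    finally show ?thesis by simp
  qed
  have "(\<Sum>z\<in>R \<times> R. G z) = (\<Sum>z\<in>P. G z)"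
    using R \<open>P \<subseteq> R \<times> R\<close> by (intro sum.mono_neutral_right) (auto simp: P_def G_def D_def)
  also have "\<dots> = (\<Sum>\<Psi>\<in>L ` P. \<Sum>z\<in>{z\<in>P. L z = \<Psi>}. G z)"
    by (rule sum.image_gen[OF finP])
  also have "\<dots> = 0"
    using fibre by simp
  finally have "(\<Sum>\<alpha>\<in>R. \<Sum>\<beta>\<in>R. G (\<alpha>, \<beta>)) = 0"
    by (simp add: sum.cartesian_product')
  then have "(\<Sum>\<alpha>\<in>R. \<Sum>\<beta>\<in>R. sc (p \<alpha> * q \<beta>) (k \<alpha> \<beta>)) - (\<Sum>\<alpha>\<in>R. \<Sum>\<beta>\<in>R. sc (q \<alpha> * p \<beta>) (k \<alpha> \<beta>)) = 0"
    by (simp add: G_def D_def scale_left_diff_distrib sum_subtractf)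
  moreover have "(\<Sum>\<alpha>\<in>R. \<Sum>\<beta>\<in>R. sc (q \<alpha> * p \<beta>) (k \<alpha> \<beta>)) = (\<Sum>\<beta>\<in>R. \<Sum>\<alpha>\<in>R. - sc (p \<beta> * q \<alpha>) (k \<beta> \<alpha>))"
    using skew by (subst sum.swap) (intro sum.cong refl, metis mult.commute scale_minus_right)
  then have "(\<Sum>\<alpha>\<in>R. \<Sum>\<beta>\<in>R. sc (q \<alpha> * p \<beta>) (k \<alpha> \<beta>)) = - (\<Sum>\<alpha>\<in>R. \<Sum>\<beta>\<in>R. sc (p \<alpha> * q \<beta>) (k \<alpha> \<beta>))"
    by (simp add: sum_negf)
  ultimately have "sc 2 (\<Sum>\<alpha>\<in>R. \<Sum>\<beta>\<in>R. sc (p \<alpha> * q \<beta>) (k \<alpha> \<beta>)) = 0"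
    using scale_left_distrib[of 1 1] by simp
  then show ?thesis
    by simp
qed

context lie_module
begin

lemma rep_endo: "V.endo (\<rho> x)"
  using linear_rep by simp

lemma rep_add: "\<rho> x (v + w) = \<rho> x v + \<rho> x w"
  and rep_scale: "\<rho> x (scV a v) = scV a (\<rho> x v)"
  and rep_diff: "\<rho> x (v - w) = \<rho> x v - \<rho> x w"
  and rep_zero [simp]: "\<rho> x 0 = 0"
  and rep_sum: "\<rho> x (sum g A) = (\<Sum>i\<in>A. \<rho> x (g i))"
  using rep_endo[of x] by (simp_all add: V.endo_add V.endo_scale V.endo_diff V.endo_zero V.endo_sum)

lemma rep_arg_add: "\<rho> (x + y) v = \<rho> x v + \<rho> y v"
  and rep_arg_scale: "\<rho> (sc a x) v = scV a (\<rho> x v)"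
  using linear_rep_arg[of v] unfolding Vector_Spaces.linear_iff by blast+

lemma rep_arg_sum: "\<rho> (sum g A) v = (\<Sum>i\<in>A. \<rho> (g i) v)"
  by (induction A rule: infinite_finite_induct)
    (use rep_arg_scale[of 0 0 v] in \<open>simp_all add: rep_arg_add\<close>)

lemma rep_arg_minus: "\<rho> (- x) v = - \<rho> x v"
  using rep_arg_scale[of "- 1" x v] by simp

end

locale casimir_connection = cartan_form sc br H c + lie_module sc br scV \<rho>
  for sc :: "complex \<Rightarrow> 'g::real_normed_vector \<Rightarrow> 'g" and br H c
    and scV :: "complex \<Rightarrow> 'v::real_normed_vector \<Rightarrow> 'v" and \<rho> +
  fixes e f :: "('g \<Rightarrow> complex) \<Rightarrow> 'g"
  assumes root_vectors: "root_vectors c H e f"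
begin

text \<open>
  Both hypotheses expand a bracket with \<open>y\<close> in a pair of dual families. By invariance of the form the
  two coefficient matrices are negative transposes of each other.
\<close>

lemma casimir_commutes:
  assumes "finite I"
    and b: "\<And>i. i \<in> I \<Longrightarrow> br y (b i) = (\<Sum>j\<in>I. sc (form (br y (b i)) (d j)) (b j))"
    and d: "\<And>i. i \<in> I \<Longrightarrow> br y (d i) = (\<Sum>j\<in>I. sc (form (b j) (br y (d i))) (d j))"
  shows "\<rho> y (\<Sum>i\<in>I. \<rho> (b i) (\<rho> (d i) v)) = (\<Sum>i\<in>I. \<rho> (b i) (\<rho> (d i) (\<rho> y v)))"
proof -
  define m where "m i j = form (br y (b i)) (d j)" for i j
  have m: "form (b j) (br y (d i)) = - m j i" for i j
    unfolding m_def by (simp add: form_skew)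
  have "\<rho> y (\<Sum>i\<in>I. \<rho> (b i) (\<rho> (d i) v)) - (\<Sum>i\<in>I. \<rho> (b i) (\<rho> (d i) (\<rho> y v)))
      = (\<Sum>i\<in>I. \<rho> (br y (b i)) (\<rho> (d i) v) + \<rho> (b i) (\<rho> (br y (d i)) v))"
    by (simp add: rep_sum rep_br rep_diff flip: sum_subtractf)
  also have "\<dots> = (\<Sum>i\<in>I. \<rho> (br y (b i)) (\<rho> (d i) v)) + (\<Sum>i\<in>I. \<rho> (b i) (\<rho> (br y (d i)) v))"
    by (rule sum.distrib)
  also have "(\<Sum>i\<in>I. \<rho> (br y (b i)) (\<rho> (d i) v)) = (\<Sum>i\<in>I. \<Sum>j\<in>I. scV (m i j) (\<rho> (b j) (\<rho> (d i) v)))"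
  proof (rule sum.cong[OF refl])
    fix i assume "i \<in> I"
    then show "\<rho> (br y (b i)) (\<rho> (d i) v) = (\<Sum>j\<in>I. scV (m i j) (\<rho> (b j) (\<rho> (d i) v)))"
      by (subst b) (simp_all add: m_def rep_arg_sum rep_arg_scale)
  qed
  also have "(\<Sum>i\<in>I. \<rho> (b i) (\<rho> (br y (d i)) v)) = (\<Sum>i\<in>I. \<Sum>j\<in>I. - scV (m j i) (\<rho> (b i) (\<rho> (d j) v)))"
  proof (rule sum.cong[OF refl])
    fix i assume "i \<in> I"
    then show "\<rho> (b i) (\<rho> (br y (d i)) v) = (\<Sum>j\<in>I. - scV (m j i) (\<rho> (b i) (\<rho> (d j) v)))"
      by (subst d) (simp_all add: m rep_arg_sum rep_arg_scale rep_sum rep_scale flip: scale_minus_left V.scale_minus_left)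
  qed
  also have "\<dots> = - (\<Sum>i\<in>I. \<Sum>j\<in>I. scV (m i j) (\<rho> (b j) (\<rho> (d i) v)))"
    by (subst sum.swap) (simp add: sum_negf)
  finally show ?thesis by simp
qed

text \<open>The multiple of \<open>f \<alpha>\<close> that pairs to one with \<open>e \<alpha>\<close> under the invariant form.\<close>

definition dual_root_vector :: "('g \<Rightarrow> complex) \<Rightarrow> 'g" where
  "dual_root_vector \<alpha> = sc (dual_form c H \<alpha> \<alpha> / 2) (f \<alpha>)"

lemma e_root: "\<alpha> \<in> roots H \<Longrightarrow> e \<alpha> \<in> root_space H \<alpha>"
  using root_vectors by (simp add: root_vectors_def)

lemma dual_root_vector_root: "\<alpha> \<in> roots H \<Longrightarrow> dual_root_vector \<alpha> \<in> root_space H (- \<alpha>)"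
  using root_vectors subspace_scale[OF subspace_root_space]
  by (simp add: root_vectors_def dual_root_vector_def)

lemma br_e_dual:
  assumes "\<alpha> \<in> roots H"
  shows "br (e \<alpha>) (dual_root_vector \<alpha>) = dual_vector c H \<alpha>"
proof -
  have "dual_form c H \<alpha> \<alpha> \<noteq> 0"
    using root_norm_nonzero[OF assms] form_dual_vector[OF assms dual_vector_in_H[OF assms]]
    by (simp add: dual_form_def)
  then show ?thesis
    using root_vectors assms by (simp add: root_vectors_def dual_root_vector_def br_scale_right coroot_def)
qed

lemma form_e_dual:
  assumes "\<alpha> \<in> roots H"
  shows "form (e \<alpha>) (dual_root_vector \<alpha>) = 1"
proof -
  have "sc (form (e \<alpha>) (dual_root_vector \<alpha>)) (dual_vector c H \<alpha>) = sc 1 (dual_vector c H \<alpha>)"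
    using br_opposite_roots[OF assms e_root[OF assms] dual_root_vector_root[OF assms]] br_e_dual[OF assms] by simp
  moreover have "dual_vector c H \<alpha> \<noteq> 0"
    using root_norm_nonzero[OF assms] root_linear(2)[OF assms subspace_0[OF subspace_H], of 0] by auto
  ultimately show ?thesis
    by (simp only: scale_cancel_right) simp
qed

abbreviation \<kappa> :: "('g \<Rightarrow> complex) \<Rightarrow> 'v \<Rightarrow> 'v" where
  "\<kappa> \<equiv> truncated_casimir c H e f"

lemma truncated_casimir_dual:
  "\<kappa> \<alpha> v = \<rho> (e \<alpha>) (\<rho> (dual_root_vector \<alpha>) v) + \<rho> (dual_root_vector \<alpha>) (\<rho> (e \<alpha>) v)"
  by (simp add: truncated_casimir_def dual_root_vector_def rep_arg_scale rep_scale V.scale_right_distrib)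

text \<open>The correction to normal ordering lies in \<open>H\<close> and so commutes with all truncated Casimir operators.\<close>

lemma truncated_casimir_ordered:
  assumes "\<alpha> \<in> roots H"
  shows "\<kappa> \<alpha> v = scV 2 (\<rho> (e \<alpha>) (\<rho> (dual_root_vector \<alpha>) v)) - \<rho> (dual_vector c H \<alpha>) v"
  using rep_br[of "e \<alpha>" "dual_root_vector \<alpha>" v] V.scale_left_distrib[of 1 1 "\<rho> (e \<alpha>) (\<rho> (dual_root_vector \<alpha>) v)"]
  by (simp add: br_e_dual[OF assms] truncated_casimir_dual)

lemma \<kappa>_endo: "V.endo (\<kappa> \<alpha>)"
  unfolding truncated_casimir_dual[abs_def]
  by (rule V.endo_plus[OF V.endo_comp[OF rep_endo rep_endo] V.endo_comp[OF rep_endo rep_endo]])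

lemma \<kappa>_weight_zero:
  assumes "\<alpha> \<in> roots H" "h \<in> H"
  shows "\<rho> h (\<kappa> \<alpha> v) = \<kappa> \<alpha> (\<rho> h v)"
proof -
  have e: "\<rho> h (\<rho> (e \<alpha>) w) = \<rho> (e \<alpha>) (\<rho> h w) + scV (\<alpha> h) (\<rho> (e \<alpha>) w)" for w
    using rep_br[of h "e \<alpha>" w] e_root[OF assms(1)] assms(2)
    by (simp add: root_space_iff rep_arg_scale)
  have d: "\<rho> h (\<rho> (dual_root_vector \<alpha>) w)
      = \<rho> (dual_root_vector \<alpha>) (\<rho> h w) - scV (\<alpha> h) (\<rho> (dual_root_vector \<alpha>) w)" for w
    using rep_br[of h "dual_root_vector \<alpha>" w] dual_root_vector_root[OF assms(1)] assms(2)
    by (simp add: root_space_iff rep_arg_scale rep_arg_minus algebra_simps)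
  show ?thesis
    by (simp add: truncated_casimir_dual rep_add rep_diff rep_scale e d)
qed

text \<open>
  In a decomposition of \<open>y\<close> by root spaces, the part belonging to roots that do not vanish at \<open>l\<close> is
  in the span of eigenspaces of \<open>ad l\<close> for nonzero eigenvalues, but is killed by \<open>ad l\<close>.
\<close>

lemma centralizer_decomposition:
  assumes l: "l \<in> H" and y: "br l y = 0"
  shows "y \<in> span (H \<union> (\<Union>\<alpha>\<in>{\<alpha>\<in>roots H. \<alpha> l = 0}. root_space H \<alpha>))"
proof -
  define S where "S = H \<union> (\<Union>\<alpha>\<in>{\<alpha>\<in>roots H. \<alpha> l = 0}. root_space H \<alpha>)"
  define T where "T = (\<Union>\<alpha>\<in>{\<alpha>\<in>roots H. \<alpha> l \<noteq> 0}. root_space H \<alpha>)"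
  have "H \<union> (\<Union>\<alpha>\<in>roots H. root_space H \<alpha>) = S \<union> T"
    by (auto simp: S_def T_def)
  then have "y \<in> span (S \<union> T)"
    using root_decomposition by simp
  then obtain y1 y2 where y12: "y = y1 + y2" "y1 \<in> span S" "y2 \<in> span T"
    unfolding span_Un by blast
  have "br l s = 0" if "s \<in> S" for s
    using that l H_abelian by (auto simp: S_def root_space_iff)
  then have "br l y1 = 0"
    using endo_span[OF endo_br, of S l "{0}" y1] y12(2) by simp
  then have "br l y2 = 0"
    using y y12(1) by (simp add: br_add_right)
  then have "y2 \<in> geig (br l) 0"
    by (intro eigenvector_in_geig) simp
  moreover have "T \<subseteq> (\<Union>m\<in>-{0}. geig (br l) m)"
    using l by (auto simp: T_def root_space_iff intro!: eigenvector_in_geig)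
  then have "y2 \<in> span (\<Union>m\<in>-{0}. geig (br l) m)"
    using y12(3) span_mono by blast
  ultimately have "y2 = 0"
    by (rule geig_independent[OF endo_br])
  then show ?thesis
    using y12 by (simp add: S_def)
qed

lemma opposite_weight_form:
  assumes "\<alpha> \<in> roots H" "\<beta> \<in> roots H" "\<alpha> \<noteq> \<beta>" "x \<in> root_space H \<alpha>" "y \<in> root_space H (- \<beta>)"
  shows "form x y = 0"
proof -
  obtain h where "h \<in> H" "\<alpha> h \<noteq> \<beta> h"
    by (rule roots_separated[OF assms(1-3)])
  then show ?thesis
    using form_root_orthogonal[OF assms(4,5), of h] by simp
qed

lemma form_H_root_zero:
  assumes "\<alpha> \<in> roots H" "x \<in> H" "y \<in> root_space H \<alpha>"
  shows "form x y = 0" "form y x = 0"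
  using root_nonzero[OF assms(1)] form_H_root[OF assms(2,3)] form_sym by metis+

text \<open>
  Dual bases of \<open>H\<close> together with the root vectors and their duals are dual bases of the centralizer
  of \<open>l\<close>. The second identity uses that with \<open>\<beta>\<close> also \<open>-\<beta>\<close> vanishes at \<open>l\<close>, and that the dual root
  vector of \<open>-\<beta>\<close> spans the root space of \<open>\<beta>\<close>.
\<close>

lemma centralizer_dual_bases:
  assumes l: "l \<in> H" and y: "br l y = 0" and B: "finite B" "B \<subseteq> H" "d ` B \<subseteq> H"
      "\<forall>y\<in>H. y = (\<Sum>b\<in>B. sc (form y (d b)) b)" "\<forall>y\<in>H. y = (\<Sum>b\<in>B. sc (form b y) (d b))"
  defines "\<Psi> \<equiv> {\<alpha>\<in>roots H. \<alpha> l = 0}"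
  shows "y = (\<Sum>b\<in>B. sc (form y (d b)) b) + (\<Sum>\<alpha>\<in>\<Psi>. sc (form y (dual_root_vector \<alpha>)) (e \<alpha>))" (is ?A)
    and "y = (\<Sum>b\<in>B. sc (form b y) (d b)) + (\<Sum>\<alpha>\<in>\<Psi>. sc (form (e \<alpha>) y) (dual_root_vector \<alpha>))" (is ?B)
proof -
  have finPsi: "finite \<Psi>"
    using finite_roots by (simp add: \<Psi>_def)
  define p where "p y = (\<Sum>b\<in>B. sc (form y (d b)) b) + (\<Sum>\<alpha>\<in>\<Psi>. sc (form y (dual_root_vector \<alpha>)) (e \<alpha>))" for y
  define q where "q y = (\<Sum>b\<in>B. sc (form b y) (d b)) + (\<Sum>\<alpha>\<in>\<Psi>. sc (form (e \<alpha>) y) (dual_root_vector \<alpha>))" for y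
  have ep: "endo p" and eq: "endo q"
    unfolding p_def q_def endo_iff
    by (simp_all add: form_add_left form_add_right form_scale_left form_scale_right
        sum.distrib scale_sum_right scale_left_distrib scale_right_distrib)
  have H0: "form x (dual_root_vector \<alpha>) = 0" "form (e \<alpha>) x = 0" if "x \<in> H" "\<alpha> \<in> \<Psi>" for x \<alpha>
  proof -
    have a: "\<alpha> \<in> roots H"
      using that by (simp add: \<Psi>_def)
    show "form x (dual_root_vector \<alpha>) = 0"
      using form_H_root_zero(1)[OF neg_root[OF a] that(1) dual_root_vector_root[OF a]] .
    show "form (e \<alpha>) x = 0"
      using form_H_root_zero(2)[OF a that(1) e_root[OF a]] .
  qed
  have pH: "p x = x" "q x = x" if "x \<in> H" for x
    using H0[OF that] B(4,5) that by (simp_all add: p_def q_def)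
  have pR: "p x = x" "q x = x" if \<beta>: "\<beta> \<in> \<Psi>" and x: "x \<in> root_space H \<beta>" for x \<beta>
  proof -
    have b: "\<beta> \<in> roots H" "\<beta> l = 0"
      using \<beta> by (auto simp: \<Psi>_def)
    have nb: "- \<beta> \<in> \<Psi>" "- \<beta> \<in> roots H"
      using b neg_root by (auto simp: \<Psi>_def)
    have BH: "form x (d b) = 0" "form b x = 0" if "b \<in> B" for b
      using form_H_root_zero[OF b(1) _ x] B(2,3) that by auto
    have "e \<beta> \<noteq> 0"
      using form_e_dual[OF b(1)] by auto
    then obtain k where k: "x = sc k (e \<beta>)"
      using root_space_one_dimensional[OF b(1) e_root[OF b(1)]] x by (auto simp: span_singleton)
    have "(\<Sum>\<alpha>\<in>\<Psi>. sc (form x (dual_root_vector \<alpha>)) (e \<alpha>)) = (\<Sum>\<alpha>\<in>{\<beta>}. sc (form x (dual_root_vector \<alpha>)) (e \<alpha>))"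
      using finPsi \<beta> opposite_weight_form[OF b(1) _ _ x dual_root_vector_root]
      by (intro sum.mono_neutral_right) (auto simp: \<Psi>_def)
    also have "\<dots> = x"
      by (simp add: k form_scale_left form_e_dual[OF b(1)])
    finally show "p x = x"
      by (simp add: p_def BH)
    have negneg: "- (- \<beta>) = \<beta>"
      by (rule ext) simp
    have mem: "dual_root_vector (- \<beta>) \<in> root_space H \<beta>"
      using dual_root_vector_root[OF nb(2)] by (simp add: negneg)
    moreover have "dual_root_vector (- \<beta>) \<noteq> 0"
      using form_e_dual[OF nb(2)] by auto
    ultimately obtain j where j: "x = sc j (dual_root_vector (- \<beta>))"
      using root_space_one_dimensional[OF b(1)] x by (auto simp: span_singleton)
    have xm: "x \<in> root_space H (- (- \<beta>))"
      using x by (simp add: negneg)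
    have "(\<Sum>\<alpha>\<in>\<Psi>. sc (form (e \<alpha>) x) (dual_root_vector \<alpha>)) = (\<Sum>\<alpha>\<in>{- \<beta>}. sc (form (e \<alpha>) x) (dual_root_vector \<alpha>))"
      using finPsi nb(1) opposite_weight_form[OF _ nb(2) _ e_root xm]
      by (intro sum.mono_neutral_right) (auto simp: \<Psi>_def)
    also have "\<dots> = x"
      by (simp add: j form_scale_right form_e_dual[OF nb(2)])
    finally show "q x = x"
      by (simp add: q_def BH)
  qed
  have y: "y \<in> span (H \<union> (\<Union>\<alpha>\<in>\<Psi>. root_space H \<alpha>))"
    using centralizer_decomposition[OF l y] by (simp add: \<Psi>_def)
  have gen: "p s - s \<in> {0}" "q s - s \<in> {0}" if "s \<in> H \<union> (\<Union>\<alpha>\<in>\<Psi>. root_space H \<alpha>)" for s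
    using that pH pR by auto
  have "p y - y \<in> {0}"
    by (rule endo_span[OF endo_minus[OF ep endo_ident] gen(1) subspace_single_0 y])
  moreover have "q y - y \<in> {0}"
    by (rule endo_span[OF endo_minus[OF eq endo_ident] gen(2) subspace_single_0 y])
  ultimately have "p y = y" "q y = y"
    by simp_all
  then show ?A ?B
    by (simp_all only: p_def q_def)
qed

text \<open>
  The operator \<open>C\<close> is the Casimir operator of the centralizer of \<open>l\<close>, which contains the root vectors
  of \<open>\<alpha>\<close>. The sum of the \<open>\<kappa> \<beta>\<close> is twice \<open>C\<close> minus an operator \<open>T\<close> built from elements of \<open>H\<close> only, and
  \<open>\<kappa> \<alpha>\<close>, being of weight zero, commutes with \<open>T\<close>.
\<close>

lemma \<kappa>_commutes_subsystem_sum: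
  assumes l: "l \<in> H" and \<alpha>: "\<alpha> \<in> roots H" "\<alpha> l = 0"
  defines "\<Psi> \<equiv> {\<alpha>\<in>roots H. \<alpha> l = 0}"
  shows "(\<Sum>\<beta>\<in>\<Psi>. \<kappa> \<alpha> (\<kappa> \<beta> v)) = (\<Sum>\<beta>\<in>\<Psi>. \<kappa> \<beta> (\<kappa> \<alpha> v))"
proof -
  obtain B d where B: "finite B" "B \<subseteq> H" "d ` B \<subseteq> H"
    "\<forall>y\<in>H. y = (\<Sum>b\<in>B. sc (form y (d b)) b)" "\<forall>y\<in>H. y = (\<Sum>b\<in>B. sc (form b y) (d b))"
    by (rule dual_bases_H)
  have finPsi: "finite \<Psi>"
    using finite_roots by (simp add: \<Psi>_def)
  have Psi: "\<beta> \<in> roots H" "\<beta> l = 0" if "\<beta> \<in> \<Psi>" for \<beta>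
    using that by (auto simp: \<Psi>_def)
  define I where "I = B <+> \<Psi>"
  define bb where "bb = case_sum (\<lambda>b. b) e"
  define dd where "dd = case_sum d dual_root_vector"
  define C where "C v = (\<Sum>i\<in>I. \<rho> (bb i) (\<rho> (dd i) v))" for v
  have central: "br l (bb i) = 0" "br l (dd i) = 0" if i: "i \<in> I" for i
  proof -
    consider b where "i = Inl b" "b \<in> B" | \<beta> where "i = Inr \<beta>" "\<beta> \<in> \<Psi>"
      using i by (auto simp: I_def)
    then have "br l (bb i) = 0 \<and> br l (dd i) = 0"
    proof cases
      case 1
      then show ?thesis
        using H_abelian[OF l] B(2,3) by (auto simp: bb_def dd_def)
    next
      case 2
      then show ?thesis
        using e_root dual_root_vector_root l Psi[of \<beta>] by (simp add: bb_def dd_def root_space_iff)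
    qed
    then show "br l (bb i) = 0" "br l (dd i) = 0" by auto
  qed
  have closed: "br l (br y z) = 0" if "br l y = 0" "br l z = 0" for y z
    using br_derivation[of l y z] that by simp
  have C_commutes: "\<rho> y (C v) = C (\<rho> y v)" if y: "br l y = 0" for y v
    unfolding C_def
  proof (rule casimir_commutes)
    show "finite I"
      using B(1) finPsi by (simp add: I_def)
    show "br y (bb i) = (\<Sum>j\<in>I. sc (form (br y (bb i)) (dd j)) (bb j))" if "i \<in> I" for i
      using centralizer_dual_bases(1)[OF l closed[OF y central(1)[OF that]] B] B(1) finPsi
      by (simp add: I_def bb_def dd_def sum.Plus \<Psi>_def)
    show "br y (dd i) = (\<Sum>j\<in>I. sc (form (bb j) (br y (dd i))) (dd j))" if "i \<in> I" for i
      using centralizer_dual_bases(2)[OF l closed[OF y central(2)[OF that]] B] B(1) finPsi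
      by (simp add: I_def bb_def dd_def sum.Plus \<Psi>_def)
  qed
  have \<kappa>C: "\<kappa> \<alpha> (C v) = C (\<kappa> \<alpha> v)" for v
  proof -
    have "br l (e \<alpha>) = 0" "br l (dual_root_vector \<alpha>) = 0"
      using e_root[OF \<alpha>(1)] dual_root_vector_root[OF \<alpha>(1)] l \<alpha>(2) by (simp_all add: root_space_iff)
    moreover have "C (v + w) = C v + C w" for v w
      by (simp add: C_def rep_add sum.distrib)
    ultimately show ?thesis
      by (simp add: truncated_casimir_dual C_commutes)
  qed
  define T where "T v = scV 2 (\<Sum>b\<in>B. \<rho> b (\<rho> (d b) v)) + (\<Sum>\<beta>\<in>\<Psi>. \<rho> (dual_vector c H \<beta>) v)" for v
  note ka = \<kappa>_endo[of \<alpha>]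
  have \<kappa>T: "\<kappa> \<alpha> (T v) = T (\<kappa> \<alpha> v)" for v
  proof -
    have "\<kappa> \<alpha> (\<rho> b (\<rho> (d b) v)) = \<rho> b (\<rho> (d b) (\<kappa> \<alpha> v))" if "b \<in> B" for b
      using \<kappa>_weight_zero[OF \<alpha>(1)] B(2,3) that by (metis image_subset_iff subsetD)
    moreover have "\<kappa> \<alpha> (\<rho> (dual_vector c H \<beta>) v) = \<rho> (dual_vector c H \<beta>) (\<kappa> \<alpha> v)" if "\<beta> \<in> \<Psi>" for \<beta>
      using \<kappa>_weight_zero[OF \<alpha>(1) dual_vector_in_H[OF Psi(1)[OF that]]] by simp
    ultimately show ?thesis
      by (simp add: T_def V.endo_add[OF ka] V.endo_scale[OF ka] V.endo_sum[OF ka])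
  qed
  have sum_eq: "(\<Sum>\<beta>\<in>\<Psi>. \<kappa> \<beta> v) = scV 2 (C v) - T v" for v
  proof -
    have "(\<Sum>\<beta>\<in>\<Psi>. \<kappa> \<beta> v) = (\<Sum>\<beta>\<in>\<Psi>. scV 2 (\<rho> (e \<beta>) (\<rho> (dual_root_vector \<beta>) v)) - \<rho> (dual_vector c H \<beta>) v)"
      by (intro sum.cong refl truncated_casimir_ordered Psi)
    also have "\<dots> = scV 2 (\<Sum>\<beta>\<in>\<Psi>. \<rho> (e \<beta>) (\<rho> (dual_root_vector \<beta>) v)) - (\<Sum>\<beta>\<in>\<Psi>. \<rho> (dual_vector c H \<beta>) v)"
      by (simp add: sum_subtractf V.scale_sum_right)
    also have "C v = (\<Sum>b\<in>B. \<rho> b (\<rho> (d b) v)) + (\<Sum>\<beta>\<in>\<Psi>. \<rho> (e \<beta>) (\<rho> (dual_root_vector \<beta>) v))"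
      using B(1) finPsi by (simp add: C_def I_def bb_def dd_def sum.Plus)
    then have "scV 2 (\<Sum>\<beta>\<in>\<Psi>. \<rho> (e \<beta>) (\<rho> (dual_root_vector \<beta>) v)) - (\<Sum>\<beta>\<in>\<Psi>. \<rho> (dual_vector c H \<beta>) v)
        = scV 2 (C v) - T v"
      by (simp add: T_def V.scale_right_distrib)
    finally show ?thesis .
  qed
  have "(\<Sum>\<beta>\<in>\<Psi>. \<kappa> \<alpha> (\<kappa> \<beta> v)) = \<kappa> \<alpha> (\<Sum>\<beta>\<in>\<Psi>. \<kappa> \<beta> v)"
    by (simp add: V.endo_sum[OF ka])
  also have "\<dots> = scV 2 (C (\<kappa> \<alpha> v)) - T (\<kappa> \<alpha> v)"
    by (simp add: sum_eq V.endo_diff[OF ka] V.endo_scale[OF ka] \<kappa>C \<kappa>T)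
  also have "\<dots> = (\<Sum>\<beta>\<in>\<Psi>. \<kappa> \<beta> (\<kappa> \<alpha> v))"
    by (simp add: sum_eq)
  finally show ?thesis .
qed

abbreviation \<omega> :: "complex \<Rightarrow> 'g \<Rightarrow> 'g \<Rightarrow> 'v \<Rightarrow> 'v" where
  "\<omega> \<equiv> casimir_form c H e f"

lemma casimir_form_endo: "V.endo (\<omega> h x u)"
  unfolding V.endo_iff casimir_form_def
  by (simp add: V.endo_add[OF \<kappa>_endo] V.endo_scale[OF \<kappa>_endo] V.scale_right_distrib
      sum.distrib V.scale_sum_right mult_ac)

text \<open>
  The roots on the line \<open>a p + b q + m = 0\<close> are those vanishing at \<open>l = a u + b u' + m x\<close>: this is the
  equation of the line multiplied by the nonzero number \<open>\<beta>(x)\<close>.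
\<close>

theorem casimir_form_commutes:
  assumes x: "x \<in> regular_elements H" and u: "u \<in> H" "u' \<in> H"
  shows "\<omega> h x u (\<omega> h x u' v) = \<omega> h x u' (\<omega> h x u v)"
proof -
  define p q where "p \<alpha> = \<alpha> u / \<alpha> x" and "q \<alpha> = \<alpha> u' / \<alpha> x" for \<alpha> :: "'g \<Rightarrow> complex"
  define k where "k \<alpha> \<beta> = \<kappa> \<alpha> (\<kappa> \<beta> v) - \<kappa> \<beta> (\<kappa> \<alpha> v)" for \<alpha> \<beta>
  have xH: "x \<in> H" and reg: "\<And>\<alpha>. \<alpha> \<in> roots H \<Longrightarrow> \<alpha> x \<noteq> 0"
    using x by (auto simp: regular_elements_def)
  have prod: "(\<Sum>\<alpha>\<in>roots H. scV (r \<alpha>) (\<kappa> \<alpha> (\<Sum>\<beta>\<in>roots H. scV (s \<beta>) (\<kappa> \<beta> v))))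
      = (\<Sum>\<alpha>\<in>roots H. \<Sum>\<beta>\<in>roots H. scV (r \<alpha> * s \<beta>) (\<kappa> \<alpha> (\<kappa> \<beta> v)))" for r s
    by (simp add: V.endo_sum[OF \<kappa>_endo] V.endo_scale[OF \<kappa>_endo] V.scale_sum_right)
  have "(\<Sum>\<alpha>\<in>roots H. \<Sum>\<beta>\<in>roots H. scV (p \<alpha> * q \<beta>) (k \<alpha> \<beta>)) = 0"
  proof (rule V.line_sums_cancel[OF finite_roots])
    show "k \<alpha> \<beta> = - k \<beta> \<alpha>" for \<alpha> \<beta>
      by (simp add: k_def)
    fix a b m \<alpha> assume \<alpha>: "\<alpha> \<in> roots H" and on: "a * p \<alpha> + b * q \<alpha> + m = 0"
    define l where "l = sc a u + sc b u' + sc m x"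
    have lH: "l \<in> H"
      using u xH subspace_H by (simp add: l_def subspace_add subspace_scale)
    have \<beta>l: "a * p \<beta> + b * q \<beta> + m = 0 \<longleftrightarrow> \<beta> l = 0" if "\<beta> \<in> roots H" for \<beta>
    proof -
      have "\<beta> l = a * \<beta> u + b * \<beta> u' + m * \<beta> x"
        using u xH subspace_H by (simp add: l_def root_linear[OF that] subspace_add subspace_scale)
      also have "\<dots> = \<beta> x * (a * p \<beta> + b * q \<beta> + m)"
        using reg[OF that] by (simp add: p_def q_def field_simps)
      finally show ?thesis
        using reg[OF that] by simp
    qed
    have "{\<beta>\<in>roots H. a * p \<beta> + b * q \<beta> + m = 0} = {\<beta>\<in>roots H. \<beta> l = 0}"
      using \<beta>l by blast
    then show "(\<Sum>\<beta>\<in>{\<beta>\<in>roots H. a * p \<beta> + b * q \<beta> + m = 0}. k \<alpha> \<beta>) = 0"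
      using \<kappa>_commutes_subsystem_sum[OF lH \<alpha>] \<beta>l[OF \<alpha>] on by (simp add: k_def sum_subtractf)
  qed
  then have "(\<Sum>\<alpha>\<in>roots H. \<Sum>\<beta>\<in>roots H. scV (p \<alpha> * q \<beta>) (\<kappa> \<alpha> (\<kappa> \<beta> v)))
      = (\<Sum>\<alpha>\<in>roots H. \<Sum>\<beta>\<in>roots H. scV (p \<alpha> * q \<beta>) (\<kappa> \<beta> (\<kappa> \<alpha> v)))"
    by (simp add: k_def V.scale_right_diff_distrib sum_subtractf)
  also have "\<dots> = (\<Sum>\<alpha>\<in>roots H. \<Sum>\<beta>\<in>roots H. scV (q \<alpha> * p \<beta>) (\<kappa> \<alpha> (\<kappa> \<beta> v)))"
    by (subst sum.swap) (simp add: mult.commute)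
  finally have "(\<Sum>\<alpha>\<in>roots H. scV (p \<alpha>) (\<kappa> \<alpha> (\<Sum>\<beta>\<in>roots H. scV (q \<beta>) (\<kappa> \<beta> v))))
      = (\<Sum>\<alpha>\<in>roots H. scV (q \<alpha>) (\<kappa> \<alpha> (\<Sum>\<beta>\<in>roots H. scV (p \<beta>) (\<kappa> \<beta> v))))"
    unfolding prod .
  then show ?thesis
    unfolding V.endo_scale[OF casimir_form_endo] casimir_form_def[of c H e f h x u' v]
      casimir_form_def[of c H e f h x u v]
    by (simp add: casimir_form_def p_def q_def)
qed

lemma casimir_form_weight:
  assumes "w \<in> weight_space scV \<rho> H \<mu>"
  shows "\<omega> h x u w \<in> weight_space scV \<rho> H \<mu>"
  unfolding weight_space_def
proof (intro CollectI ballI)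
  fix y assume y: "y \<in> H"
  have k: "\<rho> y (\<kappa> \<alpha> w) = scV (\<mu> y) (\<kappa> \<alpha> w)" if "\<alpha> \<in> roots H" for \<alpha>
    using assms y by (simp add: \<kappa>_weight_zero[OF that y] weight_space_def V.endo_scale[OF \<kappa>_endo])
  have "\<rho> y (\<omega> h x u w) = scV (- h) (\<Sum>\<alpha>\<in>roots H. scV (\<alpha> u / \<alpha> x) (\<rho> y (\<kappa> \<alpha> w)))"
    unfolding casimir_form_def rep_scale rep_sum ..
  also have "\<dots> = scV (- h) (\<Sum>\<alpha>\<in>roots H. scV (\<mu> y) (scV (\<alpha> u / \<alpha> x) (\<kappa> \<alpha> w)))"
    by (simp add: k mult.commute)
  also have "\<dots> = scV (\<mu> y) (\<omega> h x u w)"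
    unfolding casimir_form_def V.scale_sum_right[symmetric] by (rule V.scale_left_commute)
  finally show "\<rho> y (\<omega> h x u w) = scV (\<mu> y) (\<omega> h x u w)" .
qed

end

section \<open>Linear maps on finite-dimensional normed spaces\<close>

text \<open>
  Coordinates with respect to a finite independent set are bounded linear functionals. In the
  induction step, bounded coordinates make the span of \<open>B\<close> closed, so \<open>b\<close> has a positive distance
  \<open>d\<close> from it; this bounds the coordinate of \<open>b\<close>, and then the others.
\<close>

lemma representation_bounded:
  fixes B :: "'a::real_normed_vector set"
  assumes "finite B" "independent B"
  shows "\<exists>C\<ge>0. \<forall>x\<in>span B. \<forall>b\<in>B. \<bar>representation B x b\<bar> \<le> C * norm x"
  using assms
proof (induction B rule: finite_induct)
  case empty
  then show ?case by (intro exI[of _ 0]) simp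
next
  case (insert b B)
  have indB: "independent B"
    using insert.prems independent_mono by blast
  have bB: "b \<notin> span B"
    using insert.prems insert.hyps(2) by (simp add: independent_insert)
  obtain C where C: "C \<ge> 0" "\<And>x c. x \<in> span B \<Longrightarrow> c \<in> B \<Longrightarrow> \<bar>representation B x c\<bar> \<le> C * norm x"
    using insert.IH indB by blast
  have "\<exists>d>0. \<forall>y\<in>span B. d \<le> norm (b - y)"
  proof (rule ccontr)
    assume "\<not> ?thesis"
    then have "\<forall>n. \<exists>y\<in>span B. norm (b - y) < inverse (real (Suc n))"
      by (metis inverse_positive_iff_positive not_le of_nat_0_less_iff zero_less_Suc)
    then obtain y where y: "\<And>n. y n \<in> span B" "\<And>n. norm (b - y n) < inverse (real (Suc n))"
      by metis
    have "(\<lambda>n. b - y n) \<longlonglongrightarrow> 0"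
      by (rule Lim_null_comparison[OF _ LIMSEQ_inverse_real_of_nat])
        (use y(2) in \<open>auto intro!: always_eventually less_imp_le\<close>)
    then have lim: "y \<longlonglongrightarrow> b"
      using tendsto_diff[OF tendsto_const[of b], of "\<lambda>n. b - y n" 0] by simp
    have "convergent (\<lambda>n. representation B (y n) c)" if c: "c \<in> B" for c
    proof (rule Cauchy_convergent, rule CauchyI)
      fix \<epsilon> :: real assume "0 < \<epsilon>"
      then have "0 < \<epsilon> / (C + 1)"
        using C(1) by simp
      then obtain M where M: "\<And>m n. m \<ge> M \<Longrightarrow> n \<ge> M \<Longrightarrow> norm (y m - y n) < \<epsilon> / (C + 1)"
        using CauchyD[OF LIMSEQ_imp_Cauchy[OF lim]] by metis
      have "norm (representation B (y m) c - representation B (y n) c) < \<epsilon>" if mn: "m \<ge> M" "n \<ge> M" for m n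
      proof -
        have "\<bar>representation B (y m - y n) c\<bar> \<le> C * norm (y m - y n)"
          using C(2) c span_diff[OF y(1) y(1)] by blast
        also have "\<dots> \<le> (C + 1) * norm (y m - y n)"
          by (simp add: mult_right_mono)
        also have "\<dots> < \<epsilon>"
          using M[OF mn] C(1) by (simp add: field_simps)
        finally show ?thesis
          using representation_diff[OF indB y(1) y(1), of m n] by simp
      qed
      then show "\<exists>M. \<forall>m\<ge>M. \<forall>n\<ge>M. norm (representation B (y m) c - representation B (y n) c) < \<epsilon>"
        by blast
    qed
    then obtain a where a: "\<And>c. c \<in> B \<Longrightarrow> (\<lambda>n. representation B (y n) c) \<longlonglongrightarrow> a c"
      unfolding convergent_def by metis
    have "(\<lambda>n. \<Sum>c\<in>B. representation B (y n) c *\<^sub>R c) \<longlonglongrightarrow> (\<Sum>c\<in>B. a c *\<^sub>R c)"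
      by (intro tendsto_sum tendsto_scaleR a tendsto_const)
    moreover have "(\<Sum>c\<in>B. representation B (y n) c *\<^sub>R c) = y n" for n
      by (rule sum_representation_eq[OF indB y(1) insert.hyps(1) order_refl])
    ultimately have "b = (\<Sum>c\<in>B. a c *\<^sub>R c)"
      using LIMSEQ_unique[OF lim] by simp
    moreover have "(\<Sum>c\<in>B. a c *\<^sub>R c) \<in> span B"
      by (intro span_sum span_scale span_base)
    ultimately show False
      using bB by simp
  qed
  then obtain d where d: "d > 0" "\<And>y. y \<in> span B \<Longrightarrow> d \<le> norm (b - y)"
    by blast
  \<comment> \<open>\<open>1 / d\<close> bounds the new coordinate; the other bound comes from \<open>norm y \<le> norm x + \<bar>k\<bar> * norm b\<close>.\<close>
  define C' where "C' = max (1 / d) (C * (1 + norm b / d))"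
  have "\<bar>representation (insert b B) x c\<bar> \<le> C' * norm x"
    if x: "x \<in> span (insert b B)" and c: "c \<in> insert b B" for x c
  proof -
    obtain k where k: "x - k *\<^sub>R b \<in> span B"
      using x span_breakdown_eq by blast
    define y where "y = x - k *\<^sub>R b"
    have xy: "x = y + k *\<^sub>R b" and y: "y \<in> span B"
      using k by (auto simp: y_def)
    have kd: "\<bar>k\<bar> \<le> norm x / d"
    proof (cases "k = 0")
      case True
      then show ?thesis using d by simp
    next
      case False
      have "x = k *\<^sub>R (b - (- (1 / k)) *\<^sub>R y)"
        using False by (simp add: xy algebra_simps)
      then have "norm x = \<bar>k\<bar> * norm (b - (- (1 / k)) *\<^sub>R y)"
        by (metis norm_scaleR)
      moreover have "d \<le> norm (b - (- (1 / k)) *\<^sub>R y)"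
        using d(2) y span_scale by blast
      ultimately have "\<bar>k\<bar> * d \<le> norm x"
        by (simp add: mult_left_mono)
      then show ?thesis
        using d(1) by (simp add: field_simps)
    qed
    have sub: "y \<in> span (insert b B)" "k *\<^sub>R b \<in> span (insert b B)"
      using y span_mono[of B "insert b B"] by (auto intro: span_base span_scale)
    have "representation (insert b B) x
        = (\<lambda>z. representation (insert b B) y z + representation (insert b B) (k *\<^sub>R b) z)"
      unfolding xy by (rule representation_add[OF insert.prems sub(2) sub(1)])
    moreover have "representation (insert b B) y = representation B y"
      by (rule representation_extend[OF insert.prems y]) blast
    moreover have "representation (insert b B) (k *\<^sub>R b) = (\<lambda>z. k * (if z = b then 1 else 0))"
      using insert.prems by (simp add: representation_scale representation_basis span_base)
    ultimately have rep: "representation (insert b B) x z = representation B y z + k * (if z = b then 1 else 0)" for z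
      by simp
    have rb: "representation B y b = 0"
      using insert.hyps(2) representation_ne_zero by blast
    show ?thesis
    proof (cases "c = b")
      case True
      then have "\<bar>representation (insert b B) x c\<bar> \<le> (1 / d) * norm x"
        using rep rb kd by simp
      also have "\<dots> \<le> C' * norm x"
        by (rule mult_right_mono) (simp_all add: C'_def)
      finally show ?thesis .
    next
      case False
      then have "\<bar>representation (insert b B) x c\<bar> \<le> C * norm y"
        using rep C(2)[OF y] c by simp
      also have "\<dots> \<le> C * (norm x + norm x / d * norm b)"
      proof (rule mult_left_mono[OF _ C(1)])
        have "norm y \<le> norm x + \<bar>k\<bar> * norm b"
          unfolding y_def using norm_triangle_ineq4[of x "k *\<^sub>R b"] by simp
        also have "\<bar>k\<bar> * norm b \<le> norm x / d * norm b"
          by (rule mult_right_mono[OF kd]) simp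
        finally show "norm y \<le> norm x + norm x / d * norm b"
          by simp
      qed
      also have "\<dots> = C * (1 + norm b / d) * norm x"
        by (simp add: algebra_simps)
      also have "\<dots> \<le> C' * norm x"
        by (rule mult_right_mono) (simp_all add: C'_def)
      finally show ?thesis .
    qed
  qed
  moreover have "C' \<ge> 0"
    using d(1) by (simp add: C'_def le_max_iff_disj)
  ultimately show ?case by blast
qed

lemma linear_bounded_finite_span:
  fixes f :: "'a::real_normed_vector \<Rightarrow> 'b::real_normed_vector" and S :: "'a set"
  assumes "linear f" "finite S" "span S = UNIV"
  shows "bounded_linear f"
proof -
  obtain B where B: "B \<subseteq> S" "independent B" "S \<subseteq> span B"
    using maximal_independent_subset by blast
  have finB: "finite B"
    using B(1) assms(2) finite_subset by blast
  have spB: "span B = UNIV"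
    using B(3) assms(3) by (metis span_mono span_span top.extremum_uniqueI)
  obtain C where C: "\<And>x b. b \<in> B \<Longrightarrow> \<bar>representation B x b\<bar> \<le> C * norm x"
    using representation_bounded[OF finB B(2)] spB by auto
  show ?thesis
  proof (rule bounded_linear_intro)
    show "f (x + y) = f x + f y" "f (r *\<^sub>R x) = r *\<^sub>R f x" for x y r
      using assms(1) by (simp_all add: linear_add linear_scale)
    fix x
    have "f x = f (\<Sum>b\<in>B. representation B x b *\<^sub>R b)"
      using sum_representation_eq[OF B(2) _ finB order_refl, of x] spB by simp
    then have "f x = (\<Sum>b\<in>B. representation B x b *\<^sub>R f b)"
      by (simp add: linear_sum[OF assms(1)] linear_scale[OF assms(1)])
    then have "norm (f x) \<le> (\<Sum>b\<in>B. norm (representation B x b *\<^sub>R f b))"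
      by (simp only: norm_sum)
    also have "\<dots> \<le> (\<Sum>b\<in>B. C * norm x * norm (f b))"
      using C by (intro sum_mono) (simp add: mult_right_mono)
    also have "\<dots> = norm x * (C * (\<Sum>b\<in>B. norm (f b)))"
      by (simp add: sum_distrib_left sum_distrib_right algebra_simps)
    finally show "norm (f x) \<le> norm x * (C * (\<Sum>b\<in>B. norm (f b)))" .
  qed
qed

context fd_complex_space
begin

lemma bounded_linear_fd:
  fixes f :: "'a \<Rightarrow> 'b::real_normed_vector"
  assumes "linear f"
  shows "bounded_linear f"
proof (rule linear_bounded_finite_span[OF assms])
  define B where "B = extend_basis {}"
  show "finite (B \<union> sc \<i> ` B)"
    using finite_Basis by (simp add: B_def)
  show "Real_Vector_Spaces.span (B \<union> sc \<i> ` B) = UNIV"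
  proof (intro equalityI subsetI UNIV_I)
    fix x
    have eq: "sc z b = Re z *\<^sub>R b + Im z *\<^sub>R sc \<i> b" for z b
    proof -
      have "sc z b = sc (complex_of_real (Re z) + complex_of_real (Im z) * \<i>) b"
        by (simp add: complex_eq[symmetric] mult.commute)
      also have "\<dots> = Re z *\<^sub>R b + Im z *\<^sub>R sc \<i> b"
        by (simp only: scale_left_distrib flip: scale_scale scale_of_real)
      finally show ?thesis .
    qed
    have "x = (\<Sum>b\<in>B. sc (representation B x b) b)"
      using sum_representation_eq[OF independent_Basis _ finite_Basis order_refl, of x] span_Basis
      by (simp add: B_def)
    also have "\<dots> = (\<Sum>b\<in>B. Re (representation B x b) *\<^sub>R b + Im (representation B x b) *\<^sub>R sc \<i> b)"
      by (rule sum.cong[OF refl eq])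
    also have "\<dots> \<in> Real_Vector_Spaces.span (B \<union> sc \<i> ` B)"
      by (intro Real_Vector_Spaces.span_sum Real_Vector_Spaces.span_add Real_Vector_Spaces.span_scale
          Real_Vector_Spaces.span_base) auto
    finally show "x \<in> Real_Vector_Spaces.span (B \<union> sc \<i> ` B)" .
  qed
qed

lemma bounded_linear_scale_left: "bounded_linear (\<lambda>z. sc z v)"
proof -
  have "sc (r *\<^sub>R z) v = r *\<^sub>R sc z v" for r z
    by (simp add: scaleR_conv_of_real flip: scale_of_real)
  then have "linear (\<lambda>z. sc z v)"
    by (intro linearI) (simp_all add: scale_left_distrib)
  then show ?thesis
    by (simp add: linear_conv_bounded_linear)
qed

lemma endo_bounded_linear:
  assumes "endo f"
  shows "bounded_linear f"
proof (rule bounded_linear_fd)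
  have "f (r *\<^sub>R x) = r *\<^sub>R f x" for r x
    using endo_scale[OF assms, of "complex_of_real r" x] by (simp add: scale_of_real)
  then show "linear f"
    using endo_add[OF assms] by (intro linearI) auto
qed

text \<open>
  A derivative within \<open>X\<close> is not unique on the ambient space, only on directions in \<open>H\<close>: the curve
  \<open>r \<mapsto> x + r u\<close> stays in \<open>X\<close> for small \<open>r\<close>.
\<close>

lemma derivative_unique_along_subspace:
  fixes s :: "'a \<Rightarrow> 'b::real_normed_vector"
  assumes H: "subspace H" and X: "openin (top_of_set H) X" and x: "x \<in> X" and u: "u \<in> H"
    and D: "(s has_derivative D) (at x within X)" "(s has_derivative D') (at x within X)"
  shows "D u = D' u"
proof -
  obtain T where T: "open T" "X = H \<inter> T"
    using X by (auto simp: openin_open)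
  define g where "g r = x + r *\<^sub>R u" for r :: real
  have g: "(g has_derivative (\<lambda>r. r *\<^sub>R u)) (at 0 within g -` T)"
    unfolding g_def by (auto intro!: derivative_eq_intros)
  have "continuous_on UNIV g"
    unfolding g_def by (intro continuous_intros)
  then have op: "open (g -` T)"
    using T(1) by (simp add: continuous_on_open_vimage)
  have g0: "g 0 = x"
    by (simp add: g_def)
  have "r *\<^sub>R u \<in> H" for r
    using subspace_scale[OF H u, of "complex_of_real r"] by (simp add: scale_of_real)
  then have gX: "g ` (g -` T) \<subseteq> X"
    using T x H by (auto simp: g_def intro: subspace_add)
  have *: "((s \<circ> g) has_derivative (\<lambda>r. E (r *\<^sub>R u))) (at 0)"
    if "(s has_derivative E) (at x within X)" for E
  proof -
    have "(s has_derivative E) (at (g 0) within g ` (g -` T))"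
      unfolding g0 using that gX by (rule has_derivative_subset)
    from diff_chain_within[OF g this] have "((s \<circ> g) has_derivative (\<lambda>r. E (r *\<^sub>R u))) (at 0 within g -` T)"
      by (simp add: o_def)
    moreover have "(0::real) \<in> g -` T"
      using x T g0 by simp
    ultimately show ?thesis
      using op at_within_open by metis
  qed
  have "(\<lambda>r. D (r *\<^sub>R u)) = (\<lambda>r. D' (r *\<^sub>R u))"
    by (rule has_derivative_unique[OF *[OF D(1)] *[OF D(2)]])
  from fun_cong[OF this, of 1] show ?thesis
    by simp
qed

end

section \<open>The connection\<close>

context casimir_connection
begin

text \<open>
  A root is zero outside \<open>H\<close> and hence not linear on the whole algebra. On \<open>H\<close> it agrees with the form
  against its dual vector, which is linear and continuous everywhere and serves as its extension when
  derivatives are computed.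
\<close>

lemma root_bounded_linear: "bounded_linear (form (dual_vector c H \<alpha>))"
proof (rule bounded_linear_fd)
  have "form t (r *\<^sub>R x) = r *\<^sub>R form t x" for t r x
    using form_scale_right[of t "complex_of_real r" x] by (simp add: scale_of_real scaleR_conv_of_real)
  then show "linear (form (dual_vector c H \<alpha>))"
    by (intro linearI) (simp_all add: form_add_right)
qed

lemma regular_elements_eq:
  "regular_elements H = H \<inter> (\<Inter>\<alpha>\<in>roots H. {y. form (dual_vector c H \<alpha>) y \<noteq> 0})"
  by (auto simp: regular_elements_def form_dual_vector)

lemma openin_regular_elements: "openin (top_of_set H) (regular_elements H)"
proof -
  have "open {y. form (dual_vector c H \<alpha>) y \<noteq> 0}" for \<alpha>
  proof -
    have "continuous_on UNIV (form (dual_vector c H \<alpha>))"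
      using root_bounded_linear by (simp add: linear_continuous_on)
    then have "open (form (dual_vector c H \<alpha>) -` (- {0}))"
      by (simp add: continuous_on_open_vimage open_Compl)
    then show ?thesis
      by (simp add: vimage_def)
  qed
  then have "open (\<Inter>\<alpha>\<in>roots H. {y. form (dual_vector c H \<alpha>) y \<noteq> 0})"
    using finite_roots by blast
  then show ?thesis
    unfolding regular_elements_eq openin_open by blast
qed

definition casimir_form_derivative :: "complex \<Rightarrow> 'g \<Rightarrow> 'g \<Rightarrow> 'v \<Rightarrow> 'g \<Rightarrow> 'v" where
  "casimir_form_derivative h x u v w =
     scV (- h) (\<Sum>\<alpha>\<in>roots H. scV (- (\<alpha> u * form (dual_vector c H \<alpha>) w) / (\<alpha> x)\<^sup>2) (\<kappa> \<alpha> v))"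

lemma casimir_form_has_derivative:
  assumes x: "x \<in> regular_elements H"
  shows "((\<lambda>y. \<omega> h y u v) has_derivative casimir_form_derivative h x u v) (at x within regular_elements H)"
proof -
  define a where "a \<alpha> = form (dual_vector c H \<alpha>)" for \<alpha>
  have xH: "x \<in> H"
    using x by (simp add: regular_elements_def)
  have ax: "a \<alpha> y = \<alpha> y" if "\<alpha> \<in> roots H" "y \<in> H" for \<alpha> y
    using form_dual_vector that by (simp add: a_def)
  have summand: "((\<lambda>y. scV (\<alpha> u / a \<alpha> y) (\<kappa> \<alpha> v)) has_derivative
      (\<lambda>w. scV (- (\<alpha> u * a \<alpha> w) / (\<alpha> x)\<^sup>2) (\<kappa> \<alpha> v))) (at x within regular_elements H)"
    if \<alpha>: "\<alpha> \<in> roots H" for \<alpha>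
  proof -
    have ne: "a \<alpha> x \<noteq> 0"
      using x \<alpha> ax[OF \<alpha> xH] by (simp add: regular_elements_def)
    have "(a \<alpha> has_derivative a \<alpha>) (at x within regular_elements H)"
      unfolding a_def using root_bounded_linear by (rule bounded_linear_imp_has_derivative)
    then have "((\<lambda>y. \<alpha> u / a \<alpha> y) has_derivative (\<lambda>w. - (\<alpha> u * a \<alpha> w) / (a \<alpha> x)\<^sup>2)) (at x within regular_elements H)"
      using ne by (auto intro!: derivative_eq_intros simp: power2_eq_square field_simps)
    then have "((\<lambda>y. \<alpha> u / a \<alpha> y) has_derivative (\<lambda>w. - (\<alpha> u * a \<alpha> w) / (\<alpha> x)\<^sup>2)) (at x within regular_elements H)"
      by (simp add: ax[OF \<alpha> xH])
    then show ?thesis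
      by (rule bounded_linear.has_derivative[OF V.bounded_linear_scale_left])
  qed
  have "((\<lambda>y. \<Sum>\<alpha>\<in>roots H. scV (\<alpha> u / a \<alpha> y) (\<kappa> \<alpha> v)) has_derivative
      (\<lambda>w. \<Sum>\<alpha>\<in>roots H. scV (- (\<alpha> u * a \<alpha> w) / (\<alpha> x)\<^sup>2) (\<kappa> \<alpha> v))) (at x within regular_elements H)"
    by (rule has_derivative_sum[OF summand])
  then have *: "((\<lambda>y. scV (- h) (\<Sum>\<alpha>\<in>roots H. scV (\<alpha> u / a \<alpha> y) (\<kappa> \<alpha> v))) has_derivative
      casimir_form_derivative h x u v) (at x within regular_elements H)"
    unfolding casimir_form_derivative_def[abs_def] a_def
    by (rule bounded_linear.has_derivative[OF V.endo_bounded_linear[OF V.endo_scaled[OF V.endo_ident]]])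
  show ?thesis
    by (rule has_derivative_transform[OF x _ *])
      (auto simp: casimir_form_def regular_elements_def ax intro!: arg_cong[where f = "scV (- h)"] sum.cong)
qed

lemma frechet_derivative_along_H:
  assumes X: "openin (top_of_set H) X" and x: "x \<in> X" and u: "u \<in> H"
    and D: "(s has_derivative D) (at x within X)"
  shows "frechet_derivative s (at x within X) u = D u"
proof (rule derivative_unique_along_subspace[OF subspace_H X x u _ D])
  show "(s has_derivative frechet_derivative s (at x within X)) (at x within X)"
    using D frechet_derivative_works unfolding differentiable_def by blast
qed

text \<open>This symmetry says that the one-form is closed.\<close>

lemma casimir_form_derivative_symmetric:
  assumes "u \<in> H" "u' \<in> H"
  shows "casimir_form_derivative h x u v u' = casimir_form_derivative h x u' v u"
  using assms by (simp add: casimir_form_derivative_def form_dual_vector mult.commute)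

theorem casimir_connection_flat: "flat_connection H (regular_elements H) (\<omega> h)"
  unfolding flat_connection_def curvature_def
proof (intro ballI allI)
  fix x u u' v assume x: "x \<in> regular_elements H" and u: "u \<in> H" "u' \<in> H"
  have fd: "frechet_derivative (\<lambda>y. \<omega> h y w v) (at x within regular_elements H) w'
      = casimir_form_derivative h x w v w'" if "w' \<in> H" for w w'
    by (rule frechet_derivative_along_H[OF openin_regular_elements x that casimir_form_has_derivative[OF x]])
  show "frechet_derivative (\<lambda>y. \<omega> h y u' v) (at x within regular_elements H) u
      - frechet_derivative (\<lambda>y. \<omega> h y u v) (at x within regular_elements H) u'
      + (\<omega> h x u (\<omega> h x u' v) - \<omega> h x u' (\<omega> h x u v)) = 0"
    using fd u casimir_form_derivative_symmetric[OF u] casimir_form_commutes[OF x u] by simp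
qed

theorem casimir_connection_holomorphic: "holomorphic_connection_form sc scV H (regular_elements H) (\<omega> h)"
  unfolding holomorphic_connection_form_def
proof (intro conjI ballI allI)
  show "openin (top_of_set H) (regular_elements H)"
    by (rule openin_regular_elements)
  show "Vector_Spaces.linear scV scV (\<omega> h x u)" for x u
    using casimir_form_endo by simp
  show "\<omega> h x (u + u') v = \<omega> h x u v + \<omega> h x u' v" if "u \<in> H" "u' \<in> H" for x u u' v
    using that by (simp add: casimir_form_def root_linear(1) add_divide_distrib V.scale_left_distrib
        sum.distrib V.scale_right_distrib)
  show "\<omega> h x (sc a u) v = scV a (\<omega> h x u v)" if "u \<in> H" for x a u v
  proof -
    have "\<omega> h x (sc a u) v = scV (- h) (\<Sum>\<alpha>\<in>roots H. scV a (scV (\<alpha> u / \<alpha> x) (\<kappa> \<alpha> v)))"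
      using that by (simp add: casimir_form_def root_linear(2))
    then show ?thesis
      unfolding casimir_form_def V.scale_sum_right[symmetric] using V.scale_left_commute by simp
  qed
  show "holomorphic_map sc scV H (regular_elements H) (\<lambda>x. \<omega> h x u v)" for u v
    unfolding holomorphic_map_def
  proof (intro ballI exI conjI allI)
    show "((\<lambda>x. \<omega> h x u v) has_derivative casimir_form_derivative h x u v) (at x within regular_elements H)"
      if "x \<in> regular_elements H" for x
      by (rule casimir_form_has_derivative[OF that])
    show "casimir_form_derivative h x u v (sc a w) = scV a (casimir_form_derivative h x u v w)" for x a w
    proof -
      have "casimir_form_derivative h x u v (sc a w) = scV (- h) (\<Sum>\<alpha>\<in>roots H.
          scV a (scV (- (\<alpha> u * form (dual_vector c H \<alpha>) w) / (\<alpha> x)\<^sup>2) (\<kappa> \<alpha> v)))"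
        by (simp add: casimir_form_derivative_def form_scale_right mult.left_commute)
      then show ?thesis
        unfolding casimir_form_derivative_def V.scale_sum_right[symmetric] using V.scale_left_commute by simp
    qed
  qed
qed

text \<open>
  A weight space is cut out by the maps \<open>\<phi> = \<rho> y - \<mu> y\<close>. They are bounded linear and vanish on the
  section, so they vanish on its derivative along \<open>H\<close>.
\<close>

theorem preserves_weight_subbundle:
  "preserves_subbundle sc scV H (regular_elements H) (\<omega> h) (weight_space scV \<rho> H \<mu>)"
  unfolding preserves_subbundle_def
proof (intro allI impI ballI)
  fix U s x u
  assume a: "openin (top_of_set H) U \<and> U \<subseteq> regular_elements H \<and> holomorphic_map sc scV H U s \<and>
      s ` U \<subseteq> weight_space scV \<rho> H \<mu>"
    and x: "x \<in> U" and u: "u \<in> H"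
  have op: "openin (top_of_set H) U" and sW: "\<And>y. y \<in> U \<Longrightarrow> s y \<in> weight_space scV \<rho> H \<mu>"
    using a by auto
  obtain D where D: "(s has_derivative D) (at x within U)"
    using a x by (auto simp: holomorphic_map_def)
  have "\<rho> y (D u) = scV (\<mu> y) (D u)" if y: "y \<in> H" for y
  proof -
    define \<phi> where "\<phi> v = \<rho> y v - scV (\<mu> y) v" for v
    have "bounded_linear \<phi>"
      unfolding \<phi>_def by (rule V.endo_bounded_linear[OF V.endo_shift[OF rep_endo]])
    then have "((\<lambda>z. \<phi> (s z)) has_derivative (\<lambda>w. \<phi> (D w))) (at x within U)"
      using D by (rule bounded_linear.has_derivative)
    moreover have "((\<lambda>z. \<phi> (s z)) has_derivative (\<lambda>w. 0)) (at x within U)"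
      by (rule has_derivative_transform[OF x _ has_derivative_const[of 0]])
        (use sW y in \<open>simp add: \<phi>_def weight_space_def\<close>)
    ultimately have "\<phi> (D u) = 0"
      by (rule derivative_unique_along_subspace[OF subspace_H op x u])
    then show ?thesis
      by (simp add: \<phi>_def)
  qed
  then have "D u \<in> weight_space scV \<rho> H \<mu>"
    by (simp add: weight_space_def)
  moreover have "\<omega> h x u (s x) \<in> weight_space scV \<rho> H \<mu>"
    using casimir_form_weight sW[OF x] by blast
  ultimately show "covariant_derivative (\<omega> h) U s x u \<in> weight_space scV \<rho> H \<mu>"
    unfolding covariant_derivative_def frechet_derivative_along_H[OF op x u D]
    by (simp add: weight_space_def rep_add V.scale_right_distrib)
qed

end

theorem theorem1p1:
  fixes sc :: "complex \<Rightarrow> 'g::real_normed_vector \<Rightarrow> 'g"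
    and br :: "'g \<Rightarrow> 'g \<Rightarrow> 'g"
    and H :: "'g set"
    and scV :: "complex \<Rightarrow> 'v::real_normed_vector \<Rightarrow> 'v"
    and \<rho> :: "'g \<Rightarrow> 'v \<Rightarrow> 'v"
    and c h :: complex
    and e f :: "('g \<Rightarrow> complex) \<Rightarrow> 'g"
  defines "X \<equiv> lie_algebra.regular_elements sc br H"
    and "\<omega> \<equiv> lie_module.casimir_form sc br scV \<rho> c H e f h"
  assumes "lie_algebra sc br"
    and "lie_algebra.semisimple sc br"
    and "lie_algebra.cartan_subalgebra sc br H"
    and "lie_module sc br scV \<rho>"
    and "c \<noteq> 0"
    and "lie_algebra.root_vectors sc br c H e f"
  shows "holomorphic_connection_form sc scV H X \<omega>
    \<and> flat_connection H X \<omega>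
    \<and> (\<forall>\<mu>\<in>lie_module.weights sc scV \<rho> H.
         preserves_subbundle sc scV H X \<omega> (weight_space scV \<rho> H \<mu>))"
proof -
  interpret lie_module sc br scV \<rho>
    by fact
  interpret casimir_connection sc br H c scV \<rho> e f
    by unfold_locales (use assms in auto)
  show ?thesis
    unfolding X_def \<omega>_def using casimir_connection_holomorphic casimir_connection_flat preserves_weight_subbundle by blast
qed

end
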